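(* Let $u^\varepsilon$ be the solution of Problem $(P^\varepsilon)$ and let $\eta$ be an arbitrary constant satisfying $0<\eta<\eta_0$. Then there exist positive constants $\varepsilon_0$ and $M_0$ such that, for all $\varepsilon\in(0,\varepsilon_0)$, the following holds: (i) for all $x\in D$, $\ \alpha_--\eta\le u^\varepsilon(x,t^\varepsilon)\le \alpha_++\eta$; (ii) if $u_0(x)\ge \alpha+M_0\varepsilon$, then $u^\varepsilon(x,t^\varepsilon)\ge \alpha_+-\eta$; (iii) if $u_0(x)\le \alpha-M_0\varepsilon$, then $u^\varepsilon(x,t^\varepsilon)\le \alpha_-+\eta$.
   Context: Let $N\ge 2$, let $D\subset\mathbb{R}^N$ be a smooth bounded domain with outward unit normal $\nu$ on $\partial D$, and let $\varepsilon>0$ be a small parameter. Problem $(P^\varepsilon)$ is $$u_t=\Delta\varphi(u)+\frac1{\varepsilon^2}f(u)\ \text{ in } D\times\mathbb{R}^+,\qquad \frac{\partial\varphi(u)}{\partial\nu}=0\ \text{ on }\partial D\times\mathbb{R}^+,\qquad u(x,0)=u_0(x)\ \text{ for }x\in D.$$ It possesses a unique classical solution, denoted $u^\varepsilon$. Assumptions on $f$: $f\in C^2(\mathbb{R})$ has exactly three zeros $\alpha_-<\alpha<\alpha_+$, with $f'(\alpha_-)<0$, $f'(\alpha_+)<0$, $f'(\alpha)>0$, so that $f(s)>0$ for $s<\alpha_-$ and $f(s)<0$ for $s>\alpha_+$. Assumptions on $\varphi$: $\varphi\in C^4(\mathbb{R})$ and $\varphi'\ge C_\varphi$ for some constant $C_\varphi>0$.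 Relation: $\int_{\alpha_-}^{\alpha_+}\varphi'(s)f(s)\,ds=0$. Assumptions on $u_0$: $u_0\in C^2(\overline D)$; the set $\Gamma_0:=\{x\in D: u_0(x)=\alpha\}$ is a $C^{4+\vartheta}$ hypersurface without boundary for some $0<\vartheta<1$, $\Gamma_0\Subset D$, and $\nabla u_0(x)\cdot n(x)\ne0$ for $x\in\Gamma_0$; $u_0>\alpha$ in $D_0^+$ and $u_0<\alpha$ in $D_0^-$. Here $D_0^-$ is the region enclosed by $\Gamma_0$, $D_0^+$ is the region enclosed between $\partial D$ and $\Gamma_0$, and $n$ is the outward normal vector to $D_0^-$. Notation: $\mu=f'(\alpha)$, $t^\varepsilon=\mu^{-1}\varepsilon^2|\ln\varepsilon|$, $\eta_0=\min(\alpha-\alpha_-,\alpha_+-\alpha)$. *)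

theory Defs
  imports "HOL-Analysis.Analysis"
begin

text \<open>Classes of differentiable functions. \<open>Ck_on k g S\<close> is meant for open \<open>S\<close>; with \<open>'a = real\<close>
  and \<open>S = UNIV\<close> it is $C^k(\mathbb R)$, since \<open>Basis = {1}\<close> there.\<close>

fun Ck_on :: "nat \<Rightarrow> ('a::euclidean_space \<Rightarrow> real) \<Rightarrow> 'a set \<Rightarrow> bool" where
  "Ck_on 0 g S \<longleftrightarrow> continuous_on S g"
| "Ck_on (Suc k) g S \<longleftrightarrow>
     (\<forall>x\<in>S. g differentiable (at x)) \<and>
     (\<forall>b\<in>Basis. Ck_on k (\<lambda>x. frechet_derivative g (at x) b) S)"

text \<open>$C^k(\overline D)$ for open \<open>D\<close>: all partial derivatives up to order \<open>k\<close> exist in \<open>D\<close> and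
  extend continuously to the closure; the witness \<open>h\<close> below is the extension.\<close>

fun Ck_closure :: "nat \<Rightarrow> ('a::euclidean_space \<Rightarrow> real) \<Rightarrow> 'a set \<Rightarrow> bool" where
  "Ck_closure 0 g D \<longleftrightarrow> continuous_on (closure D) g"
| "Ck_closure (Suc k) g D \<longleftrightarrow>
     continuous_on (closure D) g \<and>
     (\<forall>x\<in>D. g differentiable (at x)) \<and>
     (\<forall>b\<in>Basis. \<exists>h. Ck_closure k h D \<and> (\<forall>x\<in>D. h x = frechet_derivative g (at x) b))"

definition holder_on :: "real \<Rightarrow> ('a::metric_space \<Rightarrow> real) \<Rightarrow> 'a set \<Rightarrow> bool" where
  "holder_on \<theta> g S \<longleftrightarrow> (\<exists>C. \<forall>x\<in>S. \<forall>y\<in>S. \<bar>g x - g y\<bar> \<le> C * dist x y powr \<theta>)"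

fun Ck_holder_on :: "nat \<Rightarrow> real \<Rightarrow> ('a::euclidean_space \<Rightarrow> real) \<Rightarrow> 'a set \<Rightarrow> bool" where
  "Ck_holder_on 0 \<theta> g S \<longleftrightarrow> continuous_on S g \<and> holder_on \<theta> g S"
| "Ck_holder_on (Suc k) \<theta> g S \<longleftrightarrow>
     (\<forall>x\<in>S. g differentiable (at x)) \<and>
     (\<forall>b\<in>Basis. Ck_holder_on k \<theta> (\<lambda>x. frechet_derivative g (at x) b) S)"

definition gradient :: "('a::euclidean_space \<Rightarrow> real) \<Rightarrow> 'a \<Rightarrow> 'a" where
  "gradient g x = (\<Sum>b\<in>Basis. frechet_derivative g (at x) b *\<^sub>R b)"

definition laplacian :: "('a::euclidean_space \<Rightarrow> real) \<Rightarrow> 'a \<Rightarrow> real" where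
  "laplacian g x =
     (\<Sum>b\<in>Basis. frechet_derivative (\<lambda>y. frechet_derivative g (at y) b) (at x) b)"

text \<open>\<open>D\<close> lies locally on one side of its boundary: inside \<open>U\<close> it is the sublevel set of a \<open>C\<^sup>1\<close>
  function without critical points, so that \<open>frontier D \<inter> U\<close> is the zero set of \<open>\<rho>\<close> in \<open>U\<close> and the
  gradient of \<open>\<rho>\<close> points out of \<open>D\<close> there.\<close>

definition local_defining_function ::
  "'a::euclidean_space set \<Rightarrow> 'a set \<Rightarrow> ('a \<Rightarrow> real) \<Rightarrow> bool" where
  "local_defining_function D U \<rho> \<longleftrightarrow>
     open U \<and> Ck_on 1 \<rho> U \<and> (\<forall>y\<in>U. gradient \<rho> y \<noteq> 0) \<and> D \<inter> U = {y\<in>U. \<rho> y < 0}"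

definition outward_unit_normal :: "'a::euclidean_space set \<Rightarrow> 'a \<Rightarrow> 'a \<Rightarrow> bool" where
  "outward_unit_normal D x n \<longleftrightarrow>
     x \<in> frontier D \<and>
     (\<exists>U \<rho>. local_defining_function D U \<rho> \<and> x \<in> U \<and>
             n = gradient \<rho> x /\<^sub>R norm (gradient \<rho> x))"

definition smooth_bounded_domain :: "'a::euclidean_space set \<Rightarrow> bool" where
  "smooth_bounded_domain D \<longleftrightarrow>
     open D \<and> connected D \<and> D \<noteq> {} \<and> bounded D \<and>
     (\<forall>x\<in>frontier D. \<exists>U \<rho>. x \<in> U \<and> local_defining_function D U \<rho> \<and> (\<forall>k. Ck_on k \<rho> U))"

definition Ck_holder_hypersurface ::
  "nat \<Rightarrow> real \<Rightarrow> 'a::euclidean_space set \<Rightarrow> bool" where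
  "Ck_holder_hypersurface k \<theta> \<Gamma> \<longleftrightarrow>
     (\<forall>x\<in>\<Gamma>. \<exists>U g. open U \<and> x \<in> U \<and> Ck_holder_on k \<theta> g U \<and>
                     (\<forall>y\<in>U. gradient g y \<noteq> 0) \<and> \<Gamma> \<inter> U = {y\<in>U. g y = 0})"

text \<open>\<open>\<Gamma>\<close> splits \<open>D\<close> into the region \<open>Dm\<close> enclosed by \<open>\<Gamma>\<close> and the region \<open>Dp\<close> between the boundary
  of \<open>D\<close> and \<open>\<Gamma>\<close>. Neither part is required to be connected, so \<open>\<Gamma>\<close> may have several components.\<close>

definition separates_into ::
  "'a::euclidean_space set \<Rightarrow> 'a set \<Rightarrow> 'a set \<Rightarrow> 'a set \<Rightarrow> bool" where
  "separates_into \<Gamma> D Dm Dp \<longleftrightarrow>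
     open Dm \<and> open Dp \<and> Dm \<inter> Dp = {} \<and> Dm \<union> Dp = D - \<Gamma> \<and>
     frontier Dm = \<Gamma> \<and> frontier Dp = frontier D \<union> \<Gamma>"

definition C21_on :: "('a::euclidean_space \<Rightarrow> real \<Rightarrow> real) \<Rightarrow> 'a set \<Rightarrow> bool" where
  "C21_on u D \<longleftrightarrow>
     (\<forall>t>0. Ck_on 2 (\<lambda>x. u x t) D) \<and>
     (\<forall>x\<in>D. \<forall>t>0. (\<lambda>s. u x s) differentiable (at t)) \<and>
     continuous_on (D \<times> {0<..}) (\<lambda>(x, t). deriv (\<lambda>s. u x s) t) \<and>
     (\<forall>b\<in>Basis. continuous_on (D \<times> {0<..})
        (\<lambda>(x, t). frechet_derivative (\<lambda>y. u y t) (at x) b)) \<and>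
     (\<forall>b\<in>Basis. \<forall>c\<in>Basis. continuous_on (D \<times> {0<..})
        (\<lambda>(x, t). frechet_derivative (\<lambda>z. frechet_derivative (\<lambda>y. u y t) (at z) b) (at x) c))"

text \<open>\<open>u x t\<close> is a classical solution on $D\times\mathbb R^+$ of
  $u_t=\Delta\varphi(u)+\varepsilon^{-2}f(u)$. Continuity is required up to the boundary and up to
  \<open>t = 0\<close>, but no derivative is required to be continuous at \<open>t = 0\<close>, because \<open>u0\<close> need not satisfy
  the Neumann condition. The normal derivative on the boundary is the one-sided one, taken from
  inside \<open>D\<close>.\<close>

definition classical_solution ::
  "'a::euclidean_space set \<Rightarrow> ('a \<Rightarrow> 'a) \<Rightarrow> (real \<Rightarrow> real) \<Rightarrow> (real \<Rightarrow> real) \<Rightarrow> ('a \<Rightarrow> real) \<Rightarrow> real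
    \<Rightarrow> ('a \<Rightarrow> real \<Rightarrow> real) \<Rightarrow> bool" where
  "classical_solution D \<nu> \<phi> f u0 \<epsilon> u \<longleftrightarrow>
     continuous_on (closure D \<times> {0..}) (\<lambda>(x, t). u x t) \<and>
     C21_on u D \<and>
     (\<forall>x\<in>D. \<forall>t>0.
        deriv (\<lambda>s. u x s) t = laplacian (\<lambda>y. \<phi> (u y t)) x + 1 / \<epsilon>\<^sup>2 * f (u x t)) \<and>
     (\<forall>x\<in>frontier D. \<forall>t>0.
        ((\<lambda>s. \<phi> (u (x + s *\<^sub>R \<nu> x) t)) has_real_derivative 0) (at_left 0)) \<and>
     (\<forall>x\<in>D. u x 0 = u0 x)"

end

theory Submission
  imports Defs "HOL-Real_Asymp.Real_Asymp"
begin

text \<open>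
  Both halves follow from lower bounds, the upper ones by the reflection \<open>u \<mapsto> - u\<close>.  Choose an increasing
  coordinate \<open>\<Theta>\<close> vanishing at \<open>0\<close> with \<open>\<Theta>'(y) f(\<alpha> + y) \<ge> \<mu> \<Theta>(y)\<close>, and a concave bounded \<open>J\<close> with
  \<open>J(0) = 0\<close>, so that \<open>z J'(z) \<le> J(z)\<close>.  If \<open>\<Theta>(u - \<alpha>)\<close> touches \<open>J(z)\<close> from above, then \<open>z\<close> satisfies
  \<open>z_t \<ge> \<mu> z / \<epsilon>\<^sup>2 - C (\<bar>D\<^sup>2 z\<bar> + \<bar>\<nabla>z\<bar>\<^sup>2)\<close>.  This is violated by
  \<open>z = exp (\<mu> t / \<epsilon>\<^sup>2) (\<zeta>(x) - p(t))\<close>, where \<open>p\<close> stays of order \<open>\<epsilon>\<close> up to \<open>t = \<epsilon>\<^sup>2 \<bar>ln \<epsilon>\<bar> / \<mu>\<close> as soon as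
  \<open>\<bar>\<nabla>\<zeta>\<bar> = O(1)\<close> and \<open>\<bar>D\<^sup>2 \<zeta>\<bar> = O(1 / (\<epsilon> \<bar>ln \<epsilon>\<bar>))\<close>.  At that time \<open>z \<ge> \<zeta> / \<epsilon> - C\<close>, which is large
  where \<open>\<zeta> \<ge> M \<epsilon>\<close>.  The freedom in the second derivatives of \<open>\<zeta> \<le> u0 - \<alpha>\<close> is spent on making \<open>\<zeta>\<close>
  strictly increasing along the inward normal, which excludes touching on the boundary.  The datum may
  take the value \<open>\<alpha>\<close> on the boundary of \<open>D\<close>, since \<open>\<Gamma>\<^sub>0\<close> is only defined inside \<open>D\<close>.
\<close>

subsection \<open>Second derivatives along coordinate lines\<close>

text \<open>The size 1 / (\<epsilon> |ln \<epsilon>|) allowed for second derivatives is critical: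
  over a time \<epsilon>^2 |ln \<epsilon>| / \<mu> it integrates to \<epsilon> / \<mu>. The squared
  gradient enters p' with the weight exp (\<mu> t / \<epsilon>^2), whose integral up to the time
  when the weight is 1 / \<epsilon> is again at most \<epsilon> / \<mu>. Both therefore cost exactly
  the order at which the theorem resolves u0. J is bounded so that touching forces u to lie below a
  level short of the upper stable zero; the lower estimate thus does not presuppose an upper one.
  The two signs differ at the boundary of D. The set where u0 <= \<alpha> keeps a positive distance
  from it, so for the upper bounds a boundary layer of width \<epsilon> |ln \<epsilon>| is
  exponentially small where it matters. For the lower bounds u0 - \<alpha> may vanish on the
  boundary while decreasing inwards, and correcting this slope at a cost of order \<epsilon> uses
  that a nonnegative function with bounded second derivative cannot be steep where it is small.
  Hence two constructions of \<zeta>.\<close>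

definition line_C2 :: "'a::euclidean_space set \<Rightarrow> ('a \<Rightarrow> real) \<Rightarrow> ('a \<Rightarrow> 'a \<Rightarrow> real) \<Rightarrow>
    ('a \<Rightarrow> 'a \<Rightarrow> real) \<Rightarrow> bool" where
  "line_C2 D g g1 g2 \<longleftrightarrow> (\<forall>x\<in>D. \<forall>b\<in>Basis.
     ((\<lambda>s. g (x + s *\<^sub>R b)) has_real_derivative g1 b x) (at 0) \<and>
     ((\<lambda>s. g1 b (x + s *\<^sub>R b)) has_real_derivative g2 b x) (at 0))"

lemma line_C2_const: "line_C2 D (\<lambda>x. c) (\<lambda>b x. 0) (\<lambda>b x. 0)"
  by (auto simp: line_C2_def)

lemma line_C2_add:
  assumes "line_C2 D g g1 g2" "line_C2 D h h1 h2"
  shows "line_C2 D (\<lambda>x. g x + h x) (\<lambda>b x. g1 b x + h1 b x) (\<lambda>b x. g2 b x + h2 b x)"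
  using assms unfolding line_C2_def by (auto intro!: derivative_eq_intros)

lemma line_C2_cmult:
  assumes "line_C2 D g g1 g2"
  shows "line_C2 D (\<lambda>x. c * g x) (\<lambda>b x. c * g1 b x) (\<lambda>b x. c * g2 b x)"
  using assms unfolding line_C2_def by (auto intro!: derivative_eq_intros)

lemma line_C2_compose:
  fixes A :: "real \<Rightarrow> real"
  assumes g: "line_C2 D g g1 g2"
    and A1: "\<And>y. (A has_real_derivative A1 y) (at y)"
    and A2: "\<And>y. (A1 has_real_derivative A2 y) (at y)"
  shows "line_C2 D (\<lambda>x. A (g x)) (\<lambda>b x. A1 (g x) * g1 b x)
    (\<lambda>b x. A1 (g x) * g2 b x + A2 (g x) * (g1 b x)\<^sup>2)"
proof -
  have "((\<lambda>s. A (g (x + s *\<^sub>R b))) has_real_derivative A1 (g x) * g1 b x) (at 0)"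
    "((\<lambda>s. A1 (g (x + s *\<^sub>R b)) * g1 b (x + s *\<^sub>R b)) has_real_derivative
      A1 (g x) * g2 b x + A2 (g x) * (g1 b x)\<^sup>2) (at 0)"
    if "x \<in> D" "b \<in> Basis" for x b
  proof -
    have 1: "((\<lambda>s. g (x + s *\<^sub>R b)) has_real_derivative g1 b x) (at 0)"
      and 2: "((\<lambda>s. g1 b (x + s *\<^sub>R b)) has_real_derivative g2 b x) (at 0)"
      using g that by (auto simp: line_C2_def)
    show "((\<lambda>s. A (g (x + s *\<^sub>R b))) has_real_derivative A1 (g x) * g1 b x) (at 0)"
      using DERIV_chain2[of A "A1 (g x)" "\<lambda>s. g (x + s *\<^sub>R b)" 0 "g1 b x"] A1 1 by simp
    have "((\<lambda>s. A1 (g (x + s *\<^sub>R b))) has_real_derivative A2 (g x) * g1 b x) (at 0)"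
      using DERIV_chain2[of A1 "A2 (g x)" "\<lambda>s. g (x + s *\<^sub>R b)" 0 "g1 b x"] A2 1 by simp
    from DERIV_mult[OF this 2]
    show "((\<lambda>s. A1 (g (x + s *\<^sub>R b)) * g1 b (x + s *\<^sub>R b)) has_real_derivative
      A1 (g x) * g2 b x + A2 (g x) * (g1 b x)\<^sup>2) (at 0)"
      by (simp add: power2_eq_square algebra_simps)
  qed
  then show ?thesis by (auto simp: line_C2_def)
qed

lemma line_C2_mult:
  assumes "line_C2 D g g1 g2" "line_C2 D h h1 h2"
  shows "line_C2 D (\<lambda>x. g x * h x) (\<lambda>b x. g1 b x * h x + g x * h1 b x)
    (\<lambda>b x. g2 b x * h x + 2 * g1 b x * h1 b x + g x * h2 b x)"
  using assms unfolding line_C2_def by (auto intro!: derivative_eq_intros)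

lemma line_C2_sum:
  assumes "finite I" "\<And>i. i \<in> I \<Longrightarrow> line_C2 D (g i) (g1 i) (g2 i)"
  shows "line_C2 D (\<lambda>x. \<Sum>i\<in>I. g i x) (\<lambda>b x. \<Sum>i\<in>I. g1 i b x) (\<lambda>b x. \<Sum>i\<in>I. g2 i b x)"
  using assms by (induction I) (auto intro: line_C2_const line_C2_add)

lemma line_C2_subset: "line_C2 D g g1 g2 \<Longrightarrow> E \<subseteq> D \<Longrightarrow> line_C2 E g g1 g2"
  by (auto simp: line_C2_def)

lemma line_C2_deriv_along:
  assumes "line_C2 D g g1 g2" "x + s *\<^sub>R b \<in> D" "b \<in> Basis"
  shows "((\<lambda>s. g (x + s *\<^sub>R b)) has_real_derivative g1 b (x + s *\<^sub>R b)) (at s)"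
proof -
  have "((\<lambda>r. g ((x + s *\<^sub>R b) + r *\<^sub>R b)) has_real_derivative g1 b (x + s *\<^sub>R b)) (at 0)"
    using assms by (auto simp: line_C2_def)
  then have "((\<lambda>r. g (x + (r + s) *\<^sub>R b)) has_real_derivative g1 b (x + s *\<^sub>R b)) (at 0)"
    by (simp add: scaleR_add_left add_ac)
  then show ?thesis using DERIV_shift[of "\<lambda>s. g (x + s *\<^sub>R b)" _ 0 s] by simp
qed

section \<open>Minima and first touching times\<close>

lemma second_derivative_nonneg_at_min:
  fixes k :: "real \<Rightarrow> real"
  assumes "\<delta> > 0" and k1: "\<And>s. \<bar>s\<bar> < \<delta> \<Longrightarrow> (k has_real_derivative k1 s) (at s)"
    and k2: "(k1 has_real_derivative k2) (at 0)"
    and min: "\<And>s. \<bar>s\<bar> < \<delta> \<Longrightarrow> k 0 \<le> k s"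
  shows "k1 0 = 0" "k2 \<ge> 0"
proof -
  show 0: "k1 0 = 0"
    using DERIV_local_min[OF k1[of 0] \<open>\<delta> > 0\<close>] min \<open>\<delta> > 0\<close> by auto
  show "k2 \<ge> 0"
  proof (rule ccontr)
    assume "\<not> k2 \<ge> 0"
    then obtain e where e: "e > 0" "\<And>h. 0 < h \<Longrightarrow> h < e \<Longrightarrow> k1 h < k1 0"
      using DERIV_neg_dec_right[OF k2] by auto
    define h where "h = min (e/2) (\<delta>/2)"
    have h: "0 < h" "h < e" "h < \<delta>" using e \<open>\<delta> > 0\<close> by (auto simp: h_def)
    obtain w where "0 < w" "w < h" "k h - k 0 = (h - 0) * k1 w"
      using MVT2[of 0 h k k1] k1 h by force
    moreover have "k1 w < 0" using e(2)[of w] 0 calculation h by auto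
    ultimately have "k h < k 0" using h(1) by (smt (verit) mult_pos_neg)
    with min[of h] h show False by auto
  qed
qed

lemma derivative_nonpos_at_left_min:
  fixes k :: "real \<Rightarrow> real"
  assumes "(k has_real_derivative d) (at t)" "\<delta> > 0"
    and "\<And>s. t - \<delta> < s \<Longrightarrow> s < t \<Longrightarrow> k t \<le> k s"
  shows "d \<le> 0"
proof (rule ccontr)
  assume "\<not> d \<le> 0"
  then obtain e where e: "e > 0" "\<And>h. 0 < h \<Longrightarrow> h < e \<Longrightarrow> k (t - h) < k t"
    using DERIV_pos_inc_left[OF assms(1)] by auto
  define h where "h = min (e/2) (\<delta>/2)"
  have h: "0 < h" "h < e" "h < \<delta>" using e \<open>\<delta> > 0\<close> by (auto simp: h_def)
  with e(2)[of h] assms(3)[of "t - h"] show False by auto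
qed

text \<open>The Laplacian sees only pure second derivatives, so the one-variable test on each
  coordinate line is enough; this is why \<open>line_C2\<close> records neither mixed derivatives
  nor continuity.\<close>

lemma line_C2_min:
  assumes "open D" "x \<in> D" "b \<in> Basis" "line_C2 D k k1 k2" "\<And>y. y \<in> D \<Longrightarrow> k x \<le> k y"
  shows "k1 b x = 0" "k2 b x \<ge> 0"
proof -
  obtain \<delta> where \<delta>: "\<delta> > 0" "ball x \<delta> \<subseteq> D" using assms(1,2) openE by blast
  have in_D: "x + s *\<^sub>R b \<in> D" if "\<bar>s\<bar> < \<delta>" for s
    using \<delta> that assms(3) by (auto simp: dist_norm subset_iff)
  have "(\<lambda>s. k1 b (x + s *\<^sub>R b)) 0 = 0 \<and> k2 b x \<ge> 0"
    using second_derivative_nonneg_at_min[OF \<delta>(1), of "\<lambda>s. k (x + s *\<^sub>R b)" "\<lambda>s. k1 b (x + s *\<^sub>R b)" "k2 b x"]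
      line_C2_deriv_along[OF assms(4) in_D assms(3)] assms(2,3,4,5) in_D
    by (auto simp: line_C2_def)
  then show "k1 b x = 0" "k2 b x \<ge> 0" by auto
qed

text \<open>Compactness yields an earliest time at which k is nonpositive somewhere. The initial
  sign makes this time positive, and k vanishes there because all earlier values are
  positive.\<close>

lemma touching_principle:
  fixes k :: "'a::euclidean_space \<Rightarrow> real \<Rightarrow> real"
  assumes K: "compact K" and cont: "continuous_on (K \<times> {0..T}) (\<lambda>(x,t). k x t)"
    and init: "\<And>x. x \<in> K \<Longrightarrow> k x 0 > 0"
    and touch: "\<And>x t. \<lbrakk>x \<in> K; 0 < t; t \<le> T; k x t = 0; \<And>y s. y \<in> K \<Longrightarrow> 0 \<le> s \<Longrightarrow> s \<le> t \<Longrightarrow> k y s \<ge> 0\<rbrakk> \<Longrightarrow> False"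
    and "x \<in> K" "0 \<le> t" "t \<le> T"
  shows "k x t > 0"
proof (rule ccontr)
  assume neg: "\<not> k x t > 0"
  define S where "S = (K \<times> {0..T}) \<inter> (\<lambda>(x, t). k x t) -` {..0}"
  have "closed S"
    unfolding S_def by (intro continuous_closed_preimage[OF cont] closed_Times compact_imp_closed[OF K]) auto
  moreover have "S = (K \<times> {0..T}) \<inter> S" by (auto simp: S_def)
  ultimately have "compact S" using compact_Int_closed[OF compact_Times[OF K compact_Icc]] by metis
  moreover have "(x, t) \<in> S" using neg assms by (auto simp: S_def)
  ultimately obtain p where p: "p \<in> S" "\<And>p'. p' \<in> S \<Longrightarrow> snd p \<le> snd p'"
    using continuous_attains_inf[of S snd, OF _ _ continuous_on_snd[OF continuous_on_id]] by blast
  obtain x0 t0 where pe: "p = (x0, t0)" by (cases p)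
  have x0: "x0 \<in> K" "0 \<le> t0" "t0 \<le> T" "k x0 t0 \<le> 0" using p pe by (auto simp: S_def)
  have pos: "k y s > 0" if "y \<in> K" "0 \<le> s" "s < t0" for y s
    using p(2)[of "(y,s)"] that x0 pe by (force simp: S_def)
  have "t0 > 0" using init[of x0] x0 by (cases "t0 = 0") auto
  \<comment> \<open>Minimality of t0 says nothing about the time t0 itself; there the sign is the
    left limit of positive values.\<close>
  have nn: "k y s \<ge> 0" if "y \<in> K" "0 \<le> s" "s \<le> t0" for y s
  proof (cases "s < t0")
    case True then show ?thesis using pos[of y s] that by auto
  next
    case False
    then have s: "s = t0" using that by auto
    have "continuous_on {0..t0} (\<lambda>s. k y s)"
      by (rule continuous_on_compose2[OF cont, of "{0..t0}" "\<lambda>s. (y, s)", simplified])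
        (use that x0 in \<open>auto intro!: continuous_intros\<close>)
    then have "((\<lambda>s. k y s) \<longlongrightarrow> k y t0) (at t0 within {0..t0})"
      using \<open>t0 > 0\<close> by (auto simp: continuous_on)
    then have "((\<lambda>s. k y s) \<longlongrightarrow> k y t0) (at_left t0)"
      using \<open>t0 > 0\<close> by (simp add: at_within_Icc_at_left)
    moreover have "eventually (\<lambda>s. k y s \<ge> 0) (at_left t0)"
      using eventually_at_left_real[OF \<open>t0 > 0\<close>]
      by eventually_elim (use pos[OF that(1)] in \<open>force intro: less_imp_le\<close>)
    ultimately show ?thesis unfolding s
      by (intro tendsto_lowerbound[of "\<lambda>s. k y s"]) auto
  qed
  show False
    by (rule touch[OF x0(1) \<open>t0 > 0\<close> x0(3) _ nn]) (use nn[OF x0(1,2)] x0 in auto)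
qed

subsection \<open>Comparison principle\<close>

text \<open>The diffusion is expanded into nondivergence form and the boundary condition is put on u
  itself, so that only values of \<phi>' and \<phi>'' enter the comparison. They are separate
  parameters so that the reflected equation has the same form.\<close>

definition line_solution :: "'a::euclidean_space set \<Rightarrow> ('a \<Rightarrow> 'a) \<Rightarrow> (real \<Rightarrow> real) \<Rightarrow> (real \<Rightarrow> real) \<Rightarrow>
    (real \<Rightarrow> real) \<Rightarrow> real \<Rightarrow> ('a \<Rightarrow> real \<Rightarrow> real) \<Rightarrow> bool" where
  "line_solution D \<nu> \<phi>1 \<phi>2 f \<epsilon> u \<longleftrightarrow>
     continuous_on (closure D \<times> {0..}) (\<lambda>(x, t). u x t) \<and>
     (\<forall>t>0. \<exists>u1 u2. line_C2 D (\<lambda>x. u x t) u1 u2 \<and>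
        (\<forall>x\<in>D. ((\<lambda>s. u x s) has_real_derivative
           (\<Sum>b\<in>Basis. \<phi>1 (u x t) * u2 b x + \<phi>2 (u x t) * (u1 b x)\<^sup>2) + f (u x t) / \<epsilon>\<^sup>2) (at t))) \<and>
     (\<forall>x\<in>frontier D. \<forall>t>0. ((\<lambda>s. u (x + s *\<^sub>R \<nu> x) t) has_real_derivative 0) (at_left 0))"

text \<open>A solution with zero normal derivative changes only by o(s) along the normal, so a
  linear gain c s of the barrier excludes touching at a boundary point. The constants may depend on
  the point, since the argument takes place at one touching point.\<close>

definition inward_increasing :: "'a::euclidean_space set \<Rightarrow> ('a \<Rightarrow> 'a) \<Rightarrow> ('a \<Rightarrow> real) \<Rightarrow> bool" where
  "inward_increasing D \<nu> g \<longleftrightarrow> (\<forall>x\<in>frontier D. \<exists>c>0. \<exists>\<delta>>0. \<forall>s. 0 < s \<and> s < \<delta> \<longrightarrow>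
     x - s *\<^sub>R \<nu> x \<in> D \<and> g (x - s *\<^sub>R \<nu> x) \<ge> g x + c * s)"

lemma inward_increasing_compose:
  fixes J :: "real \<Rightarrow> real"
  assumes g: "inward_increasing D \<nu> g" and mono: "mono J"
    and J: "\<And>y. (J has_real_derivative J1 y) (at y)" "\<And>y. J1 y > 0"
  shows "inward_increasing D \<nu> (\<lambda>x. J (g x))"
  unfolding inward_increasing_def
proof
  fix x assume "x \<in> frontier D"
  then obtain c \<delta> where c: "c > 0" "\<delta> > 0"
    "\<And>s. 0 < s \<Longrightarrow> s < \<delta> \<Longrightarrow> x - s *\<^sub>R \<nu> x \<in> D \<and> g (x - s *\<^sub>R \<nu> x) \<ge> g x + c * s"
    using g unfolding inward_increasing_def by blast
  \<comment> \<open>Half of the composed slope; the other half absorbs the error of linearizing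
    J.\<close>
  define d where "d = c * J1 (g x) / 2"
  have "d > 0" using c J by (simp add: d_def)
  have der: "((\<lambda>s. J (g x + c * s) - d * s) has_real_derivative J1 (g x) * c - d) (at 0)"
  proof -
    have "((\<lambda>s. g x + c * s) has_real_derivative c) (at 0)"
      by (auto intro!: derivative_eq_intros)
    from DERIV_chain2[OF J(1) this] show ?thesis
      by (auto intro!: derivative_eq_intros)
  qed
  have "J1 (g x) * c - d > 0" using \<open>d > 0\<close> by (simp add: d_def field_simps)
  from DERIV_pos_inc_right[OF der this] obtain e where e: "e > 0"
    "\<And>h. 0 < h \<Longrightarrow> h < e \<Longrightarrow> J (g x) < J (g x + c * h) - d * h"
    by auto
  have "x - s *\<^sub>R \<nu> x \<in> D \<and> J (g (x - s *\<^sub>R \<nu> x)) \<ge> J (g x) + d * s" if "0 < s" "s < min \<delta> e" for s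
    using c(3)[of s] e(2)[of s] that monoD[OF mono, of "g x + c * s" "g (x - s *\<^sub>R \<nu> x)"] by auto
  then show "\<exists>c>0. \<exists>\<delta>>0. \<forall>s. 0 < s \<and> s < \<delta> \<longrightarrow>
     x - s *\<^sub>R \<nu> x \<in> D \<and> J (g (x - s *\<^sub>R \<nu> x)) \<ge> J (g x) + c * s"
    using \<open>d > 0\<close> c(2) e(1) by (intro exI[of _ d] conjI exI[of _ "min \<delta> e"]) auto
qed

text \<open>At a first interior touching point A(u) - Z has a spatial minimum, which ties the
  derivatives of u to those of Z. The hypothesis \<open>sub\<close> quantifies over all numbers
  satisfying these relations, so testing a barrier becomes pointwise algebra, free of any derivative
  bounds for the solution.\<close>

lemma barrier_comparison:
  fixes D :: "'a::euclidean_space set" and A :: "real \<Rightarrow> real"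
  assumes D: "open D" "bounded D" and sol: "line_solution D \<nu> \<phi>1 \<phi>2 f \<epsilon> u"
    and A: "\<And>y. (A has_real_derivative A1 y) (at y)" "\<And>y. (A1 has_real_derivative A2 y) (at y)"
    and Z_cont: "continuous_on (closure D \<times> {0..T}) (\<lambda>(x,t). Z t x)"
    and Z_C2: "\<And>t. 0 < t \<Longrightarrow> t \<le> T \<Longrightarrow> line_C2 D (Z t) (Z1 t) (Z2 t)"
    and Z_t: "\<And>x t. x \<in> D \<Longrightarrow> 0 < t \<Longrightarrow> t \<le> T \<Longrightarrow> ((\<lambda>s. Z s x) has_real_derivative Zt t x) (at t)"
    and Z_bd: "\<And>t. 0 < t \<Longrightarrow> t \<le> T \<Longrightarrow> inward_increasing D \<nu> (Z t)"
    and init: "\<And>x. x \<in> closure D \<Longrightarrow> Z 0 x < A (u x 0)"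
    and sub: "\<And>x t u1 u2. \<lbrakk>x \<in> D; 0 < t; t \<le> T; A (u x t) = Z t x;
       \<And>b. b \<in> Basis \<Longrightarrow> A1 (u x t) * u1 b = Z1 t b x;
       \<And>b. b \<in> Basis \<Longrightarrow> A1 (u x t) * u2 b + A2 (u x t) * (u1 b)\<^sup>2 \<ge> Z2 t b x\<rbrakk> \<Longrightarrow>
       Zt t x < A1 (u x t) * ((\<Sum>b\<in>Basis. \<phi>1 (u x t) * u2 b + \<phi>2 (u x t) * (u1 b)\<^sup>2) + f (u x t) / \<epsilon>\<^sup>2)"
    and x: "x \<in> closure D" "0 \<le> t" "t \<le> T"
  shows "Z t x < A (u x t)"
proof -
  have u_cont: "continuous_on (closure D \<times> {0..}) (\<lambda>(x, t). u x t)"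
    using sol by (simp add: line_solution_def)
  have A_cont: "continuous_on UNIV A"
    using A(1) by (intro DERIV_continuous_on[of UNIV A A1]) auto
  have "A (u x t) - Z t x > 0"
  proof (rule touching_principle[of "closure D" T "\<lambda>x t. A (u x t) - Z t x"])
    have "continuous_on (closure D \<times> {0..T}) (\<lambda>p. u (fst p) (snd p))"
      by (rule continuous_on_subset[of "closure D \<times> {0..}"]) (use u_cont in \<open>auto simp: case_prod_unfold\<close>)
    then have "continuous_on (closure D \<times> {0..T}) (\<lambda>p. A (u (fst p) (snd p)))"
      by (rule continuous_on_compose2[OF A_cont]) auto
    then show "continuous_on (closure D \<times> {0..T}) (\<lambda>(x, t). A (u x t) - Z t x)"
      using Z_cont by (auto simp: case_prod_unfold intro!: continuous_intros)
  next
    fix y s assume y: "y \<in> closure D" "0 < s" "s \<le> T" "A (u y s) - Z s y = 0"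
      and nn: "\<And>w r. w \<in> closure D \<Longrightarrow> 0 \<le> r \<Longrightarrow> r \<le> s \<Longrightarrow> A (u w r) - Z r w \<ge> 0"
    show False
    proof (cases "y \<in> D")
      case True
      obtain u1 u2 where u12: "line_C2 D (\<lambda>x. u x s) u1 u2"
        and ut: "((\<lambda>r. u y r) has_real_derivative
           (\<Sum>b\<in>Basis. \<phi>1 (u y s) * u2 b y + \<phi>2 (u y s) * (u1 b y)\<^sup>2) + f (u y s) / \<epsilon>\<^sup>2) (at s)"
        using sol y True unfolding line_solution_def by blast
      note k = line_C2_add[OF line_C2_compose[OF u12 A] line_C2_cmult[OF Z_C2[OF y(2,3)], of "-1"]]
      have min: "A (u y s) + - 1 * Z s y \<le> A (u w s) + - 1 * Z s w" if "w \<in> D" for w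
        using nn[of w s] y that closure_subset[of D] by auto
      note k0 = line_C2_min[OF D(1) True _ k min]
      have "Zt s y < A1 (u y s) * ((\<Sum>b\<in>Basis. \<phi>1 (u y s) * u2 b y + \<phi>2 (u y s) * (u1 b y)\<^sup>2) + f (u y s) / \<epsilon>\<^sup>2)"
        using k0 y True by (intro sub) auto
      moreover have "((\<lambda>r. A (u y r) - Z r y) has_real_derivative
        A1 (u y s) * ((\<Sum>b\<in>Basis. \<phi>1 (u y s) * u2 b y + \<phi>2 (u y s) * (u1 b y)\<^sup>2) + f (u y s) / \<epsilon>\<^sup>2) - Zt s y) (at s)"
        by (intro DERIV_diff DERIV_chain2[OF A(1) ut] Z_t True y)
      from derivative_nonpos_at_left_min[OF this y(2)]
      have "A1 (u y s) * ((\<Sum>b\<in>Basis. \<phi>1 (u y s) * u2 b y + \<phi>2 (u y s) * (u1 b y)\<^sup>2) + f (u y s) / \<epsilon>\<^sup>2) - Zt s y \<le> 0"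
        using nn[of y] y by auto
      ultimately show False by simp
    next
      case False
      then have yf: "y \<in> frontier D" using y D(1) by (simp add: frontier_def interior_open)
      then obtain c \<delta> where c: "c > 0" "\<delta> > 0"
        "\<And>h. 0 < h \<Longrightarrow> h < \<delta> \<Longrightarrow> y - h *\<^sub>R \<nu> y \<in> D \<and> Z s (y - h *\<^sub>R \<nu> y) \<ge> Z s y + c * h"
        using Z_bd[OF y(2,3)] unfolding inward_increasing_def by blast
      \<comment> \<open>A(u) + c h has left derivative c > 0, so just inside D the value of A(u) is
        below Z s y + c h for the inward distance h, hence below the barrier, against
        \<open>nn\<close>.\<close>
      have "((\<lambda>h. u (y + h *\<^sub>R \<nu> y) s) has_real_derivative 0) (at_left 0)"
        using sol yf y unfolding line_solution_def by blast
      then have "((\<lambda>h. A (u (y + h *\<^sub>R \<nu> y) s)) has_real_derivative A1 (u (y + 0 *\<^sub>R \<nu> y) s) * 0) (at_left 0)"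
        by (rule DERIV_chain2[OF A(1)])
      then have "((\<lambda>h. A (u (y + h *\<^sub>R \<nu> y) s) + c * h) has_real_derivative c) (at_left 0)"
        by (auto intro!: derivative_eq_intros)
      then obtain d where d: "d > 0"
        "\<And>h. 0 < h \<Longrightarrow> h < d \<Longrightarrow> A (u (y - h *\<^sub>R \<nu> y) s) - c * h < A (u y s)"
        using has_real_derivative_pos_inc_left[of "\<lambda>h. A (u (y + h *\<^sub>R \<nu> y) s) + c * h" c 0 "{..<0}"] c(1) by auto
      define h where "h = min d \<delta> / 2"
      have h: "0 < h" "h < d" "h < \<delta>" using c d by (auto simp: h_def)
      have "A (u (y - h *\<^sub>R \<nu> y) s) - Z s (y - h *\<^sub>R \<nu> y) \<ge> 0"
        using nn[of "y - h *\<^sub>R \<nu> y" s] c(3)[OF h(1,3)] y closure_subset[of D] by auto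
      then show False using d(2)[OF h(1,2)] c(3)[OF h(1,3)] y(4) by auto
    qed
  qed (use x init D in auto)
  then show ?thesis by simp
qed

subsection \<open>Growth of the interface profile\<close>

text \<open>Both are 1 + s <= exp s, at s = -z / m and s = z / m. For J(z) = m (1 - exp (-z / m))
  they read J(z) <= z, which orders the data at time 0, and z J'(z) <= J(z), which turns the linear
  growth of z into a reaction bound.\<close>

lemma exp_saturation:
  fixes m z :: real
  assumes "m > 0"
  shows "m * (1 - exp (- z / m)) \<le> z" "z * exp (- z / m) \<le> m * (1 - exp (- z / m))"
proof -
  have "1 + (- z / m) \<le> exp (- z / m)" by (rule exp_ge_add_one_self)
  then show "m * (1 - exp (- z / m)) \<le> z" using assms by (simp add: field_simps)
  have "(1 + z / m) * exp (- z / m) \<le> exp (z / m) * exp (- z / m)"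
    by (intro mult_right_mono exp_ge_add_one_self) auto
  also have "\<dots> = 1" by (simp flip: exp_add)
  finally show "z * exp (- z / m) \<le> m * (1 - exp (- z / m))" using assms by (simp add: field_simps)
qed

text \<open>In the application a1 = A'(y), a2 = A''(y), j = J'(z), p = \<phi>'(u), r = \<phi>''(u),
  and the remaining variables are derivatives of u and z in one direction. Every error must keep a
  factor j, because j tends to 0 for large z and the result is compared with j z_t. Wherever j^2
  appears, one factor is replaced by its bound J1.\<close>

lemma touching_diffusion_bound:
  fixes a1 a2 j :: real
  assumes a: "0 < T1" "T1 \<le> a1" "\<bar>a2\<bar> \<le> T2" and j: "0 < j" "j \<le> J1" and m: "0 < m"
    and p: "0 \<le> p" "p \<le> M" and r: "\<bar>r\<bar> \<le> M"
    and first: "a1 * u1 = j * z1" and second: "a1 * u2 + a2 * u1\<^sup>2 \<ge> j * z2 - j / m * z1\<^sup>2"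
  shows "a1 * (p * u2 + r * u1\<^sup>2) \<ge>
    - (j * (M * \<bar>z2\<bar> + (M / m + M * T2 * J1 / T1\<^sup>2 + M * J1 / T1) * z1\<^sup>2))"
proof -
  have a1: "a1 > 0" and M: "M \<ge> 0" and T2: "T2 \<ge> 0" using a p by auto
  have u1: "u1 = j * z1 / a1" using first a1 by (simp add: field_simps)
  have u1sq: "u1\<^sup>2 \<le> j * J1 / T1\<^sup>2 * z1\<^sup>2"
  proof -
    have "j\<^sup>2 / a1\<^sup>2 \<le> j * J1 / T1\<^sup>2"
      using a a1 j by (intro frac_le power_mono) (auto simp: power2_eq_square)
    from mult_right_mono[OF this, of "z1\<^sup>2"] show ?thesis
      by (simp add: u1 power_divide power_mult_distrib)
  qed
  have t1: "p * (j * z2) \<ge> - (j * (M * \<bar>z2\<bar>))"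
  proof -
    have "p * (j * \<bar>z2\<bar>) \<le> M * (j * \<bar>z2\<bar>)" using p j by (intro mult_right_mono) auto
    moreover have "p * (j * z2) \<ge> - (p * (j * \<bar>z2\<bar>))"
      using p j abs_ge_minus_self[of z2] mult_left_mono[of "- \<bar>z2\<bar>" z2 "p * j"] by (simp add: mult.assoc)
    ultimately show ?thesis by (simp add: algebra_simps)
  qed
  have t2: "p * (j / m * z1\<^sup>2) \<le> j * (M / m * z1\<^sup>2)"
    using mult_right_mono[OF p(2), of "j / m * z1\<^sup>2"] j m by (simp add: algebra_simps)
  have t3: "p * (a2 * u1\<^sup>2) \<le> j * (M * T2 * J1 / T1\<^sup>2 * z1\<^sup>2)"
  proof -
    have "p * (a2 * u1\<^sup>2) \<le> M * (T2 * u1\<^sup>2)"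
    proof -
      have "a2 * u1\<^sup>2 \<le> T2 * u1\<^sup>2" using a by (intro mult_right_mono) auto
      then have "p * (a2 * u1\<^sup>2) \<le> p * (T2 * u1\<^sup>2)" using p by (intro mult_left_mono)
      also have "\<dots> \<le> M * (T2 * u1\<^sup>2)" using p T2 by (intro mult_right_mono) auto
      finally show ?thesis .
    qed
    also have "\<dots> \<le> M * (T2 * (j * J1 / T1\<^sup>2 * z1\<^sup>2))"
      using u1sq M T2 by (intro mult_left_mono) auto
    finally show ?thesis by (simp add: algebra_simps)
  qed
  have t4: "a1 * (r * u1\<^sup>2) \<ge> - (j * (M * J1 / T1 * z1\<^sup>2))"
  proof -
    have e: "a1 * u1\<^sup>2 = j * j / a1 * z1\<^sup>2" using a1 by (simp add: u1 power2_eq_square)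
    have "j * j / a1 \<le> j * J1 / T1" using a a1 j by (intro frac_le) auto
    then have "a1 * u1\<^sup>2 \<le> j * J1 / T1 * z1\<^sup>2" unfolding e by (intro mult_right_mono) auto
    then have "M * (a1 * u1\<^sup>2) \<le> M * (j * J1 / T1 * z1\<^sup>2)" using M by (intro mult_left_mono)
    moreover have "r * (a1 * u1\<^sup>2) \<ge> - M * (a1 * u1\<^sup>2)"
      using r a1 by (intro mult_right_mono) auto
    ultimately show ?thesis by (simp add: algebra_simps)
  qed
  have "p * (a1 * u2) \<ge> p * (j * z2 - j / m * z1\<^sup>2 - a2 * u1\<^sup>2)"
    using second p by (intro mult_left_mono) auto
  then have "a1 * (p * u2 + r * u1\<^sup>2) \<ge>
      p * (j * z2) - p * (j / m * z1\<^sup>2) - p * (a2 * u1\<^sup>2) + a1 * (r * u1\<^sup>2)"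
    by (simp add: algebra_simps)
  with t1 t2 t3 t4 show ?thesis by (simp add: algebra_simps)
qed

lemma continuous_bounded_Icc:
  fixes g :: "real \<Rightarrow> real"
  assumes "continuous_on {a..b} g"
  obtains M where "M > 0" "\<And>x. a \<le> x \<Longrightarrow> x \<le> b \<Longrightarrow> \<bar>g x\<bar> \<le> M"
proof -
  have "bounded (g ` {a..b})"
    by (intro compact_imp_bounded compact_continuous_image assms compact_Icc)
  then obtain M where "M > 0" "\<forall>y\<in>g ` {a..b}. norm y \<le> M" using bounded_pos by blast
  with that show ?thesis by (simp add: atLeastAtMost_iff) 
qed

lemma continuous_pos_Icc:
  fixes g :: "real \<Rightarrow> real"
  assumes "continuous_on {a..b} g" "\<And>x. a \<le> x \<Longrightarrow> x \<le> b \<Longrightarrow> g x > 0"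
  obtains c where "c > 0" "\<And>x. a \<le> x \<Longrightarrow> x \<le> b \<Longrightarrow> c \<le> g x"
proof (cases "a \<le> b")
  case True
  then obtain y where "y \<in> {a..b}" "\<forall>x\<in>{a..b}. g y \<le> g x"
    using continuous_attains_inf[OF compact_Icc _ assms(1)] by auto
  with that[of "g y"] assms(2) show ?thesis by auto
qed (use that[of 1] in auto)

text \<open>The constant C is fixed before \<epsilon>, u and \<zeta>. The reaction inequality is
  demanded on [-B, \<beta>] only: the lower end is the assumed bound on u, and at touching y <
  \<beta> because J stays below A \<beta>.\<close>

lemma interface_growth:
  fixes D :: "'a::euclidean_space set" and A f \<phi>1 \<phi>2 :: "real \<Rightarrow> real"
  assumes D: "open D" "bounded D"
    and A: "\<And>y. (A has_real_derivative A1 y) (at y)" "\<And>y. (A1 has_real_derivative A2 y) (at y)"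
    and A2: "continuous_on UNIV A2" and A1_pos: "\<And>y. A1 y > 0" and A_ge: "\<And>y. y \<le> A y"
    and pos: "\<mu> > 0" "\<beta> > 0"
    and react: "\<And>y. - B \<le> y \<Longrightarrow> y \<le> \<beta> \<Longrightarrow> \<mu> * A y \<le> A1 y * f (\<alpha> + y)"
    and \<phi>: "continuous_on UNIV \<phi>1" "continuous_on UNIV \<phi>2" "\<And>y. \<phi>1 y \<ge> 0"
    and C0: "C0 \<ge> 0"
  obtains C where "C > 0"
    "\<And>\<epsilon> u \<zeta> \<zeta>1 \<zeta>2 x. \<lbrakk>0 < \<epsilon>; \<epsilon> < 1; line_solution D \<nu> \<phi>1 \<phi>2 f \<epsilon> u;
      \<And>x t. x \<in> closure D \<Longrightarrow> 0 \<le> t \<Longrightarrow> t \<le> \<epsilon>\<^sup>2 * \<bar>ln \<epsilon>\<bar> / \<mu> \<Longrightarrow> \<alpha> - B < u x t;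
      continuous_on (closure D) \<zeta>; line_C2 D \<zeta> \<zeta>1 \<zeta>2;
      \<And>x b. x \<in> D \<Longrightarrow> b \<in> Basis \<Longrightarrow> \<bar>\<zeta>1 b x\<bar> \<le> C0;
      \<And>x b. x \<in> D \<Longrightarrow> b \<in> Basis \<Longrightarrow> \<bar>\<zeta>2 b x\<bar> \<le> C0 / (\<epsilon> * \<bar>ln \<epsilon>\<bar>);
      inward_increasing D \<nu> \<zeta>; \<And>x. x \<in> closure D \<Longrightarrow> \<zeta> x \<le> u x 0 - \<alpha>; x \<in> D\<rbrakk> \<Longrightarrow>
      A \<beta> * (1 - exp (- (\<zeta> x / \<epsilon> - C) / A \<beta>)) < A (u x (\<epsilon>\<^sup>2 * \<bar>ln \<epsilon>\<bar> / \<mu>) - \<alpha>)"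
proof -
  define m where "m = A \<beta>"
  have m: "m > 0" using A_ge[of \<beta>] pos by (simp add: m_def)
  have A_smono: "A x < A y \<longleftrightarrow> x < y" for x y
  proof -
    have "A x < A y" if "x < y" for x y
      using DERIV_pos_imp_increasing[OF that, of A] A(1) A1_pos by blast
    from this[of x y] this[of y x] show ?thesis by (cases x y rule: linorder_cases) auto
  qed
  have A1_cont: "continuous_on S A1" for S
    using DERIV_continuous_on[of UNIV A1 A2] A(2) continuous_on_subset by blast
  obtain T1 where T1: "T1 > 0" "\<And>y. - B \<le> y \<Longrightarrow> y \<le> \<beta> \<Longrightarrow> T1 \<le> A1 y"
    using continuous_pos_Icc[OF A1_cont, of "-B" \<beta>] A1_pos by blast
  obtain T2 where T2: "T2 > 0" "\<And>y. - B \<le> y \<Longrightarrow> y \<le> \<beta> \<Longrightarrow> \<bar>A2 y\<bar> \<le> T2"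
    using continuous_bounded_Icc[OF continuous_on_subset[OF A2], of "-B" \<beta>] by blast
  obtain Ma where Ma: "Ma > 0" "\<And>y. \<alpha> - B \<le> y \<Longrightarrow> y \<le> \<alpha> + \<beta> \<Longrightarrow> \<bar>\<phi>1 y\<bar> \<le> Ma"
    using continuous_bounded_Icc[OF continuous_on_subset[OF \<phi>(1)], of "\<alpha>-B" "\<alpha>+\<beta>"] by blast
  obtain Mb where Mb: "Mb > 0" "\<And>y. \<alpha> - B \<le> y \<Longrightarrow> y \<le> \<alpha> + \<beta> \<Longrightarrow> \<bar>\<phi>2 y\<bar> \<le> Mb"
    using continuous_bounded_Icc[OF continuous_on_subset[OF \<phi>(2)], of "\<alpha>-B" "\<alpha>+\<beta>"] by blast
  define M where "M = max Ma Mb"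
  have M: "M > 0" "\<And>y. \<alpha> - B \<le> y \<Longrightarrow> y \<le> \<alpha> + \<beta> \<Longrightarrow> \<phi>1 y \<le> M"
    "\<And>y. \<alpha> - B \<le> y \<Longrightarrow> y \<le> \<alpha> + \<beta> \<Longrightarrow> \<bar>\<phi>2 y\<bar> \<le> M"
    using Ma Mb unfolding M_def by (force simp: abs_le_iff)+
  \<comment> \<open>At touching J'(z) = 1 - J(z) / m = 1 - A(y) / m, so y > -B bounds J' from above;
    the entry 1 keeps J1 positive.\<close>
  define J1 where "J1 = max 1 (1 - A (- B) / m)"
  define C1 where "C1 = M / m + M * T2 * J1 / T1\<^sup>2 + M * J1 / T1"
  have "J1 > 0" by (simp add: J1_def)
  then have "C1 > 0" using M T1 T2 m by (simp add: C1_def add_pos_pos)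
  \<comment> \<open>The number of directions times the error per direction; the additional 1 makes
    the final differential inequality strict.\<close>
  define C3 where "C3 = DIM('a) * (M * C0 + C1 * C0\<^sup>2) + 1"
  have C3: "C3 \<ge> 1" using M C0 \<open>C1 > 0\<close> by (simp add: C3_def)
  define C where "C = 1 + 2 * C3 / \<mu>"
  have "C > 0" using C3 pos by (simp add: C_def add_pos_nonneg)
  show ?thesis
  proof (rule that[OF \<open>C > 0\<close>])
    fix \<epsilon> u \<zeta> \<zeta>1 \<zeta>2 x0
    assume \<epsilon>: "0 < \<epsilon>" "\<epsilon> < 1" and sol: "line_solution D \<nu> \<phi>1 \<phi>2 f \<epsilon> u"
      and lower: "\<And>x t. x \<in> closure D \<Longrightarrow> 0 \<le> t \<Longrightarrow> t \<le> \<epsilon>\<^sup>2 * \<bar>ln \<epsilon>\<bar> / \<mu> \<Longrightarrow> \<alpha> - B < u x t"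
      and \<zeta>: "continuous_on (closure D) \<zeta>" "line_C2 D \<zeta> \<zeta>1 \<zeta>2"
        "\<And>x b. x \<in> D \<Longrightarrow> b \<in> Basis \<Longrightarrow> \<bar>\<zeta>1 b x\<bar> \<le> C0"
        "\<And>x b. x \<in> D \<Longrightarrow> b \<in> Basis \<Longrightarrow> \<bar>\<zeta>2 b x\<bar> \<le> C0 / (\<epsilon> * \<bar>ln \<epsilon>\<bar>)"
        "inward_increasing D \<nu> \<zeta>" "\<And>x. x \<in> closure D \<Longrightarrow> \<zeta> x \<le> u x 0 - \<alpha>"
      and x0: "x0 \<in> D"
    define L where "L = \<bar>ln \<epsilon>\<bar>"
    have L: "L > 0" "exp L = 1 / \<epsilon>" using \<epsilon> by (auto simp: L_def exp_minus field_simps)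
    define T where "T = \<epsilon>\<^sup>2 * L / \<mu>"
    define E where "E = (\<lambda>t. exp (\<mu> / \<epsilon>\<^sup>2 * t))"
    have E_pos: "E t > 0" for t by (simp add: E_def)
    have E_der: "(E has_real_derivative \<mu> / \<epsilon>\<^sup>2 * E t) (at t)" for t
      unfolding E_def by (rule derivative_eq_intros refl | simp)+
    \<comment> \<open>In the derivative of \<pi> the term 1 / (\<epsilon> L) pays for the second
      derivatives of \<zeta> and the term E for the squared first ones. The summand \<epsilon> gives
      strictness at time 0.\<close>
    define \<pi> where "\<pi> = (\<lambda>t. \<epsilon> + C3 * (t / (\<epsilon> * L) + \<epsilon>\<^sup>2 / \<mu> * E t))"
    have \<pi>_der: "(\<pi> has_real_derivative C3 * (1 / (\<epsilon> * L) + E t)) (at t)" for t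
      unfolding \<pi>_def using \<epsilon> pos L by (auto intro!: derivative_eq_intros E_der simp: field_simps)
    define z where "z = (\<lambda>t x. E t * (\<zeta> x - \<pi> t))"
    define J where "J = (\<lambda>z. m * (1 - exp (- z / m)))"
    have J: "(J has_real_derivative exp (- y / m)) (at y)"
      "((\<lambda>y. exp (- y / m)) has_real_derivative - exp (- y / m) / m) (at y)" for y
      unfolding J_def using m by (auto intro!: derivative_eq_intros)
    have "J (z T x0) < A (u x0 T - \<alpha>)"
    proof (rule barrier_comparison[OF D sol, of "\<lambda>y. A (y - \<alpha>)" "\<lambda>y. A1 (y - \<alpha>)" "\<lambda>y. A2 (y - \<alpha>)" T "\<lambda>t x. J (z t x)"])
      fix y show "((\<lambda>y. A (y - \<alpha>)) has_real_derivative A1 (y - \<alpha>)) (at y)"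
        using DERIV_shift[of A "A1 (y-\<alpha>)" y "-\<alpha>"] A by simp
      show "((\<lambda>y. A1 (y - \<alpha>)) has_real_derivative A2 (y - \<alpha>)) (at y)"
        using DERIV_shift[of A1 "A2 (y-\<alpha>)" y "-\<alpha>"] A by simp
    next
      have "continuous_on (closure D \<times> {0..T}) (\<lambda>p. \<zeta> (fst p))"
        by (rule continuous_on_compose2[OF \<zeta>(1)]) (auto intro!: continuous_intros)
      then show "continuous_on (closure D \<times> {0..T}) (\<lambda>(x, t). J (z t x))"
        using \<epsilon> L m unfolding case_prod_unfold J_def z_def \<pi>_def E_def by (intro continuous_intros) auto
    next
      fix t :: real assume t: "0 < t" "t \<le> T"
      have "line_C2 D (\<lambda>x. E t * \<zeta> x + (- E t * \<pi> t)) (\<lambda>b x. E t * \<zeta>1 b x + 0) (\<lambda>b x. E t * \<zeta>2 b x + 0)"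
        by (intro line_C2_add line_C2_cmult line_C2_const \<zeta>(2))
      then have "line_C2 D (z t) (\<lambda>b x. E t * \<zeta>1 b x) (\<lambda>b x. E t * \<zeta>2 b x)"
        by (simp add: z_def algebra_simps)
      from line_C2_compose[OF this J]
      show "line_C2 D (\<lambda>x. J (z t x)) (\<lambda>b x. exp (- z t x / m) * (E t * \<zeta>1 b x))
        (\<lambda>b x. exp (- z t x / m) * (E t * \<zeta>2 b x) + (- exp (- z t x / m) / m) * (E t * \<zeta>1 b x)\<^sup>2)" .
      have lin: "((\<lambda>y. E t * (y - \<pi> t)) has_real_derivative E t) (at y)" for y
        by (auto intro!: derivative_eq_intros)
      have "mono (\<lambda>y. E t * (y - \<pi> t))"
        using E_pos[of t] by (auto intro!: monoI)
      from inward_increasing_compose[OF \<zeta>(5) this lin E_pos]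
      have inc: "inward_increasing D \<nu> (z t)" by (simp add: z_def[abs_def])
      have "mono J" unfolding J_def using m by (auto intro!: monoI simp: divide_right_mono)
      from inward_increasing_compose[OF inc this J(1)]
      show "inward_increasing D \<nu> (\<lambda>x. J (z t x))" by simp
    next
      fix x t assume x: "x \<in> D" "0 < t" "t \<le> T"
      have "((\<lambda>s. z s x) has_real_derivative \<mu> / \<epsilon>\<^sup>2 * z t x - E t * (C3 * (1 / (\<epsilon> * L) + E t))) (at t)"
      proof -
        have d: "((\<lambda>s. \<zeta> x - \<pi> s) has_real_derivative - (C3 * (1 / (\<epsilon> * L) + E t))) (at t)"
          using DERIV_diff[OF DERIV_const \<pi>_der] by simp
        show ?thesis unfolding z_def
          by (rule DERIV_cong[OF DERIV_mult[OF E_der d]]) (simp add: mult_ac)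
      qed
      from DERIV_chain2[OF J(1) this]
      show "((\<lambda>s. J (z s x)) has_real_derivative exp (- z t x / m) *
        (\<mu> / \<epsilon>\<^sup>2 * z t x - E t * (C3 * (1 / (\<epsilon> * L) + E t)))) (at t)" .
    next
      fix x assume "x \<in> closure D"
      have "J (z 0 x) \<le> z 0 x" unfolding J_def by (rule exp_saturation(1)[OF m])
      also have "\<dots> < \<zeta> x"
      proof -
        have "C3 * \<epsilon>\<^sup>2 / \<mu> \<ge> 0" using C3 pos by simp
        with \<epsilon> show ?thesis by (simp add: z_def E_def \<pi>_def)
      qed
      also have "\<dots> \<le> u x 0 - \<alpha>" by (rule \<zeta>(6)[OF \<open>x \<in> closure D\<close>])
      also have "\<dots> \<le> A (u x 0 - \<alpha>)" by (rule A_ge)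
      finally show "J (z 0 x) < A (u x 0 - \<alpha>)" .
    next
      fix x t and u1 u2 :: "'a \<Rightarrow> real"
      assume x: "x \<in> D" "0 < t" "t \<le> T" and eq: "A (u x t - \<alpha>) = J (z t x)"
        and first: "\<And>b. b \<in> Basis \<Longrightarrow> A1 (u x t - \<alpha>) * u1 b = exp (- z t x / m) * (E t * \<zeta>1 b x)"
        and second: "\<And>b. b \<in> Basis \<Longrightarrow> A1 (u x t - \<alpha>) * u2 b + A2 (u x t - \<alpha>) * (u1 b)\<^sup>2 \<ge>
          exp (- z t x / m) * (E t * \<zeta>2 b x) + (- exp (- z t x / m) / m) * (E t * \<zeta>1 b x)\<^sup>2"
      define y where "y = u x t - \<alpha>"
      define j where "j = exp (- z t x / m)"
      have j: "j > 0" "j = 1 - A y / m" using eq m by (auto simp: j_def y_def J_def)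
      have yB: "- B < y" using lower[of x t] x closure_subset[of D] by (auto simp: y_def T_def L_def)
      \<comment> \<open>j > 0 means that J has not reached its supremum m = A \<beta>, and A is
        strictly increasing.\<close>
      have y\<beta>: "y < \<beta>" using j m A_smono[of y \<beta>] by (simp add: m_def field_simps)
      have jJ1: "j \<le> J1"
      proof -
        have "A (- B) \<le> A y" using A_smono yB by (simp add: less_imp_le)
        then show ?thesis using m by (simp add: j J1_def divide_right_mono max.coboundedI2)
      qed
      have point: "A1 y * (\<phi>1 (u x t) * u2 b + \<phi>2 (u x t) * (u1 b)\<^sup>2) \<ge>
          - (j * (E t * (M * C0 / (\<epsilon> * L)) + C1 * (E t)\<^sup>2 * C0\<^sup>2))" if b: "b \<in> Basis" for b
      proof -
        have lb: "A1 y * (\<phi>1 (u x t) * u2 b + \<phi>2 (u x t) * (u1 b)\<^sup>2) \<ge>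
            - (j * (M * \<bar>E t * \<zeta>2 b x\<bar> + C1 * (E t * \<zeta>1 b x)\<^sup>2))"
          unfolding C1_def
        proof (rule touching_diffusion_bound[of T1 _ "A2 y"])
          show "A1 y * u1 b = j * (E t * \<zeta>1 b x)" using first[OF b] by (simp add: y_def j_def)
          show "j * (E t * \<zeta>2 b x) - j / m * (E t * \<zeta>1 b x)\<^sup>2 \<le> A1 y * u2 b + A2 y * (u1 b)\<^sup>2"
            using second[OF b] by (simp add: y_def j_def)
        qed (use T1 T2 yB y\<beta> j jJ1 m M(2,3)[of "u x t"] \<phi>(3) in \<open>auto simp: y_def\<close>)
        have "M * \<bar>E t * \<zeta>2 b x\<bar> \<le> E t * (M * C0 / (\<epsilon> * L))"
        proof -
          have "M * E t * \<bar>\<zeta>2 b x\<bar> \<le> M * E t * (C0 / (\<epsilon> * L))"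
            using \<zeta>(4)[OF x(1) b] M(1) E_pos[of t] by (intro mult_left_mono) (auto simp: L_def)
          then show ?thesis using E_pos[of t] by (simp add: abs_mult mult_ac)
        qed
        moreover have "C1 * (E t * \<zeta>1 b x)\<^sup>2 \<le> C1 * (E t)\<^sup>2 * C0\<^sup>2"
        proof -
          have "(\<zeta>1 b x)\<^sup>2 \<le> C0\<^sup>2" using \<zeta>(3)[OF x(1) b] C0 by (simp add: abs_le_square_iff[symmetric])
          then have "C1 * (E t)\<^sup>2 * (\<zeta>1 b x)\<^sup>2 \<le> C1 * (E t)\<^sup>2 * C0\<^sup>2"
            using \<open>C1 > 0\<close> by (intro mult_left_mono) auto
          then show ?thesis by (simp add: power_mult_distrib mult.assoc)
        qed
        ultimately have "M * \<bar>E t * \<zeta>2 b x\<bar> + C1 * (E t * \<zeta>1 b x)\<^sup>2 \<le>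
          E t * (M * C0 / (\<epsilon> * L)) + C1 * (E t)\<^sup>2 * C0\<^sup>2" by simp
        from mult_left_mono[OF this less_imp_le[OF j(1)]] lb show ?thesis by linarith
      qed
      have "- (j * (E t * ((C3 - 1) * (1 / (\<epsilon> * L) + E t)))) \<le>
          (\<Sum>b\<in>(Basis :: 'a set). - (j * (E t * (M * C0 / (\<epsilon> * L)) + C1 * (E t)\<^sup>2 * C0\<^sup>2)) :: real)"
      proof -
        have pos': "0 \<le> 1 / (\<epsilon> * L)" "0 \<le> E t" "0 \<le> M * C0" "0 \<le> C1 * C0\<^sup>2"
          using \<epsilon> L E_pos[of t] M C0 \<open>C1 > 0\<close> by auto
        have "M * C0 * (1 / (\<epsilon> * L)) + C1 * C0\<^sup>2 * E t \<le> (M * C0 + C1 * C0\<^sup>2) * (1 / (\<epsilon> * L) + E t)"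
          using mult_nonneg_nonneg[OF pos'(3,2)] mult_nonneg_nonneg[OF pos'(4,1)] by (simp only: distrib_left distrib_right)
        then have "j * (E t * (DIM('a) * (M * C0 * (1 / (\<epsilon> * L)) + C1 * C0\<^sup>2 * E t))) \<le>
           j * (E t * (DIM('a) * ((M * C0 + C1 * C0\<^sup>2) * (1 / (\<epsilon> * L) + E t))))"
          using j pos' by (intro mult_left_mono) auto
        then show ?thesis by (simp add: C3_def algebra_simps power2_eq_square)
      qed
      also have "\<dots> \<le> (\<Sum>b\<in>Basis. A1 y * (\<phi>1 (u x t) * u2 b + \<phi>2 (u x t) * (u1 b)\<^sup>2))"
        by (rule sum_mono) (rule point)
      finally have diff: "- (j * (E t * ((C3 - 1) * (1 / (\<epsilon> * L) + E t)))) \<le>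
        A1 y * (\<Sum>b\<in>Basis. \<phi>1 (u x t) * u2 b + \<phi>2 (u x t) * (u1 b)\<^sup>2)"
        by (simp add: sum_distrib_left)
      \<comment> \<open>This is the chain \<mu> z J'(z) <= \<mu> J(z) = \<mu> A(y) <= A'(y)
        f(\<alpha> + y).\<close>
      have "j * (\<mu> / \<epsilon>\<^sup>2 * z t x) \<le> A1 y * (f (u x t) / \<epsilon>\<^sup>2)"
      proof -
        have "j * z t x \<le> A y"
          using exp_saturation(2)[OF m, of "z t x"] eq by (simp add: j_def J_def y_def mult.commute)
        then have "\<mu> * (j * z t x) \<le> \<mu> * A y" using pos by (intro mult_left_mono) auto
        also have "\<dots> \<le> A1 y * f (u x t)" using react[of y] yB y\<beta> by (simp add: y_def)
        finally have "\<mu> * (j * z t x) / \<epsilon>\<^sup>2 \<le> A1 y * f (u x t) / \<epsilon>\<^sup>2"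
          by (intro divide_right_mono) auto
        then show ?thesis by (simp add: mult_ac)
      qed
      moreover have "j * (E t * (1 / (\<epsilon> * L) + E t)) > 0"
        using j \<epsilon> L E_pos[of t] by (intro mult_pos_pos add_pos_pos) auto
      ultimately have "j * (\<mu> / \<epsilon>\<^sup>2 * z t x - E t * (C3 * (1 / (\<epsilon> * L) + E t))) <
        A1 y * ((\<Sum>b\<in>Basis. \<phi>1 (u x t) * u2 b + \<phi>2 (u x t) * (u1 b)\<^sup>2) + f (u x t) / \<epsilon>\<^sup>2)"
        using diff unfolding distrib_left right_diff_distrib left_diff_distrib by (simp add: mult_ac)
      then show "exp (- z t x / m) * (\<mu> / \<epsilon>\<^sup>2 * z t x - E t * (C3 * (1 / (\<epsilon> * L) + E t))) <
        A1 (u x t - \<alpha>) * ((\<Sum>b\<in>Basis. \<phi>1 (u x t) * u2 b + \<phi>2 (u x t) * (u1 b)\<^sup>2) + f (u x t) / \<epsilon>\<^sup>2)"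
        by (simp add: y_def j_def)
    qed (use x0 closure_subset[of D] \<epsilon> L pos in \<open>auto simp: T_def\<close>)
    moreover have "z T x0 = \<zeta> x0 / \<epsilon> - C"
    proof -
      \<comment> \<open>T is the time at which the exponential factor reaches 1 / \<epsilon>; both
        variable terms of \<pi> then equal C3 \<epsilon> / \<mu>.\<close>
      have ET: "E T = 1 / \<epsilon>" using \<epsilon> pos L by (simp add: E_def T_def)
      have "T / (\<epsilon> * L) = \<epsilon> / \<mu>" "\<epsilon>\<^sup>2 / \<mu> * E T = \<epsilon> / \<mu>"
        unfolding ET using \<epsilon> pos L by (auto simp: T_def power2_eq_square)
      then have "\<pi> T = \<epsilon> * C" unfolding \<pi>_def C_def by (simp only:) (simp add: algebra_simps)
      with \<epsilon> show ?thesis by (simp add: z_def ET diff_divide_distrib)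
    qed
    ultimately have "J (\<zeta> x0 / \<epsilon> - C) < A (u x0 T - \<alpha>)" by (simp only:)
    then show "A \<beta> * (1 - exp (- (\<zeta> x0 / \<epsilon> - C) / A \<beta>)) < A (u x0 (\<epsilon>\<^sup>2 * \<bar>ln \<epsilon>\<bar> / \<mu>) - \<alpha>)"
      unfolding J_def m_def T_def L_def .
  qed
qed

subsection \<open>Linearizing coordinate and lower bounds for the reaction\<close>

text \<open>With \<open>S = sqrt (1 + (K y)\<^sup>2)\<close> this is the solution \<open>\<Theta>\<close> of \<open>y \<Theta>' = (S + K y) \<Theta>\<close>, \<open>\<Theta>'(0) = 1\<close>.  The weight
  \<open>S + K y\<close> is at least \<open>1 + K y\<close> for \<open>y > 0\<close> and at most \<open>1 / (1 - K y)\<close> for \<open>y < 0\<close>, so that for large \<open>K\<close>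
  it absorbs the quadratic error of the linearization of \<open>f\<close> at \<open>\<alpha>\<close>.\<close>

definition interface_coord :: "real \<Rightarrow> real \<Rightarrow> real" where
  "interface_coord K y = 2 * y * exp (sqrt (1 + (K * y)\<^sup>2) + K * y - 1) / (1 + sqrt (1 + (K * y)\<^sup>2))"

text \<open>The quotient (S + K y) \<Theta> / y with the factor y cancelled, so that it makes sense
  and is positive at 0 too.\<close>

definition interface_coord_deriv :: "real \<Rightarrow> real \<Rightarrow> real" where
  "interface_coord_deriv K y = 2 * (sqrt (1 + (K * y)\<^sup>2) + K * y) *
     exp (sqrt (1 + (K * y)\<^sup>2) + K * y - 1) / (1 + sqrt (1 + (K * y)\<^sup>2))"

lemma sqrt_one_plus_square:
  fixes a :: real
  shows "sqrt (1 + a\<^sup>2) \<ge> 1" "(sqrt (1 + a\<^sup>2))\<^sup>2 = 1 + a\<^sup>2" "sqrt (1 + a\<^sup>2) > \<bar>a\<bar>" "sqrt (1 + a\<^sup>2) \<le> 1 + \<bar>a\<bar>"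
proof -
  show "sqrt (1 + a\<^sup>2) \<ge> 1" "(sqrt (1 + a\<^sup>2))\<^sup>2 = 1 + a\<^sup>2" by auto
  show "sqrt (1 + a\<^sup>2) > \<bar>a\<bar>" by (rule real_less_rsqrt) auto
  show "sqrt (1 + a\<^sup>2) \<le> 1 + \<bar>a\<bar>" by (rule real_le_lsqrt) (auto simp: power2_eq_square algebra_simps)
qed

lemma sqrt_one_plus_square_DERIV:
  "((\<lambda>y. sqrt (1 + (K * y)\<^sup>2)) has_real_derivative K\<^sup>2 * y / sqrt (1 + (K * y)\<^sup>2)) (at y)"
proof -
  have pos: "0 < 1 + (K * y)\<^sup>2" by (rule add_pos_nonneg) auto
  have inner: "((\<lambda>y. 1 + (K * y)\<^sup>2) has_real_derivative 2 * (K\<^sup>2 * y)) (at y)"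
    by (auto intro!: derivative_eq_intros simp: power2_eq_square)
  show ?thesis
    by (rule DERIV_cong[OF DERIV_chain2[where f = sqrt and g = "\<lambda>y. 1 + (K * y)\<^sup>2",
      OF DERIV_real_sqrt[OF pos] inner]]) (simp add: inverse_eq_divide)
qed

lemma interface_coord_DERIV:
  "(interface_coord K has_real_derivative interface_coord_deriv K y) (at y)"
proof -
  define S where "S = (\<lambda>y. sqrt (1 + (K * y)\<^sup>2))"
  have S1: "S y \<ge> 1" "(S y)\<^sup>2 = 1 + (K * y)\<^sup>2" using sqrt_one_plus_square by (auto simp: S_def)
  have S_der: "(S has_real_derivative K\<^sup>2 * y / S y) (at y)"
    unfolding S_def by (rule sqrt_one_plus_square_DERIV)
  have "((\<lambda>y. 2 * y * exp (S y + K * y - 1) / (1 + S y)) has_real_derivative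
    2 * (S y + K * y) * exp (S y + K * y - 1) / (1 + S y)) (at y)"
  proof (rule DERIV_cong)
    show "((\<lambda>y. 2 * y * exp (S y + K * y - 1) / (1 + S y)) has_real_derivative
      ((2 * exp (S y + K * y - 1) + (exp (S y + K * y - 1) * (K\<^sup>2 * y / S y + K)) * (2 * y)) * (1 + S y) -
       2 * y * exp (S y + K * y - 1) * (K\<^sup>2 * y / S y)) / ((1 + S y) * (1 + S y))) (at y)"
      using S1 by (auto intro!: derivative_eq_intros S_der)
    define s e where "s = S y" and "e = exp (s + K * y - 1)"
    have s: "s > 0" "1 + s > 0" "s\<^sup>2 = 1 + (K * y)\<^sup>2" using S1 by (auto simp: s_def)
    have "(2 * e + (e * (K\<^sup>2 * y / s + K)) * (2 * y)) * (1 + s) - 2 * y * e * (K\<^sup>2 * y / s) =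
       2 * e * (1 + K * y) * (1 + s) + 2 * e * (K * y)\<^sup>2"
    proof -
      \<comment> \<open>With t = S' and t s = K^2 y the inner quotient disappears, and (K y)^2 = s^2
        - 1 then brings out the factor 1 + s that cancels against the denominator.\<close>
      define t where "t = K\<^sup>2 * y / s"
      have "(2 * e + (e * (t + K)) * (2 * y)) * (1 + s) - 2 * y * e * t =
         2 * e * (1 + K * y) * (1 + s) + 2 * e * y * (t * s)" by (simp add: algebra_simps)
      moreover have "t * s = K\<^sup>2 * y" using s by (simp add: t_def)
      ultimately show ?thesis by (simp add: t_def power2_eq_square mult_ac)
    qed
    also have "\<dots> = 2 * e * ((1 + K * y) * (1 + s) + (s\<^sup>2 - 1))" unfolding s(3) by (simp add: algebra_simps)
    also have "\<dots> = 2 * (s + K * y) * e * (1 + s)" by (simp add: algebra_simps power2_eq_square)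
    finally show "((2 * exp (S y + K * y - 1) + (exp (S y + K * y - 1) * (K\<^sup>2 * y / S y + K)) * (2 * y)) * (1 + S y) -
       2 * y * exp (S y + K * y - 1) * (K\<^sup>2 * y / S y)) / ((1 + S y) * (1 + S y)) =
       2 * (S y + K * y) * exp (S y + K * y - 1) / (1 + S y)"
      using s by (simp flip: s_def e_def)
  qed
  then show ?thesis by (simp add: S_def interface_coord_def[abs_def] interface_coord_deriv_def)
qed

lemma interface_coord_deriv_DERIV:
  obtains A2 where "\<And>y. (interface_coord_deriv K has_real_derivative A2 y) (at y)" "continuous_on UNIV A2"
proof -
  define S where "S = (\<lambda>y. sqrt (1 + (K * y)\<^sup>2))"
  have S1: "S y \<ge> 1" for y using sqrt_one_plus_square by (auto simp: S_def)
  have S0: "S y \<noteq> 0" "1 + S y \<noteq> 0" for y using S1[of y] by auto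
  have S_der: "(S has_real_derivative K\<^sup>2 * y / S y) (at y)" for y
    unfolding S_def by (rule sqrt_one_plus_square_DERIV)
  define A2 where "A2 = (\<lambda>y. ((2 * (K\<^sup>2 * y / S y + K) * exp (S y + K * y - 1) +
       exp (S y + K * y - 1) * (K\<^sup>2 * y / S y + K) * (2 * (S y + K * y))) * (1 + S y) -
       2 * (S y + K * y) * exp (S y + K * y - 1) * (K\<^sup>2 * y / S y)) / ((1 + S y) * (1 + S y)))"
  have "(interface_coord_deriv K has_real_derivative A2 y) (at y)" for y
  proof -
    have "((\<lambda>y. 2 * (S y + K * y) * exp (S y + K * y - 1) / (1 + S y)) has_real_derivative A2 y) (at y)"
      unfolding A2_def using S0 by (auto intro!: derivative_eq_intros S_der)
    then show ?thesis by (simp add: S_def interface_coord_deriv_def[abs_def])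
  qed
  moreover have "continuous_on UNIV S" unfolding S_def by (intro continuous_intros)
  then have "continuous_on UNIV A2" unfolding A2_def
    by (intro continuous_intros ballI) (use S0 in auto)
  ultimately show ?thesis using that by blast
qed

lemma interface_coord_deriv_pos: "interface_coord_deriv K y > 0"
  using sqrt_one_plus_square(1,3)[of "K * y"] unfolding interface_coord_deriv_def
  by (intro divide_pos_pos mult_pos_pos) auto

text \<open>The factor multiplying y is at least 1 for y >= 0 by exp s >= 1 + s, and at most 1 for y
  < 0, where S <= 1 + |K y| makes the exponent nonpositive. The inequality transfers the ordering of
  the initial data to the new coordinate.\<close>

lemma interface_coord_ge:
  assumes "K \<ge> 0"
  shows "y \<le> interface_coord K y"
proof -
  define S where "S = sqrt (1 + (K * y)\<^sup>2)"
  have S: "S \<ge> 1" "S \<le> 1 + \<bar>K * y\<bar>" unfolding S_def by (rule sqrt_one_plus_square)+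
  define e where "e = 2 * exp (S + K * y - 1) / (1 + S)"
  have eq: "interface_coord K y = y * e" by (simp add: interface_coord_def S_def e_def)
  show ?thesis
  proof (cases "y \<ge> 0")
    case True
    then have "K * y \<ge> 0" using assms by simp
    moreover have "1 + (S + K * y - 1) \<le> exp (S + K * y - 1)" by (rule exp_ge_add_one_self)
    ultimately have "e \<ge> 1" using S(1) by (simp add: e_def field_simps)
    from mult_left_mono[OF this True] eq show ?thesis by simp
  next
    case False
    then have "S + K * y - 1 \<le> 0" using S(2) assms by (simp add: abs_mult)
    then have "exp (S + K * y - 1) \<le> 1" by simp
    then have "2 * exp (S + K * y - 1) \<le> 1 + S" using S(1) by linarith
    then have "e \<le> 1" unfolding e_def using S(1) by (subst divide_le_eq_1_pos) linarith+
    from mult_left_mono_neg[OF this, of y] False eq show ?thesis by simp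
  qed
qed

text \<open>Dividing by the positive quotient \<Theta> / y leaves \<mu> y <= (S + K y) h(y). For y <
  0 the identity (S + K y)(S - K y) = 1 makes the weight small enough; for small y > 0 the weight 1
  + K y beats the quadratic error; away from 0, h is bounded below and a large K suffices.\<close>

lemma interface_coord_subsolution:
  fixes h :: "real \<Rightarrow> real"
  assumes "\<mu> > 0" "K0 \<ge> 0" "\<beta> > 0"
    and quad: "\<And>y. - B \<le> y \<Longrightarrow> y \<le> \<beta> \<Longrightarrow> h y \<ge> \<mu> * y - K0 * y\<^sup>2"
    and pos: "\<And>y. 0 < y \<Longrightarrow> y \<le> \<beta> \<Longrightarrow> h y > 0" and cont: "continuous_on UNIV h"
  obtains K where "K > 0"
    "\<And>y. - B \<le> y \<Longrightarrow> y \<le> \<beta> \<Longrightarrow> \<mu> * interface_coord K y \<le> interface_coord_deriv K y * h y"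
proof -
  \<comment> \<open>Normalizes the bound to h y >= \<mu> (y - k y^2); the added 1 keeps k positive,
    so that 1 / (2 k) can separate small from large y.\<close>
  define k where "k = K0 / \<mu> + 1"
  have k: "k \<ge> 1" "K0 \<le> \<mu> * k" using assms by (auto simp: k_def field_simps)
  obtain c where c: "c > 0" "\<And>y. 1 / (2 * k) \<le> y \<Longrightarrow> y \<le> \<beta> \<Longrightarrow> c \<le> h y"
    using continuous_pos_Icc[OF continuous_on_subset[OF cont], of "1 / (2 * k)" \<beta>] pos k
    by (metis divide_pos_pos less_le_trans mult_pos_pos subset_UNIV zero_less_numeral zero_less_one)
  \<comment> \<open>The entry 2 k controls y <= 1 / (2 k), including all negative y, and \<mu> / c
    controls the rest of the range.\<close>
  define K where "K = max (2 * k) (\<mu> / c)"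
  have K: "K \<ge> 2 * k" "\<mu> \<le> K * c" using c(1) by (auto simp: K_def field_simps max_def)
  have Kpos: "K > 0" using K k by linarith
  show ?thesis
  proof (rule that[OF Kpos])
    fix y assume y: "- B \<le> y" "y \<le> \<beta>"
    define S where "S = sqrt (1 + (K * y)\<^sup>2)"
    have S: "S \<ge> 1" "S\<^sup>2 = 1 + (K * y)\<^sup>2" "S > \<bar>K * y\<bar>" unfolding S_def by (rule sqrt_one_plus_square)+
    define N where "N = S + K * y"
    have N: "N > 0" using S by (auto simp: N_def)
    have quad': "h y \<ge> \<mu> * (y - k * y\<^sup>2)"
      using quad[OF y] mult_right_mono[OF k(2), of "y\<^sup>2"] by (simp add: algebra_simps)
    have "\<mu> * y \<le> N * h y"
    proof (cases "y < 0")
      case True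
      have "(S - K * (- y)) * (1 + K * (- y)) \<le> (S - K * (- y)) * (S + K * (- y))"
        using S by (intro mult_left_mono) auto
      also have "\<dots> = S\<^sup>2 - (K * y)\<^sup>2" by (simp add: algebra_simps power2_eq_square)
      finally have NK: "N * (1 - K * y) \<le> 1" using S by (simp add: N_def)
      have "N * (1 - k * y) \<le> N * (1 - K * y)"
        using N True K k by (intro mult_left_mono) (auto simp: mult_right_mono_neg)
      with NK have "N * (1 - k * y) \<le> 1" by simp
      from mult_left_mono_neg[OF this, of "\<mu> * y"] True assms(1)
      have "\<mu> * y \<le> \<mu> * y * (N * (1 - k * y))" by (simp add: mult_nonneg_nonpos)
      also have "\<dots> = N * (\<mu> * (y - k * y\<^sup>2))" by (simp add: algebra_simps power2_eq_square)
      also have "\<dots> \<le> N * h y" using N quad' by (intro mult_left_mono) auto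
      finally show ?thesis .
    next
      case False
      then have y0: "y \<ge> 0" by simp
      have NK: "N \<ge> 1 + K * y" using S by (simp add: N_def)
      have hy: "h y \<ge> 0" using pos[of y] quad'[THEN order_trans[rotated]] y y0 by (cases "y = 0") (use quad' in auto)
      show ?thesis
      proof (cases "y \<le> 1 / (2 * k)")
        case True
        then have ky: "2 * k * y \<le> 1" using k by (simp add: field_simps)
        have "(1 + K * y) * (1 - k * y) \<ge> (1 + 2 * k * y) * (1 - k * y)"
          using K y0 ky by (intro mult_right_mono add_left_mono mult_right_mono) auto
        moreover have "(1 + 2 * k * y) * (1 - k * y) = 1 + k * y * (1 - 2 * k * y)"
          by (simp add: algebra_simps)
        moreover have "k * y * (1 - 2 * k * y) \<ge> 0" using k y0 ky by (intro mult_nonneg_nonneg) auto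
        ultimately have "(1 + K * y) * (1 - k * y) \<ge> 1" by linarith
        then have "\<mu> * y * 1 \<le> \<mu> * y * ((1 + K * y) * (1 - k * y))" using assms(1) y0 by (intro mult_left_mono) auto
        also have "\<dots> = (1 + K * y) * (\<mu> * (y - k * y\<^sup>2))" by (simp add: algebra_simps power2_eq_square)
        also have "\<dots> \<le> (1 + K * y) * h y" using Kpos y0 quad' by (intro mult_left_mono) auto
        also have "\<dots> \<le> N * h y" using NK hy by (intro mult_right_mono) auto
        finally show ?thesis by simp
      next
        case False
        then have "c \<le> h y" using c(2)[of y] y by simp
        have "\<mu> * y \<le> K * c * y" using K y0 by (intro mult_right_mono) auto
        also have "\<dots> \<le> K * h y * y" using Kpos y0 \<open>c \<le> h y\<close> by (intro mult_right_mono mult_left_mono) auto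
        also have "\<dots> \<le> N * h y" using mult_right_mono[OF NK hy] hy by (simp add: algebra_simps)
        finally show ?thesis .
      qed
    qed
    then have "2 * exp (N - 1) / (1 + S) * (\<mu> * y) \<le> 2 * exp (N - 1) / (1 + S) * (N * h y)"
      using S by (intro mult_left_mono) auto
    then show "\<mu> * interface_coord K y \<le> interface_coord_deriv K y * h y"
      unfolding interface_coord_def interface_coord_deriv_def S_def[symmetric] N_def[symmetric]
      by (simp add: mult_ac)
  qed
qed

section \<open>Quadratic and sign bounds for the bistable reaction\<close>

lemma quadratic_lower_bound:
  fixes f :: "real \<Rightarrow> real"
  assumes f: "\<And>s. (f has_real_derivative f1 s) (at s)" "\<And>s. (f1 has_real_derivative f2 s) (at s)"
    and f2: "continuous_on UNIV f2" and "f \<alpha> = 0" "B > 0" "\<beta> > 0"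
  obtains K0 where "K0 \<ge> 0" "\<And>y. - B \<le> y \<Longrightarrow> y \<le> \<beta> \<Longrightarrow> f (\<alpha> + y) \<ge> f1 \<alpha> * y - K0 * y\<^sup>2"
proof -
  obtain M where M: "M > 0" "\<And>s. \<alpha> - B \<le> s \<Longrightarrow> s \<le> \<alpha> + \<beta> \<Longrightarrow> \<bar>f2 s\<bar> \<le> M"
    using continuous_bounded_Icc[OF continuous_on_subset[OF f2], of "\<alpha> - B" "\<alpha> + \<beta>"] by blast
  have "f (\<alpha> + y) \<ge> f1 \<alpha> * y - M / 2 * y\<^sup>2" if y: "- B \<le> y" "y \<le> \<beta>" for y
  proof (cases "y = 0")
    case False
    define d where "d = (\<lambda>n. [f, f1, f2] ! n)"
    have "\<forall>m t. m < 2 \<and> \<alpha> - B \<le> t \<and> t \<le> \<alpha> + \<beta> \<longrightarrow> (d m has_real_derivative d (Suc m) t) (at t)"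
      using f by (auto simp: d_def less_2_cases_iff)
    then obtain t where t: "if \<alpha> + y < \<alpha> then \<alpha> + y < t \<and> t < \<alpha> else \<alpha> < t \<and> t < \<alpha> + y"
      "f (\<alpha> + y) = (\<Sum>m<2. d m \<alpha> / fact m * (\<alpha> + y - \<alpha>) ^ m) + d 2 t / fact 2 * (\<alpha> + y - \<alpha>) ^ 2"
      using Taylor[of 2 d f "\<alpha> - B" "\<alpha> + \<beta>" \<alpha> "\<alpha> + y"] y False assms(5,6) by (auto simp: d_def)
    have "f (\<alpha> + y) = f1 \<alpha> * y + f2 t / 2 * y\<^sup>2"
      using t(2) assms(4) by (simp add: d_def numeral_2_eq_2)
    moreover have "- M \<le> f2 t" using M(2)[of t] t(1) y assms(5,6) by (auto split: if_splits)
    then have "- M / 2 * y\<^sup>2 \<le> f2 t / 2 * y\<^sup>2" by (intro mult_right_mono) auto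
    ultimately show ?thesis by simp
  qed (use assms in auto)
  with M(1) show ?thesis by (intro that[of "M / 2"]) auto
qed

lemma pos_right_of_zero:
  fixes f :: "real \<Rightarrow> real"
  assumes cont: "continuous_on UNIV f" and der: "(f has_real_derivative l) (at c)" "l > 0" and "f c = 0"
    and nz: "\<And>s. c < s \<Longrightarrow> s < e \<Longrightarrow> f s \<noteq> 0" and x: "c < x" "x < e"
  shows "f x > 0"
proof (rule ccontr)
  assume neg: "\<not> f x > 0"
  obtain d where d: "d > 0" "\<And>h. 0 < h \<Longrightarrow> h < d \<Longrightarrow> f c < f (c + h)"
    using DERIV_pos_inc_right[OF der] by auto
  define h where "h = min (d / 2) ((x - c) / 2)"
  have h: "0 < h" "h < d" "c + h < x" using d x by (auto simp: h_def min_def field_simps)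
  have "f (c + h) > 0" using d(2)[OF h(1,2)] assms(4) by simp
  then obtain s where "c + h \<le> s" "s \<le> x" "f s = 0"
    using IVT2'[of f x 0 "c + h"] neg h continuous_on_subset[OF cont] by auto
  with nz[of s] h x show False by auto
qed

lemma pos_left_of_zero:
  fixes f :: "real \<Rightarrow> real"
  assumes cont: "continuous_on UNIV f" and der: "(f has_real_derivative l) (at c)" "l < 0" and "f c = 0"
    and nz: "\<And>s. s < c \<Longrightarrow> f s \<noteq> 0" and x: "x < c"
  shows "f x > 0"
proof -
  have "continuous_on UNIV (\<lambda>s. f (- s))" by (intro continuous_on_compose2[OF cont] continuous_intros) auto
  moreover have "((\<lambda>s. f (- s)) has_real_derivative - l) (at (- c))"
    using DERIV_mirror[of f l "- c"] der by simp
  ultimately have "f (- (- x)) > 0"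
    using der assms(4) nz x by (intro pos_right_of_zero[of "\<lambda>s. f (- s)" "- l" "- c" "- x + 1" "- x"]) auto
  then show ?thesis by simp
qed

text \<open>The barrier is nearly flat in space and rises linearly from A0 by a - \<eta> - A0 during
  the available time. Its speed r / (|ln \<epsilon>| \<epsilon>^2) is beaten by the reaction, at
  least c / \<epsilon>^2 on the range concerned: the logarithm in the time scale decides. The
  multiple of d supplies the strict increase at the boundary.\<close>

lemma decaying_lower_bound:
  fixes D :: "'a::euclidean_space set" and f \<phi>1 \<phi>2 :: "real \<Rightarrow> real"
  assumes D: "open D" "bounded D"
    and d: "continuous_on (closure D) d" "\<And>x. x \<in> closure D \<Longrightarrow> 0 \<le> d x \<and> d x \<le> C0" "line_C2 D d d1 d2"
      "\<And>x b. x \<in> D \<Longrightarrow> b \<in> Basis \<Longrightarrow> \<bar>d1 b x\<bar> \<le> C0 \<and> \<bar>d2 b x\<bar> \<le> C0" "inward_increasing D \<nu> d"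
    and \<phi>: "continuous_on UNIV \<phi>1" "continuous_on UNIV \<phi>2" "\<And>y. \<phi>1 y \<ge> 0"
    and f: "continuous_on UNIV f" "\<And>s. s < a \<Longrightarrow> f s > 0" and "\<eta> > 0" "\<mu> > 0" "C0 > 0" "A0 < a - \<eta>"
  obtains \<epsilon>0 where "\<epsilon>0 > 0" "\<epsilon>0 < 1"
    "\<And>\<epsilon> u. \<lbrakk>0 < \<epsilon>; \<epsilon> < \<epsilon>0; line_solution D \<nu> \<phi>1 \<phi>2 f \<epsilon> u;
      \<And>x. x \<in> closure D \<Longrightarrow> A0 + \<eta> \<le> u x 0\<rbrakk> \<Longrightarrow>
      (\<forall>x\<in>closure D. \<forall>t. 0 \<le> t \<and> t \<le> \<epsilon>\<^sup>2 * \<bar>ln \<epsilon>\<bar> / \<mu> \<longrightarrow> A0 < u x t) \<and>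
      (\<forall>x\<in>closure D. a - \<eta> < u x (\<epsilon>\<^sup>2 * \<bar>ln \<epsilon>\<bar> / \<mu>))"
proof -
  have "f s > 0" if "s \<le> a - \<eta> / 2" for s using that f(2)[of s] \<open>\<eta> > 0\<close> by simp
  then obtain c where c: "c > 0" "\<And>s. A0 \<le> s \<Longrightarrow> s \<le> a - \<eta> / 2 \<Longrightarrow> c \<le> f s"
    using continuous_pos_Icc[OF continuous_on_subset[OF f(1) subset_UNIV], of A0 "a - \<eta> / 2"] by blast
  obtain Ma where Ma: "Ma > 0" "\<And>y. A0 \<le> y \<Longrightarrow> y \<le> a \<Longrightarrow> \<bar>\<phi>1 y\<bar> \<le> Ma"
    using continuous_bounded_Icc[OF continuous_on_subset[OF \<phi>(1)], of A0 a] by blast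
  obtain Mb where Mb: "Mb > 0" "\<And>y. A0 \<le> y \<Longrightarrow> y \<le> a \<Longrightarrow> \<bar>\<phi>2 y\<bar> \<le> Mb"
    using continuous_bounded_Icc[OF continuous_on_subset[OF \<phi>(2)], of A0 a] by blast
  \<comment> \<open>Keeps \<beta> d at most \<eta> / 2, so the barrier starts below the datum and
    never exceeds a - \<eta> / 2, up to which f >= c holds.\<close>
  define \<beta> where "\<beta> = \<eta> / (2 * C0)"
  have \<beta>: "\<beta> > 0" "\<beta> * C0 = \<eta> / 2" using \<open>\<eta> > 0\<close> \<open>C0 > 0\<close> by (auto simp: \<beta>_def)
  define Q where "Q = DIM('a) * (Ma * (\<eta> / 2) + Mb * (\<eta> / 2)\<^sup>2)"
  define r where "r = (a - \<eta> - A0) * \<mu>"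
  have r: "r > 0" using assms by (simp add: r_def)
  have "((\<lambda>\<epsilon>. r / \<bar>ln \<epsilon>\<bar> + \<epsilon>\<^sup>2 * Q) \<longlongrightarrow> 0) (at_right 0)" by real_asymp
  then have "\<forall>\<^sub>F \<epsilon> in at_right 0. r / \<bar>ln \<epsilon>\<bar> + \<epsilon>\<^sup>2 * Q < c"
    using c(1) by (rule order_tendstoD(2))
  then obtain e1 where e1: "e1 > 0" "\<And>\<epsilon>. 0 < \<epsilon> \<Longrightarrow> \<epsilon> < e1 \<Longrightarrow> r / \<bar>ln \<epsilon>\<bar> + \<epsilon>\<^sup>2 * Q < c"
    by (auto simp: eventually_at_right_field)
  define \<epsilon>0 where "\<epsilon>0 = min e1 (1/2)"
  show ?thesis
  proof (rule that[of \<epsilon>0])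
    fix \<epsilon> u assume \<epsilon>: "0 < \<epsilon>" "\<epsilon> < \<epsilon>0" and sol: "line_solution D \<nu> \<phi>1 \<phi>2 f \<epsilon> u"
      and init: "\<And>x. x \<in> closure D \<Longrightarrow> A0 + \<eta> \<le> u x 0"
    define L where "L = \<bar>ln \<epsilon>\<bar>"
    have \<epsilon>1: "\<epsilon> < 1" using \<epsilon> by (simp add: \<epsilon>0_def)
    have L: "L > 0" using \<epsilon> \<epsilon>1 by (simp add: L_def)
    define T where "T = \<epsilon>\<^sup>2 * L / \<mu>"
    define k where "k = r / (L * \<epsilon>\<^sup>2)"
    have k: "k > 0" using r L \<epsilon> by (simp add: k_def)
    have kT: "k * T = a - \<eta> - A0" using \<epsilon> L assms by (simp add: k_def T_def r_def)
    have main: "A0 + \<beta> * d x + k * t < u x t" if x: "x \<in> closure D" "0 \<le> t" "t \<le> T" for x t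
    proof (rule barrier_comparison[OF D sol, of "\<lambda>y. y" "\<lambda>_. 1" "\<lambda>_. 0" T "\<lambda>t x. A0 + \<beta> * d x + k * t"
        "\<lambda>t b x. \<beta> * d1 b x" "\<lambda>t b x. \<beta> * d2 b x" "\<lambda>t x. k"])
      have "continuous_on (closure D \<times> {0..T}) (\<lambda>p. d (fst p))"
        by (rule continuous_on_compose2[OF d(1)]) (auto intro!: continuous_intros)
      then show "continuous_on (closure D \<times> {0..T}) (\<lambda>(x, t). A0 + \<beta> * d x + k * t)"
        unfolding case_prod_unfold by (intro continuous_intros)
      fix t :: real
      have "line_C2 D (\<lambda>x. \<beta> * d x + (A0 + k * t)) (\<lambda>b x. \<beta> * d1 b x + 0) (\<lambda>b x. \<beta> * d2 b x + 0)"
        by (intro line_C2_add line_C2_cmult line_C2_const d(3))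
      then show "line_C2 D (\<lambda>x. A0 + \<beta> * d x + k * t) (\<lambda>b x. \<beta> * d1 b x) (\<lambda>b x. \<beta> * d2 b x)"
        by (simp add: algebra_simps)
      show "inward_increasing D \<nu> (\<lambda>x. A0 + \<beta> * d x + k * t)"
        using \<beta>(1) by (intro inward_increasing_compose[of D \<nu> d "\<lambda>y. A0 + \<beta> * y + k * t" "\<lambda>_. \<beta>"])
          (auto intro!: derivative_eq_intros monoI d(5))
    next
      fix x assume x: "x \<in> closure D"
      have "\<beta> * d x \<le> \<eta> / 2" using mult_left_mono[of "d x" C0 \<beta>] d(2)[OF x] \<beta> by simp
      then show "A0 + \<beta> * d x + k * 0 < u x 0" using init[OF x] \<open>\<eta> > 0\<close> by simp
    next
      fix x t and u1 u2 :: "'a \<Rightarrow> real"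
      assume x: "x \<in> D" "0 < t" "t \<le> T" and eq: "u x t = A0 + \<beta> * d x + k * t"
        and first: "\<And>b. b \<in> Basis \<Longrightarrow> 1 * u1 b = \<beta> * d1 b x"
        and second: "\<And>b. b \<in> Basis \<Longrightarrow> 1 * u2 b + 0 * (u1 b)\<^sup>2 \<ge> \<beta> * d2 b x"
      have dx: "0 \<le> d x" "d x \<le> C0" using d(2)[of x] x closure_subset[of D] by auto
      have "\<beta> * d x \<le> \<eta> / 2" using mult_left_mono[of "d x" C0 \<beta>] dx \<beta> by simp
      moreover have "k * t \<le> k * T" using x k by (intro mult_left_mono) auto
      ultimately have u: "A0 \<le> u x t" "u x t \<le> a - \<eta> / 2"
        using eq dx \<beta> k x kT by auto
      have fu: "c \<le> f (u x t)" by (rule c(2)[OF u])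
      have point: "- (Ma * (\<eta> / 2) + Mb * (\<eta> / 2)\<^sup>2) \<le> \<phi>1 (u x t) * u2 b + \<phi>2 (u x t) * (u1 b)\<^sup>2"
        if b: "b \<in> Basis" for b
      proof -
        have p: "0 \<le> \<phi>1 (u x t)" "\<phi>1 (u x t) \<le> Ma" "\<bar>\<phi>2 (u x t)\<bar> \<le> Mb"
          using Ma(2)[of "u x t"] Mb(2)[of "u x t"] \<phi>(3) u \<open>\<eta> > 0\<close> by auto
        have abs_bd: "\<bar>\<beta> * v\<bar> \<le> \<eta> / 2" if "\<bar>v\<bar> \<le> C0" for v
          using mult_left_mono[OF that, of \<beta>] \<beta> by (simp add: abs_mult)
        have "u2 b \<ge> - (\<eta> / 2)" using second[OF b] abs_bd[of "d2 b x"] d(4)[OF x(1) b] by auto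
        then have "\<phi>1 (u x t) * u2 b \<ge> \<phi>1 (u x t) * (- (\<eta> / 2))" using p by (intro mult_left_mono) auto
        moreover have "\<phi>1 (u x t) * (\<eta> / 2) \<le> Ma * (\<eta> / 2)" using p \<open>\<eta> > 0\<close> by (intro mult_right_mono) auto
        moreover have "\<bar>u1 b\<bar> \<le> \<eta> / 2" using first[OF b] abs_bd[of "d1 b x"] d(4)[OF x(1) b] by auto
        then have "(u1 b)\<^sup>2 \<le> (\<eta> / 2)\<^sup>2" using \<open>\<eta> > 0\<close> by (simp add: abs_le_square_iff[symmetric])
        then have "\<bar>\<phi>2 (u x t)\<bar> * (u1 b)\<^sup>2 \<le> Mb * (\<eta> / 2)\<^sup>2" using p by (intro mult_mono) auto
        moreover have "\<phi>2 (u x t) * (u1 b)\<^sup>2 \<ge> - (\<bar>\<phi>2 (u x t)\<bar> * (u1 b)\<^sup>2)"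
          using mult_right_mono[of "- \<bar>\<phi>2 (u x t)\<bar>" "\<phi>2 (u x t)" "(u1 b)\<^sup>2"] by auto
        ultimately show ?thesis by linarith
      qed
      have "- Q \<le> (\<Sum>b\<in>Basis. \<phi>1 (u x t) * u2 b + \<phi>2 (u x t) * (u1 b)\<^sup>2)"
      proof -
        have "- Q = (\<Sum>b\<in>(Basis :: 'a set). - (Ma * (\<eta> / 2) + Mb * (\<eta> / 2)\<^sup>2))"
          by (simp add: Q_def algebra_simps)
        also have "\<dots> \<le> (\<Sum>b\<in>Basis. \<phi>1 (u x t) * u2 b + \<phi>2 (u x t) * (u1 b)\<^sup>2)"
          by (rule sum_mono) (rule point)
        finally show ?thesis .
      qed
      moreover have "k < f (u x t) / \<epsilon>\<^sup>2 - Q"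
      proof -
        have "r / L + \<epsilon>\<^sup>2 * Q < c" using e1(2)[of \<epsilon>] \<epsilon> by (simp add: \<epsilon>0_def L_def)
        then have "(r / L + \<epsilon>\<^sup>2 * Q) / \<epsilon>\<^sup>2 < f (u x t) / \<epsilon>\<^sup>2" using fu \<epsilon> by (intro divide_strict_right_mono) auto
        then show ?thesis using \<epsilon> by (simp add: k_def add_divide_distrib)
      qed
      ultimately show "k < 1 * ((\<Sum>b\<in>Basis. \<phi>1 (u x t) * u2 b + \<phi>2 (u x t) * (u1 b)\<^sup>2) + f (u x t) / \<epsilon>\<^sup>2)"
        by simp
    qed (use x in \<open>auto intro!: derivative_eq_intros\<close>)
    have "T \<ge> 0" using \<epsilon> L assms by (simp add: T_def)
    have dnn: "\<beta> * d x \<ge> 0" if "x \<in> closure D" for x using d(2)[OF that] \<beta> by simp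
    show "(\<forall>x\<in>closure D. \<forall>t. 0 \<le> t \<and> t \<le> \<epsilon>\<^sup>2 * \<bar>ln \<epsilon>\<bar> / \<mu> \<longrightarrow> A0 < u x t) \<and>
      (\<forall>x\<in>closure D. a - \<eta> < u x (\<epsilon>\<^sup>2 * \<bar>ln \<epsilon>\<bar> / \<mu>))"
      unfolding L_def[symmetric] T_def[symmetric]
    proof (intro conjI ballI allI impI)
      fix x t assume "x \<in> closure D" "0 \<le> t \<and> t \<le> T"
      then show "A0 < u x t" using main[of x t] dnn[of x] k by (smt (verit) mult_nonneg_nonneg)
    next
      fix x assume "x \<in> closure D"
      then show "a - \<eta> < u x T" using main[of x T] dnn[of x] kT \<open>T \<ge> 0\<close> by auto
    qed
  qed (use e1 in \<open>auto simp: \<epsilon>0_def\<close>)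
qed

subsection \<open>Geometry of smooth domains\<close>

lemma frechet_derivative_line:
  assumes "g differentiable (at x)"
  shows "((\<lambda>s. g (x + s *\<^sub>R v)) has_real_derivative frechet_derivative g (at x) v) (at 0)"
proof -
  have g: "(g has_derivative frechet_derivative g (at x)) (at x)"
    using assms by (simp add: frechet_derivative_works)
  have "((\<lambda>s. x + s *\<^sub>R v) has_derivative (\<lambda>s. s *\<^sub>R v)) (at 0)"
    by (auto intro!: derivative_eq_intros)
  then have "((\<lambda>s. g (x + s *\<^sub>R v)) has_derivative (\<lambda>s. frechet_derivative g (at x) (s *\<^sub>R v))) (at 0)"
    by (rule has_derivative_compose) (simp add: g)
  moreover have "(\<lambda>s. frechet_derivative g (at x) (s *\<^sub>R v)) = (*) (frechet_derivative g (at x) v)"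
    using linear_scale[OF linear_frechet_derivative[OF assms]] by (auto simp: fun_eq_iff)
  ultimately show ?thesis by (simp add: has_field_derivative_def)
qed

lemma gradient_inner:
  assumes "g differentiable (at x)"
  shows "gradient g x \<bullet> v = frechet_derivative g (at x) v"
proof -
  have l: "linear (frechet_derivative g (at x))" by (rule linear_frechet_derivative[OF assms])
  have "frechet_derivative g (at x) v = frechet_derivative g (at x) (\<Sum>b\<in>Basis. (v \<bullet> b) *\<^sub>R b)"
    by (simp add: euclidean_representation)
  also have "\<dots> = (\<Sum>b\<in>Basis. (v \<bullet> b) * frechet_derivative g (at x) b)"
    by (simp add: linear_sum[OF l] linear_scale[OF l])
  also have "\<dots> = gradient g x \<bullet> v"
    by (simp add: gradient_def inner_sum_left inner_commute[of v] mult.commute)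
  finally show ?thesis by simp
qed

lemma gradient_line:
  assumes "g differentiable (at x)"
  shows "((\<lambda>s. g (x + s *\<^sub>R v)) has_real_derivative gradient g x \<bullet> v) (at 0)"
  using frechet_derivative_line[OF assms] by (simp add: gradient_inner[OF assms])

lemma Ck_on_imp_continuous_on: "Ck_on k g S \<Longrightarrow> continuous_on S g"
  by (cases k) (auto intro!: continuous_at_imp_continuous_on differentiable_imp_continuous_within)

lemma Ck_on_2_line_C2:
  assumes "Ck_on 2 g S"
  shows "line_C2 S g (\<lambda>b x. frechet_derivative g (at x) b)
      (\<lambda>b x. frechet_derivative (\<lambda>y. frechet_derivative g (at y) b) (at x) b)"
    and "\<And>b. b \<in> Basis \<Longrightarrow> continuous_on S (\<lambda>x. frechet_derivative g (at x) b)"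
    and "\<And>b. b \<in> Basis \<Longrightarrow> continuous_on S (\<lambda>x. frechet_derivative (\<lambda>y. frechet_derivative g (at y) b) (at x) b)"
proof -
  have g: "Ck_on (Suc (Suc 0)) g S" using assms by (simp add: numeral_2_eq_2)
  then show "line_C2 S g (\<lambda>b x. frechet_derivative g (at x) b)
      (\<lambda>b x. frechet_derivative (\<lambda>y. frechet_derivative g (at y) b) (at x) b)"
    unfolding line_C2_def by (auto intro!: frechet_derivative_line)
  show "continuous_on S (\<lambda>x. frechet_derivative g (at x) b)" if "b \<in> Basis" for b
    using g that by (intro Ck_on_imp_continuous_on[of "Suc 0"]) auto
  show "continuous_on S (\<lambda>x. frechet_derivative (\<lambda>y. frechet_derivative g (at y) b) (at x) b)"
    if "b \<in> Basis" for b using g that by auto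
qed

lemma continuous_on_gradient:
  assumes "Ck_on (Suc 0) g S"
  shows "continuous_on S (gradient g)"
  unfolding gradient_def[abs_def] using assms by (intro continuous_intros) auto

lemma local_defining_function_frontier:
  assumes D: "open D" and \<rho>: "local_defining_function D U \<rho>" and z: "z \<in> U" "z \<in> frontier D"
  shows "\<rho> z = 0"
proof -
  have U: "open U" "continuous_on U \<rho>" "D \<inter> U = {y \<in> U. \<rho> y < 0}"
    using \<rho> Ck_on_imp_continuous_on[of 1 \<rho> U] unfolding local_defining_function_def by auto
  have "z \<notin> D" using z(2) D by (simp add: frontier_def interior_open)
  then have "\<rho> z \<ge> 0" using U(3) z(1) by force
  moreover have "\<not> \<rho> z > 0"
  proof
    assume pos: "\<rho> z > 0"
    have "open (U \<inter> \<rho> -` {0<..})" using U by (intro continuous_open_preimage) auto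
    moreover have "(U \<inter> \<rho> -` {0<..}) \<inter> D = {}" using U(3) by force
    ultimately have "(U \<inter> \<rho> -` {0<..}) \<inter> closure D = {}" by (simp add: open_Int_closure_eq_empty)
    with z pos show False by (auto simp: frontier_def)
  qed
  ultimately show ?thesis by simp
qed

lemma local_defining_function_differentiable:
  "local_defining_function D U \<rho> \<Longrightarrow> x \<in> U \<Longrightarrow> \<rho> differentiable (at x)"
  by (simp add: local_defining_function_def)

text \<open>The given normal comes from some C^1 defining function, the smoothness of D from
  possibly another one. A direction pointing strictly into D for one of them cannot point strictly
  out of D for the other; for distinct unit vectors n and m the direction m - n would do just
  that.\<close>

lemma outward_unit_normal_unique:
  assumes D: "open D" and n: "outward_unit_normal D z n"
    and \<sigma>: "local_defining_function D V \<sigma>" "z \<in> V"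
  shows "n = gradient \<sigma> z /\<^sub>R norm (gradient \<sigma> z)"
proof -
  obtain U \<rho> where z: "z \<in> frontier D" and \<rho>: "local_defining_function D U \<rho>" "z \<in> U"
    and n_eq: "n = gradient \<rho> z /\<^sub>R norm (gradient \<rho> z)"
    using n by (auto simp: outward_unit_normal_def)
  define m where "m = gradient \<sigma> z /\<^sub>R norm (gradient \<sigma> z)"
  have nz: "gradient \<rho> z \<noteq> 0" "gradient \<sigma> z \<noteq> 0"
    using \<rho> \<sigma> by (auto simp: local_defining_function_def)
  have zero: "\<rho> z = 0" "\<sigma> z = 0"
    using local_defining_function_frontier[OF D _ _ z] \<rho> \<sigma> by auto
  have unit: "norm n = 1" "norm m = 1" using nz by (auto simp: n_eq m_def)
  have key: "m \<bullet> e \<le> 0" if "n \<bullet> e < 0" for e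
  proof (rule ccontr)
    assume "\<not> m \<bullet> e \<le> 0"
    then have me: "gradient \<sigma> z \<bullet> e > 0" using nz by (simp add: m_def not_le zero_less_mult_iff)
    have ne: "gradient \<rho> z \<bullet> e < 0" using that nz by (simp add: n_eq mult_less_0_iff)
    obtain d1 where d1: "d1 > 0" "\<And>h. 0 < h \<Longrightarrow> h < d1 \<Longrightarrow> \<rho> (z + h *\<^sub>R e) < 0"
      using DERIV_neg_dec_right[OF gradient_line[OF local_defining_function_differentiable[OF \<rho>]] ne] zero by auto
    obtain d2 where d2: "d2 > 0" "\<And>h. 0 < h \<Longrightarrow> h < d2 \<Longrightarrow> \<sigma> (z + h *\<^sub>R e) > 0"
      using DERIV_pos_inc_right[OF gradient_line[OF local_defining_function_differentiable[OF \<sigma>]] me] zero by auto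
    have "open (U \<inter> V)" using \<rho> \<sigma> by (auto simp: local_defining_function_def)
    then have "open ((\<lambda>h. z + h *\<^sub>R e) -` (U \<inter> V))"
      by (intro open_vimage) (auto intro!: continuous_intros)
    moreover have "0 \<in> (\<lambda>h. z + h *\<^sub>R e) -` (U \<inter> V)" using \<rho> \<sigma> by simp
    ultimately obtain d3 where d3: "d3 > 0" "ball 0 d3 \<subseteq> (\<lambda>h. z + h *\<^sub>R e) -` (U \<inter> V)"
      using openE by blast
    define h where "h = min d1 (min d2 d3) / 2"
    have h: "0 < h" "h < d1" "h < d2" "h < d3" using d1 d2 d3 by (auto simp: h_def)
    have in_UV: "z + h *\<^sub>R e \<in> U" "z + h *\<^sub>R e \<in> V" using d3(2) h by (auto simp: dist_norm subset_iff)
    then have "z + h *\<^sub>R e \<in> D" using d1(2)[OF h(1,2)] \<rho>(1) by (auto simp: local_defining_function_def)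
    then have "\<sigma> (z + h *\<^sub>R e) < 0" using in_UV \<sigma>(1) by (auto simp: local_defining_function_def)
    then show False using d2(2)[OF h(1,3)] by simp
  qed
  have "n = m"
  proof (rule ccontr)
    assume "n \<noteq> m"
    then have "0 < (n - m) \<bullet> (n - m)" by simp
    also have "\<dots> = 2 - 2 * (n \<bullet> m)"
      using unit by (simp add: inner_diff_left inner_diff_right inner_commute norm_eq_1)
    finally have nm: "n \<bullet> m < 1" by simp
    have "m \<bullet> (m - n) \<le> 0"
      using nm unit by (intro key) (simp add: inner_diff_right norm_eq_1)
    then show False using nm unit by (simp add: inner_diff_right inner_commute norm_eq_1)
  qed
  then show ?thesis by (simp add: m_def)
qed

lemma outward_unit_normal_norm: "outward_unit_normal D z n \<Longrightarrow> norm n = 1"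
  by (auto simp: outward_unit_normal_def local_defining_function_def)

text \<open>Locally the gradient of the defining function is nearly constant, so the function
  decreases strictly along inward normals issued from neighbouring boundary points. Compactness of
  the boundary makes the length of these segments uniform.\<close>

lemma inner_segments:
  fixes D :: "'a::euclidean_space set"
  assumes D: "smooth_bounded_domain D" and \<nu>: "\<And>x. x \<in> frontier D \<Longrightarrow> outward_unit_normal D x (\<nu> x)"
  obtains s0 where "s0 > 0" "\<And>z s. z \<in> frontier D \<Longrightarrow> 0 < s \<Longrightarrow> s \<le> s0 \<Longrightarrow> z - s *\<^sub>R \<nu> z \<in> D"
proof -
  have oD: "open D" "bounded D" using D by (auto simp: smooth_bounded_domain_def)
  have "\<exists>r>0. \<forall>z\<in>frontier D \<inter> ball z0 r. \<forall>s. 0 < s \<and> s \<le> r \<longrightarrow> z - s *\<^sub>R \<nu> z \<in> D" if z0: "z0 \<in> frontier D" for z0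
  proof -
    obtain U \<rho> where U: "z0 \<in> U" and \<rho>: "local_defining_function D U \<rho>"
      using D z0 unfolding smooth_bounded_domain_def by meson
    define g where "g = norm (gradient \<rho> z0)"
    have "open U" "continuous_on U (gradient \<rho>)"
      using \<rho> by (auto simp: local_defining_function_def intro!: continuous_on_gradient)
    have "g > 0" using \<rho> U by (simp add: local_defining_function_def g_def)
    have "open (U \<inter> gradient \<rho> -` ball (gradient \<rho> z0) (g / 4))"
      using \<open>open U\<close> \<open>continuous_on U (gradient \<rho>)\<close> by (intro continuous_open_preimage) auto
    moreover have "z0 \<in> U \<inter> gradient \<rho> -` ball (gradient \<rho> z0) (g / 4)" using U \<open>g > 0\<close> by simp
    ultimately obtain e where e: "e > 0" "ball z0 e \<subseteq> U \<inter> gradient \<rho> -` ball (gradient \<rho> z0) (g / 4)"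
      using openE by blast
    have near: "y \<in> U" "norm (gradient \<rho> y - gradient \<rho> z0) < g / 4" if "dist z0 y < e" for y
      using e(2) that by (auto simp: subset_iff dist_norm norm_minus_commute)
    have "z - s *\<^sub>R \<nu> z \<in> D" if z: "z \<in> frontier D" "dist z0 z < e / 2" and s: "0 < s" "s \<le> e / 4" for z s
    proof -
      have zU: "z \<in> U" using near z e by auto
      have \<nu>z: "\<nu> z = gradient \<rho> z /\<^sub>R norm (gradient \<rho> z)"
        by (rule outward_unit_normal_unique[OF oD(1) \<nu>[OF z(1)] \<rho> zU])
      have norm\<nu>: "norm (\<nu> z) = 1" by (rule outward_unit_normal_norm[OF \<nu>[OF z(1)]])
      have path: "dist z0 (z - r *\<^sub>R \<nu> z) < e" if "0 \<le> r" "r \<le> s" for r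
      proof -
        have "dist z0 (z - r *\<^sub>R \<nu> z) \<le> dist z0 z + norm (r *\<^sub>R \<nu> z)"
          by (metis add_diff_cancel_left' diff_diff_eq2 dist_norm dist_triangle diff_add_cancel)
        then show ?thesis using z(2) that s norm\<nu> by simp
      qed
      have der: "((\<lambda>r. \<rho> (z - r *\<^sub>R \<nu> z)) has_real_derivative - (gradient \<rho> (z - r *\<^sub>R \<nu> z) \<bullet> \<nu> z)) (at r)"
        if "0 \<le> r" "r \<le> s" for r
      proof -
        have "((\<lambda>h. \<rho> ((z - r *\<^sub>R \<nu> z) + h *\<^sub>R (- \<nu> z))) has_real_derivative
            gradient \<rho> (z - r *\<^sub>R \<nu> z) \<bullet> (- \<nu> z)) (at 0)"
          by (rule gradient_line[OF local_defining_function_differentiable[OF \<rho> near(1)[OF path[OF that]]]])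
        then have "((\<lambda>h. \<rho> (z - (h + r) *\<^sub>R \<nu> z)) has_real_derivative
            - (gradient \<rho> (z - r *\<^sub>R \<nu> z) \<bullet> \<nu> z)) (at 0)"
          by (simp add: algebra_simps)
        then show ?thesis using DERIV_shift[of "\<lambda>h. \<rho> (z - h *\<^sub>R \<nu> z)" _ 0 r] by simp
      qed
      \<comment> \<open>At z the slope is at least 3 g / 4, and moving from z to y changes it by
        less than g / 2.\<close>
      have slope: "gradient \<rho> y \<bullet> \<nu> z > 0" if y: "dist z0 y < e" for y
      proof -
        have "gradient \<rho> z \<bullet> \<nu> z = norm (gradient \<rho> z)"
          using \<rho> zU by (simp add: \<nu>z dot_square_norm power2_eq_square local_defining_function_def)
        moreover have "norm (gradient \<rho> z) \<ge> g - g / 4"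
          using near(2)[of z] z(2) e(1) norm_triangle_ineq2[of "gradient \<rho> z0" "gradient \<rho> z"]
          by (simp add: g_def norm_minus_commute)
        moreover have "\<bar>(gradient \<rho> y - gradient \<rho> z) \<bullet> \<nu> z\<bar> \<le> norm (gradient \<rho> y - gradient \<rho> z)"
          using Cauchy_Schwarz_ineq2[of "gradient \<rho> y - gradient \<rho> z" "\<nu> z"] norm\<nu> by simp
        moreover have "norm (gradient \<rho> y - gradient \<rho> z) < g / 2"
          using near(2)[OF y] near(2)[of z] z(2) e(1)
            norm_triangle_ineq4[of "gradient \<rho> y - gradient \<rho> z0" "gradient \<rho> z - gradient \<rho> z0"] by simp
        ultimately show ?thesis using \<open>g > 0\<close> by (simp add: inner_diff_left)
      qed
      obtain w where "0 < w" "w < s"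
        "\<rho> (z - s *\<^sub>R \<nu> z) - \<rho> (z - 0 *\<^sub>R \<nu> z) = (s - 0) * (- (gradient \<rho> (z - w *\<^sub>R \<nu> z) \<bullet> \<nu> z))"
        using MVT2[OF s(1), of "\<lambda>r. \<rho> (z - r *\<^sub>R \<nu> z)" "\<lambda>r. - (gradient \<rho> (z - r *\<^sub>R \<nu> z) \<bullet> \<nu> z)", OF der]
        by blast
      moreover have "\<rho> z = 0" by (rule local_defining_function_frontier[OF oD(1) \<rho> zU z(1)])
      moreover have "gradient \<rho> (z - w *\<^sub>R \<nu> z) \<bullet> \<nu> z > 0"
        using calculation by (intro slope path) auto
      ultimately have "\<rho> (z - s *\<^sub>R \<nu> z) < 0" using s by (simp add: mult_pos_pos)
      moreover have "z - s *\<^sub>R \<nu> z \<in> U" using near path s by simp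
      ultimately show ?thesis using \<rho> by (auto simp: local_defining_function_def)
    qed
    then show ?thesis using e(1) by (intro exI[of _ "e / 4"]) auto
  qed
  then obtain r where r: "\<And>z0. z0 \<in> frontier D \<Longrightarrow> r z0 > 0"
    "\<And>z0 z s. z0 \<in> frontier D \<Longrightarrow> z \<in> frontier D \<Longrightarrow> z \<in> ball z0 (r z0) \<Longrightarrow> 0 < s \<Longrightarrow> s \<le> r z0 \<Longrightarrow> z - s *\<^sub>R \<nu> z \<in> D"
    by (metis IntI)
  have "compact (frontier D)" using oD(2) by (rule compact_frontier_bounded)
  then obtain F where F: "F \<subseteq> frontier D" "finite F" "frontier D \<subseteq> (\<Union>z\<in>F. ball z (r z))"
    by (rule compactE_image[of _ "frontier D" "\<lambda>z. ball z (r z)"]) (use r(1) in force)+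
  define s0 where "s0 = Min (insert 1 (r ` F))"
  have s0: "s0 > 0" "\<And>z. z \<in> F \<Longrightarrow> s0 \<le> r z" using F r(1) by (auto simp: s0_def subset_iff)
  show ?thesis
  proof (rule that[OF s0(1)])
    fix z s assume "z \<in> frontier D" "0 < s" "s \<le> s0"
    moreover then obtain z0 where "z0 \<in> F" "z \<in> ball z0 (r z0)" using F(3) by blast
    ultimately show "z - s *\<^sub>R \<nu> z \<in> D" using r(2)[of z0 z s] s0(2)[of z0] F(1) by auto
  qed
qed

section \<open>Cutoffs and a substitute for the distance to the boundary\<close>

lemma DERIV_max_0_power:
  "((\<lambda>t::real. max 0 t ^ Suc (Suc n)) has_real_derivative real (Suc (Suc n)) * max 0 t ^ Suc n) (at t)"
proof (cases t "0::real" rule: linorder_cases)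
  case less
  have "((\<lambda>t::real. 0) has_real_derivative real (Suc (Suc n)) * max 0 t ^ Suc n) (at t)"
    using less by simp
  then show ?thesis
    by (rule has_field_derivative_transform_within_open[where S = "{..<0}"]) (use less in auto)
next
  case greater
  have "((\<lambda>t::real. t ^ Suc (Suc n)) has_real_derivative real (Suc (Suc n)) * max 0 t ^ Suc n) (at t)"
    using greater DERIV_pow[of "Suc (Suc n)" t] by (simp add: max_def)
  then show ?thesis
    by (rule has_field_derivative_transform_within_open[where S = "{0<..}"]) (use greater in auto)
next
  case equal
  have "((\<lambda>h::real. max 0 h ^ Suc (Suc n) / h) \<longlongrightarrow> 0) (at 0)"
  proof (rule Lim_null_comparison)
    show "\<forall>\<^sub>F h in at (0::real). norm (max 0 h ^ Suc (Suc n) / h) \<le> \<bar>h\<bar> ^ Suc n"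
      by (intro always_eventually) (auto simp: max_def mult_nonpos_nonneg)
    show "((\<lambda>h::real. \<bar>h\<bar> ^ Suc n) \<longlongrightarrow> 0) (at 0)"
      by (auto intro!: tendsto_eq_intros)
  qed
  then show ?thesis by (simp add: equal DERIV_def)
qed

text \<open>The cube is the lowest integer power of the positive part with two continuous
  derivatives.\<close>

lemma line_C2_cutoff:
  fixes z0 :: "'a::euclidean_space"
  assumes "r \<ge> 0"
  obtains bump1 bump2 where "line_C2 UNIV (\<lambda>x. max 0 (r\<^sup>2 - (x - z0) \<bullet> (x - z0)) ^ 3) bump1 bump2"
    "\<And>b. continuous_on UNIV (bump1 b)" "\<And>b. continuous_on UNIV (bump2 b)"
    "\<And>b x. x \<notin> cball z0 r \<Longrightarrow> bump1 b x = 0" "\<And>b x. x \<notin> cball z0 r \<Longrightarrow> bump2 b x = 0"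
proof -
  define g where "g = (\<lambda>x. r\<^sup>2 - (x - z0) \<bullet> (x - z0))"
  have "line_C2 UNIV g (\<lambda>b x. - 2 * ((x - z0) \<bullet> b)) (\<lambda>b x. - 2 * (b \<bullet> b))"
    unfolding line_C2_def g_def
    by (auto intro!: derivative_eq_intros simp: inner_simps inner_commute algebra_simps)
  from line_C2_compose[OF this DERIV_max_0_power[of "Suc 0"] DERIV_cmult[OF DERIV_max_0_power[of 0]]]
  have *: "line_C2 UNIV (\<lambda>x. max 0 (g x) ^ Suc (Suc (Suc 0)))
     (\<lambda>b x. real (Suc (Suc (Suc 0))) * max 0 (g x) ^ Suc (Suc 0) * (- 2 * ((x - z0) \<bullet> b)))
     (\<lambda>b x. real (Suc (Suc (Suc 0))) * max 0 (g x) ^ Suc (Suc 0) * (- 2 * (b \<bullet> b)) +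
        real (Suc (Suc (Suc 0))) * (real (Suc (Suc 0)) * max 0 (g x) ^ Suc 0) * (- 2 * ((x - z0) \<bullet> b))\<^sup>2)"
    (is "line_C2 _ _ ?c1 ?c2") .
  have g_neg: "max 0 (g x) = 0" if "x \<notin> cball z0 r" for x
  proof -
    have "r < norm (x - z0)" using that by (simp add: dist_norm norm_minus_commute)
    then have "r\<^sup>2 \<le> (norm (x - z0))\<^sup>2" using assms by (intro power_mono) auto
    then show ?thesis by (simp add: g_def dot_square_norm)
  qed
  show ?thesis
  proof (rule that)
    show "line_C2 UNIV (\<lambda>x. max 0 (r\<^sup>2 - (x - z0) \<bullet> (x - z0)) ^ 3) ?c1 ?c2"
      using * by (simp add: g_def numeral_3_eq_3)
    show "continuous_on UNIV (?c1 b)" "continuous_on UNIV (?c2 b)" for b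
      unfolding g_def by (intro continuous_intros)+
    show "?c1 b x = 0" "?c2 b x = 0" if "x \<notin> cball z0 r" for b x
      using g_neg[OF that] by auto
  qed
qed

text \<open>One summand of a function vanishing on the boundary. Its inward slope is nonnegative at
  every boundary point, not only near z0, so that in a sum no other piece can destroy the slope c
  contributed by this one.\<close>

definition boundary_piece :: "'a::euclidean_space set \<Rightarrow> ('a \<Rightarrow> 'a) \<Rightarrow> 'a \<Rightarrow> real \<Rightarrow> ('a \<Rightarrow> real) \<Rightarrow>
    ('a \<Rightarrow> 'a \<Rightarrow> real) \<Rightarrow> ('a \<Rightarrow> 'a \<Rightarrow> real) \<Rightarrow> real \<Rightarrow> bool" where
  "boundary_piece D \<nu> z0 r e e1 e2 c \<longleftrightarrow>
     0 < r \<and> 0 < c \<and> line_C2 UNIV e e1 e2 \<and> continuous_on UNIV e \<and>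
     (\<forall>b\<in>Basis. continuous_on UNIV (e1 b) \<and> continuous_on UNIV (e2 b)) \<and>
     (\<forall>x\<in>D. 0 \<le> e x) \<and> (\<forall>x\<in>D \<inter> ball z0 r. 0 < e x) \<and> (\<forall>x\<in>frontier D. e x = 0) \<and>
     (\<forall>z\<in>frontier D. \<exists>l\<ge>0. ((\<lambda>s. e (z - s *\<^sub>R \<nu> z)) has_real_derivative l) (at 0) \<and>
        (z \<in> ball z0 r \<longrightarrow> c \<le> l))"

lemma line_C2_cong_open:
  assumes "open W" "line_C2 W h h1 h2" "\<And>x. x \<in> W \<Longrightarrow> g x = h x"
    "\<And>x b. x \<in> W \<Longrightarrow> g1 b x = h1 b x" "\<And>x b. x \<in> W \<Longrightarrow> g2 b x = h2 b x"
  shows "line_C2 W g g1 g2"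
  unfolding line_C2_def
proof (intro ballI conjI)
  fix x b :: 'a assume x: "x \<in> W" and b: "b \<in> Basis"
  have op: "open ((\<lambda>s. x + s *\<^sub>R b) -` W)" using assms(1)
    by (intro open_vimage) (auto intro!: continuous_intros)
  have "((\<lambda>s. h (x + s *\<^sub>R b)) has_real_derivative h1 b x) (at 0)"
    "((\<lambda>s. h1 b (x + s *\<^sub>R b)) has_real_derivative h2 b x) (at 0)"
    using assms(2) x b by (auto simp: line_C2_def)
  then show "((\<lambda>s. g (x + s *\<^sub>R b)) has_real_derivative g1 b x) (at 0)"
    "((\<lambda>s. g1 b (x + s *\<^sub>R b)) has_real_derivative g2 b x) (at 0)"
    using has_field_derivative_transform_within_open[OF _ op] x assms(3-5) by force+
qed

lemma continuous_bounded_on_closure: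
  fixes h :: "'a::euclidean_space \<Rightarrow> real"
  assumes "bounded D" "continuous_on (closure D) h"
  shows "\<exists>M>0. \<forall>x\<in>closure D. \<bar>h x\<bar> \<le> M"
proof -
  have "bounded (h ` closure D)"
    using assms by (intro compact_imp_bounded compact_continuous_image) (auto simp: compact_closure)
  then show ?thesis by (auto simp: bounded_pos)
qed

text \<open>The piece is minus a cutoff times \<rho>, extended by 0. Because \<rho> vanishes on the
  boundary, the product rule leaves there only the cutoff times the inward slope of -\<rho>.\<close>

lemma boundary_piece_exists:
  fixes D :: "'a::euclidean_space set"
  assumes W: "open W" "z0 \<in> W" and \<rho>: "line_C2 W \<rho> \<rho>1 \<rho>2" "continuous_on W \<rho>"
      "\<And>b. b \<in> Basis \<Longrightarrow> continuous_on W (\<rho>1 b)" "\<And>b. b \<in> Basis \<Longrightarrow> continuous_on W (\<rho>2 b)"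
    and neg: "\<And>x. x \<in> D \<inter> W \<Longrightarrow> \<rho> x < 0" and zero: "\<And>x. x \<in> frontier D \<inter> W \<Longrightarrow> \<rho> x = 0"
    and slope: "c0 > 0" "\<And>z. z \<in> frontier D \<inter> W \<Longrightarrow>
      \<exists>l\<ge>c0. ((\<lambda>s. \<rho> (z - s *\<^sub>R \<nu> z)) has_real_derivative - l) (at 0)"
  shows "\<exists>r e e1 e2 c. boundary_piece D \<nu> z0 r e e1 e2 c"
proof -
  obtain r where r: "r > 0" "cball z0 r \<subseteq> W" using W open_contains_cball by blast
  define bump where "bump = (\<lambda>x. max 0 (r\<^sup>2 - (x - z0) \<bullet> (x - z0)) ^ 3)"
  obtain bump1 bump2 where bump: "line_C2 UNIV bump bump1 bump2"
    "\<And>b. continuous_on UNIV (bump1 b)" "\<And>b. continuous_on UNIV (bump2 b)"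
    "\<And>b x. x \<notin> cball z0 r \<Longrightarrow> bump1 b x = 0" "\<And>b x. x \<notin> cball z0 r \<Longrightarrow> bump2 b x = 0"
    unfolding bump_def using line_C2_cutoff[OF less_imp_le[OF r(1)]] by blast
  have bump_cont: "continuous_on UNIV bump" unfolding bump_def by (intro continuous_intros)
  have bump_nn: "bump x \<ge> 0" for x by (simp add: bump_def)
  have bump_out: "bump x = 0" if "x \<notin> cball z0 r" for x
  proof -
    have "r < norm (x - z0)" using that by (simp add: dist_norm norm_minus_commute)
    then have "r\<^sup>2 \<le> (norm (x - z0))\<^sup>2" using r(1) by (intro power_mono) auto
    then show ?thesis by (simp add: bump_def dot_square_norm)
  qed
  have bump_in: "(3 / 4 * r\<^sup>2) ^ 3 \<le> bump x" if "x \<in> ball z0 (r / 2)" for x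
  proof -
    have "norm (x - z0) \<le> r / 2" using that by (simp add: dist_norm norm_minus_commute)
    then have "(norm (x - z0))\<^sup>2 \<le> (r / 2)\<^sup>2" by (intro power_mono) auto
    then have "3 / 4 * r\<^sup>2 \<le> max 0 (r\<^sup>2 - (x - z0) \<bullet> (x - z0))"
      by (intro max.coboundedI2) (simp add: dot_square_norm power_divide)
    then show ?thesis unfolding bump_def by (intro power_mono) auto
  qed
  define V where "V = - cball z0 r"
  have V: "open V" "W \<union> V = UNIV" using r by (auto simp: V_def)
  define p1 where "p1 = (\<lambda>b x. - 1 * (bump1 b x * \<rho> x + bump x * \<rho>1 b x))"
  define p2 where "p2 = (\<lambda>b x. - 1 * (bump2 b x * \<rho> x + 2 * bump1 b x * \<rho>1 b x + bump x * \<rho>2 b x))"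
  define e where "e = (\<lambda>x. if x \<in> W then - 1 * (bump x * \<rho> x) else 0)"
  define e1 where "e1 = (\<lambda>b x. if x \<in> W then p1 b x else 0)"
  define e2 where "e2 = (\<lambda>b x. if x \<in> W then p2 b x else 0)"
  have outV: "e x = 0" "e1 b x = 0" "e2 b x = 0" if "x \<in> V" for x b
    using that bump_out[of x] bump(4,5)[of x] by (auto simp: V_def e_def e1_def e2_def p1_def p2_def)
  have "line_C2 W (\<lambda>x. - 1 * (bump x * \<rho> x)) p1 p2"
    unfolding p1_def p2_def
    by (intro line_C2_cmult line_C2_mult line_C2_subset[OF bump(1)] \<rho>(1)) auto
  then have "line_C2 W e e1 e2"
    by (rule line_C2_cong_open[OF W(1)]) (auto simp: e_def e1_def e2_def)
  moreover have "line_C2 V e e1 e2"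
    by (rule line_C2_cong_open[OF V(1) line_C2_const[of V 0]]) (auto simp: outV)
  ultimately have C2: "line_C2 UNIV e e1 e2" using V(2) unfolding line_C2_def by blast
  have glue: "continuous_on UNIV h" if "continuous_on W h" "continuous_on V h" for h :: "'a \<Rightarrow> real"
    using continuous_on_open_Un[OF W(1) V(1) that] V(2) by simp
  have cV: "continuous_on V e" "continuous_on V (e1 b)" "continuous_on V (e2 b)" for b
    by (rule continuous_on_eq[OF continuous_on_const[of V 0]], simp add: outV)+
  note sub = continuous_on_subset[OF _ subset_UNIV]
  have "continuous_on W e"
    by (rule continuous_on_eq[of W "\<lambda>x. - 1 * (bump x * \<rho> x)"])
      (auto simp: e_def intro!: continuous_intros \<rho> sub[OF bump_cont])
  moreover have "continuous_on W (e1 b)" if "b \<in> Basis" for b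
    by (rule continuous_on_eq[of W "p1 b"], unfold p1_def)
      (auto simp: e1_def p1_def intro!: continuous_intros \<rho> sub[OF bump_cont] sub[OF bump(2)] that)
  moreover have "continuous_on W (e2 b)" if "b \<in> Basis" for b
    by (rule continuous_on_eq[of W "p2 b"], unfold p2_def)
      (auto simp: e2_def p2_def intro!: continuous_intros \<rho> sub[OF bump_cont] sub[OF bump(2)] sub[OF bump(3)] that)
  ultimately have cont: "continuous_on UNIV e"
    "\<forall>b\<in>Basis. continuous_on UNIV (e1 b) \<and> continuous_on UNIV (e2 b)"
    using glue cV by auto
  have e_nn: "e x \<ge> 0" if "x \<in> D" for x
    using bump_nn[of x] neg[of x] that by (auto simp: e_def mult_nonneg_nonpos)
  have e_pos: "e x > 0" if "x \<in> D" "x \<in> ball z0 (r / 2)" for x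
  proof -
    have "0 < (3 / 4 * r\<^sup>2) ^ 3" using r(1) by simp
    then have "bump x > 0" using bump_in[OF that(2)] by linarith
    moreover have "x \<in> W" using that(2) r by (auto simp: subset_iff)
    ultimately show ?thesis using neg[of x] that(1) by (simp add: e_def mult_pos_neg)
  qed
  have e_zero: "e x = 0" if "x \<in> frontier D" for x using zero[of x] that by (simp add: e_def)
  \<comment> \<open>The first factor bounds the cutoff from below on the ball of half the
    radius.\<close>
  define c where "c = (3 / 4 * r\<^sup>2) ^ 3 * c0"
  have "c > 0" using r(1) slope(1) by (simp add: c_def)
  have e_slope: "\<exists>l\<ge>0. ((\<lambda>s. e (z - s *\<^sub>R \<nu> z)) has_real_derivative l) (at 0) \<and> (z \<in> ball z0 (r / 2) \<longrightarrow> c \<le> l)"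
    if z: "z \<in> frontier D" for z
  proof (cases "z \<in> W")
    case True
    obtain l where l: "l \<ge> c0" "((\<lambda>s. \<rho> (z - s *\<^sub>R \<nu> z)) has_real_derivative - l) (at 0)"
      using slope(2)[of z] z True by blast
    have "((\<lambda>s. (z - s *\<^sub>R \<nu> z - z0) \<bullet> (z - s *\<^sub>R \<nu> z - z0)) has_real_derivative
      - 2 * ((z - z0) \<bullet> \<nu> z)) (at 0)"
      by (auto intro!: derivative_eq_intros simp: inner_simps inner_commute algebra_simps)
    then have "((\<lambda>s. r\<^sup>2 - (z - s *\<^sub>R \<nu> z - z0) \<bullet> (z - s *\<^sub>R \<nu> z - z0)) has_real_derivative
      2 * ((z - z0) \<bullet> \<nu> z)) (at 0)"
      by (auto intro!: derivative_eq_intros)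
    from DERIV_chain2[OF DERIV_max_0_power[of 1] this]
    obtain k where k: "((\<lambda>s. bump (z - s *\<^sub>R \<nu> z)) has_real_derivative k) (at 0)"
      by (auto simp: bump_def numeral_3_eq_3)
    have "\<rho> z = 0" using zero z True by simp
    then have d: "((\<lambda>s. - 1 * (bump (z - s *\<^sub>R \<nu> z) * \<rho> (z - s *\<^sub>R \<nu> z))) has_real_derivative bump z * l) (at 0)"
      using DERIV_cmult[OF DERIV_mult[OF k l(2)], of "-1"] by (simp add: mult.commute)
    have op: "open ((\<lambda>s. z - s *\<^sub>R \<nu> z) -` W)" using W(1)
      by (intro open_vimage) (auto intro!: continuous_intros)
    have "((\<lambda>s. e (z - s *\<^sub>R \<nu> z)) has_real_derivative bump z * l) (at 0)"
      by (rule has_field_derivative_transform_within_open[OF d op]) (use True in \<open>auto simp: e_def\<close>)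
    moreover have "bump z * l \<ge> 0" using bump_nn l(1) slope(1) by simp
    moreover have "c \<le> bump z * l" if "z \<in> ball z0 (r / 2)"
      unfolding c_def using bump_in[OF that] l(1) slope(1) bump_nn by (intro mult_mono) auto
    ultimately show ?thesis by blast
  next
    case False
    then have zV: "z \<in> V" using V(2) by blast
    have op: "open ((\<lambda>s. z - s *\<^sub>R \<nu> z) -` V)" using V(1)
      by (intro open_vimage) (auto intro!: continuous_intros)
    have "((\<lambda>s. e (z - s *\<^sub>R \<nu> z)) has_real_derivative 0) (at 0)"
      by (rule has_field_derivative_transform_within_open[OF DERIV_const[of 0] op]) (use zV outV in auto)
    moreover have "z \<notin> ball z0 (r / 2)" using False r by (force simp: subset_iff)
    ultimately show ?thesis by auto
  qed
  have "boundary_piece D \<nu> z0 (r / 2) e e1 e2 c"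
    unfolding boundary_piece_def using r(1) \<open>c > 0\<close> C2 cont e_nn e_pos e_zero e_slope by auto
  then show ?thesis by blast
qed

text \<open>A stand-in for the distance to the boundary that keeps two bounded derivatives
  throughout D. Finitely many pieces cover the closure: those centred on the boundary give the
  inward slope, and the cover makes the sum positive at every interior point.\<close>

lemma domain_barrier:
  fixes D :: "'a::euclidean_space set"
  assumes D: "smooth_bounded_domain D" and \<nu>: "\<And>x. x \<in> frontier D \<Longrightarrow> outward_unit_normal D x (\<nu> x)"
  obtains d d1 d2 C where "continuous_on UNIV d" "line_C2 D d d1 d2" "C > 0"
    "\<And>x b. x \<in> D \<Longrightarrow> b \<in> Basis \<Longrightarrow> \<bar>d1 b x\<bar> \<le> C \<and> \<bar>d2 b x\<bar> \<le> C"
    "\<And>x. x \<in> closure D \<Longrightarrow> 0 \<le> d x \<and> d x \<le> C"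
    "\<And>x. x \<in> D \<Longrightarrow> d x > 0" "\<And>x. x \<in> frontier D \<Longrightarrow> d x = 0"
    "\<And>z. z \<in> frontier D \<Longrightarrow> \<exists>\<delta>>0. \<forall>s. 0 < s \<and> s < \<delta> \<longrightarrow> s \<le> d (z - s *\<^sub>R \<nu> z)"
proof -
  have oD: "open D" "bounded D" using D by (auto simp: smooth_bounded_domain_def)
  have "\<exists>r e e1 e2 c. boundary_piece D \<nu> z0 r e e1 e2 c" if z0: "z0 \<in> closure D" for z0
  proof (cases "z0 \<in> D")
    case True
    \<comment> \<open>Interior centres use the constant -1 on D itself; the frontier is disjoint
      from the open set D, so the slope condition is void.\<close>
    show ?thesis
      by (rule boundary_piece_exists[OF oD(1) True line_C2_const[of D "-1"], of D 1])
        (use oD(1) in \<open>auto simp: frontier_def interior_open\<close>)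
  next
    case False
    then have z0f: "z0 \<in> frontier D" using z0 oD(1) by (simp add: frontier_def interior_open)
    then obtain U \<rho> where U: "z0 \<in> U" and \<rho>: "local_defining_function D U \<rho>" "\<And>k. Ck_on k \<rho> U"
      using D unfolding smooth_bounded_domain_def by meson
    define g where "g = norm (gradient \<rho> z0)"
    have "open U" "continuous_on U (gradient \<rho>)"
      using \<rho> by (auto simp: local_defining_function_def intro!: continuous_on_gradient)
    have "g > 0" using \<rho> U by (simp add: local_defining_function_def g_def)
    define W where "W = U \<inter> (\<lambda>x. norm (gradient \<rho> x)) -` {g / 2<..}"
    have W: "open W" "z0 \<in> W" "W \<subseteq> U"
      unfolding W_def using \<open>open U\<close> \<open>continuous_on U (gradient \<rho>)\<close> U \<open>g > 0\<close>
      by (auto intro!: continuous_open_preimage continuous_intros simp: g_def)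
    note C2 = Ck_on_2_line_C2[OF \<rho>(2)]
    show ?thesis
    proof (rule boundary_piece_exists[OF W(1,2) line_C2_subset[OF C2(1) W(3)]])
      show "continuous_on W \<rho>" using continuous_on_subset[OF Ck_on_imp_continuous_on[OF \<rho>(2)] W(3)] by blast
      show "g / 2 > 0" using \<open>g > 0\<close> by simp
      show "continuous_on W (\<lambda>x. frechet_derivative \<rho> (at x) b)"
        "continuous_on W (\<lambda>x. frechet_derivative (\<lambda>y. frechet_derivative \<rho> (at y) b) (at x) b)"
        if "b \<in> Basis" for b
        using C2(2,3)[OF that] W(3) continuous_on_subset by blast+
      show "\<rho> x < 0" if "x \<in> D \<inter> W" for x using that W(3) \<rho>(1) by (auto simp: local_defining_function_def)
      show "\<rho> x = 0" if "x \<in> frontier D \<inter> W" for x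
        using that W(3) local_defining_function_frontier[OF oD(1) \<rho>(1)] by blast
      show "\<exists>l\<ge>g / 2. ((\<lambda>s. \<rho> (z - s *\<^sub>R \<nu> z)) has_real_derivative - l) (at 0)"
        if z: "z \<in> frontier D \<inter> W" for z
      proof (intro exI conjI)
        have zU: "z \<in> U" using z W(3) by blast
        have "\<nu> z = gradient \<rho> z /\<^sub>R norm (gradient \<rho> z)"
          by (rule outward_unit_normal_unique[OF oD(1) \<nu> \<rho>(1) zU]) (use z in blast)
        then have "gradient \<rho> z \<bullet> \<nu> z = norm (gradient \<rho> z)"
          using \<rho>(1) zU by (simp add: dot_square_norm power2_eq_square local_defining_function_def)
        then show "((\<lambda>s. \<rho> (z - s *\<^sub>R \<nu> z)) has_real_derivative - norm (gradient \<rho> z)) (at 0)"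
          using gradient_line[OF local_defining_function_differentiable[OF \<rho>(1) zU], of "- \<nu> z"] by simp
        show "g / 2 \<le> norm (gradient \<rho> z)" using z by (simp add: W_def)
      qed
    qed
  qed
  then obtain r e e1 e2 c where piece: "\<And>z. z \<in> closure D \<Longrightarrow> boundary_piece D \<nu> z (r z) (e z) (e1 z) (e2 z) (c z)"
    by metis
  have cD: "compact (closure D)" using oD(2) by (simp add: compact_closure)
  have r_pos: "r z > 0" if "z \<in> closure D" for z using piece[OF that] by (simp add: boundary_piece_def)
  have "closure D \<subseteq> (\<Union>z\<in>closure D. ball z (r z))" using r_pos centre_in_ball by blast
  then obtain F where F: "F \<subseteq> closure D" "finite F" "closure D \<subseteq> (\<Union>z\<in>F. ball z (r z))"
    using compactE_image[OF cD, of "closure D" "\<lambda>z. ball z (r z)"] open_ball by blast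
  note pF = piece[OF subsetD[OF F(1)]]
  define k where "k = Min (insert 1 (c ` F))"
  have k: "k > 0" "\<And>z. z \<in> F \<Longrightarrow> k \<le> c z"
    using F pF by (auto simp: k_def boundary_piece_def)
  \<comment> \<open>The summed inward slope is at least k, so the factor 2 / k leaves a derivative
    of at least 1 for d - s.\<close>
  define d where "d = (\<lambda>x. (2 / k) * (\<Sum>i\<in>F. e i x))"
  define d1 where "d1 = (\<lambda>b x. (2 / k) * (\<Sum>i\<in>F. e1 i b x))"
  define d2 where "d2 = (\<lambda>b x. (2 / k) * (\<Sum>i\<in>F. e2 i b x))"
  have d_C2: "line_C2 UNIV d d1 d2" unfolding d_def d1_def d2_def
    by (intro line_C2_cmult line_C2_sum F(2)) (use pF in \<open>auto simp: boundary_piece_def\<close>)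
  have d_cont: "continuous_on UNIV d" unfolding d_def
    by (intro continuous_intros) (use pF in \<open>auto simp: boundary_piece_def\<close>)
  have d12_cont: "continuous_on UNIV (d1 b)" "continuous_on UNIV (d2 b)" if "b \<in> Basis" for b
    unfolding d1_def d2_def by (intro continuous_intros; use pF that in \<open>auto simp: boundary_piece_def\<close>)+
  have bd: "\<exists>M>0. \<forall>x\<in>closure D. \<bar>h x\<bar> \<le> M" if "continuous_on UNIV h" for h :: "'a \<Rightarrow> real"
    using continuous_bounded_on_closure[OF oD(2) continuous_on_subset[OF that subset_UNIV]] .
  obtain M0 where M0: "M0 > 0" "\<And>x. x \<in> closure D \<Longrightarrow> \<bar>d x\<bar> \<le> M0" using bd[OF d_cont] by blast
  obtain M1 where M1: "\<And>b. b \<in> Basis \<Longrightarrow> M1 b > 0" "\<And>b x. b \<in> Basis \<Longrightarrow> x \<in> closure D \<Longrightarrow> \<bar>d1 b x\<bar> \<le> M1 b"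
    using bd[OF d12_cont(1)] by metis
  obtain M2 where M2: "\<And>b. b \<in> Basis \<Longrightarrow> M2 b > 0" "\<And>b x. b \<in> Basis \<Longrightarrow> x \<in> closure D \<Longrightarrow> \<bar>d2 b x\<bar> \<le> M2 b"
    using bd[OF d12_cont(2)] by metis
  define C where "C = M0 + (\<Sum>b\<in>Basis. M1 b + M2 b)"
  have Mb: "M1 b + M2 b \<le> (\<Sum>b\<in>Basis. M1 b + M2 b)" if "b \<in> Basis" for b
    using that M1(1) M2(1) by (intro member_le_sum) (auto intro: add_nonneg_nonneg less_imp_le)
  have "(\<Sum>b\<in>Basis. M1 b + M2 b) \<ge> 0"
    using M1(1) M2(1) by (intro sum_nonneg) (auto intro: add_nonneg_nonneg less_imp_le)
  then have CM: "M0 \<le> C" "0 < C" using M0 by (auto simp: C_def)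
  have d_pos: "d x > 0" if xD: "x \<in> D" for x
  proof -
    obtain i where i: "i \<in> F" "x \<in> ball i (r i)" using F(3) xD closure_subset[of D] by blast
    have "(\<Sum>j\<in>F. e j x) > 0"
      by (rule sum_pos2[OF F(2) i(1)]) (use pF xD i in \<open>auto simp: boundary_piece_def\<close>)
    then show ?thesis using k(1) by (simp add: d_def)
  qed
  have d_zero: "d x = 0" if "x \<in> frontier D" for x
    using pF that by (simp add: d_def boundary_piece_def)
  show ?thesis
  proof (rule that[OF d_cont line_C2_subset[OF d_C2 subset_UNIV] CM(2)])
    show "\<bar>d1 b x\<bar> \<le> C \<and> \<bar>d2 b x\<bar> \<le> C" if "x \<in> D" "b \<in> Basis" for x b
      using Mb[OF that(2)] M1[OF that(2)] M2[OF that(2)] that(1) closure_subset[of D] M0(1)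
      unfolding C_def by (smt (verit) subsetD)
    show "0 \<le> d x \<and> d x \<le> C" if "x \<in> closure D" for x
      using M0(2)[OF that] CM d_pos[of x] d_zero[of x] that closure_Un_frontier[of D] by force
    show "\<exists>\<delta>>0. \<forall>s. 0 < s \<and> s < \<delta> \<longrightarrow> s \<le> d (z - s *\<^sub>R \<nu> z)" if z: "z \<in> frontier D" for z
    proof -
      have "\<forall>i\<in>F. \<exists>l\<ge>0. ((\<lambda>s. e i (z - s *\<^sub>R \<nu> z)) has_real_derivative l) (at 0) \<and> (z \<in> ball i (r i) \<longrightarrow> c i \<le> l)"
        using pF z by (auto simp: boundary_piece_def)
      then obtain l where l: "\<And>i. i \<in> F \<Longrightarrow> l i \<ge> 0"
        "\<And>i. i \<in> F \<Longrightarrow> ((\<lambda>s. e i (z - s *\<^sub>R \<nu> z)) has_real_derivative l i) (at 0)"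
        "\<And>i. i \<in> F \<Longrightarrow> z \<in> ball i (r i) \<Longrightarrow> c i \<le> l i" by metis
      obtain i where i: "i \<in> F" "z \<in> ball i (r i)" using F(3) z by (auto simp: frontier_def)
      have "k \<le> c i" by (rule k(2)[OF i(1)])
      also have "\<dots> \<le> l i" by (rule l(3)[OF i])
      also have "\<dots> \<le> (\<Sum>j\<in>F. l j)" using F(2) i l(1) by (intro member_le_sum) auto
      finally have kl: "k \<le> (\<Sum>j\<in>F. l j)" .
      have der: "((\<lambda>s. d (z - s *\<^sub>R \<nu> z) - s) has_real_derivative (2 / k) * (\<Sum>j\<in>F. l j) - 1) (at 0)"
        unfolding d_def by (intro DERIV_diff DERIV_cmult DERIV_sum DERIV_ident l(2))
      have "(2 / k) * (\<Sum>j\<in>F. l j) - 1 > 0"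
        using kl k(1) by (simp add: field_simps)
      from DERIV_pos_inc_right[OF der this] obtain \<delta> where \<delta>: "\<delta> > 0" "\<And>s. 0 < s \<Longrightarrow> s < \<delta> \<Longrightarrow> 0 < d (z - s *\<^sub>R \<nu> z) - s"
        using d_zero[OF z] by auto
      then show ?thesis by (force intro: less_imp_le)
    qed
  qed (use d_pos d_zero in auto)
qed

subsection \<open>From classical solutions to coordinate lines\<close>

lemma Ck_on_real_Suc:
  fixes g :: "real \<Rightarrow> real"
  assumes "Ck_on (Suc k) g UNIV"
  shows "(g has_real_derivative deriv g s) (at s)" "Ck_on k (deriv g) UNIV"
proof -
  have D: "(g has_real_derivative frechet_derivative g (at x) 1) (at x)" for x
    using frechet_derivative_line[of g x 1] DERIV_shift[of g _ 0 x] assms by (simp add: add.commute)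
  have "frechet_derivative g (at x) 1 = deriv g x" for x using DERIV_imp_deriv[OF D[of x]] by simp
  then have eq: "(\<lambda>x. frechet_derivative g (at x) 1) = deriv g" by auto
  show "(g has_real_derivative deriv g s) (at s)" using D[of s] fun_cong[OF eq, of s] by simp
  show "Ck_on k (deriv g) UNIV" using assms by (simp add: eq)
qed

text \<open>Serves to convert the boundary condition: the difference quotients of u along the normal
  are at most those of \<phi>(u) divided by C, so a vanishing one-sided derivative of \<phi>(u)
  passes to u without knowing that u is differentiable there.\<close>

lemma expansion_of_derivative_ge:
  fixes \<phi> :: "real \<Rightarrow> real"
  assumes "\<And>s. (\<phi> has_real_derivative \<phi>1 s) (at s)" "\<And>s. \<phi>1 s \<ge> C" "C > 0"
  shows "C * \<bar>a - b\<bar> \<le> \<bar>\<phi> a - \<phi> b\<bar>"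
proof -
  have *: "C * (y - x) \<le> \<phi> y - \<phi> x" if xy: "x < y" for x y
  proof -
    obtain w where "\<phi> y - \<phi> x = (y - x) * \<phi>1 w" using MVT2[OF xy, of \<phi> \<phi>1] assms(1) by blast
    moreover have "(y - x) * C \<le> (y - x) * \<phi>1 w" using assms(2) xy by (intro mult_left_mono) auto
    ultimately show ?thesis by (simp add: mult.commute)
  qed
  show ?thesis
    using *[of a b] *[of b a] assms(3) by (cases a b rule: linorder_cases) (auto simp: abs_if algebra_simps)
qed

lemma laplacian_compose:
  fixes D :: "'a::euclidean_space set"
  assumes D: "open D" "x \<in> D" and v: "Ck_on 2 v D"
    and \<phi>: "\<And>s. (\<phi> has_real_derivative \<phi>1 s) (at s)" "\<And>s. (\<phi>1 has_real_derivative \<phi>2 s) (at s)"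
  shows "laplacian (\<lambda>y. \<phi> (v y)) x =
    (\<Sum>b\<in>Basis. \<phi>1 (v x) * frechet_derivative (\<lambda>y. frechet_derivative v (at y) b) (at x) b +
      \<phi>2 (v x) * (frechet_derivative v (at x) b)\<^sup>2)"
  unfolding laplacian_def
proof (rule sum.cong[OF refl])
  fix b :: 'a assume b: "b \<in> Basis"
  have v2: "Ck_on (Suc (Suc 0)) v D" using v by (simp add: numeral_2_eq_2)
  then have dv: "v differentiable (at y)" "(\<lambda>y. frechet_derivative v (at y) b) differentiable (at y)"
    if "y \<in> D" for y using that b by auto
  note C2 = line_C2_compose[OF Ck_on_2_line_C2(1)[OF v] \<phi>]
  have \<phi>_diff: "\<phi> differentiable (at s)" "\<phi>1 differentiable (at s)" for s
    using \<phi> real_differentiable_def by blast+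
  have first: "frechet_derivative (\<lambda>y. \<phi> (v y)) (at y) b = \<phi>1 (v y) * frechet_derivative v (at y) b"
    if y: "y \<in> D" for y
  proof -
    have "(\<lambda>y. \<phi> (v y)) differentiable (at y)"
      using differentiable_chain_at[OF dv(1)[OF y] \<phi>_diff(1)] by (simp add: o_def)
    from DERIV_unique[OF frechet_derivative_line[OF this, of b]] C2 y b show ?thesis
      by (auto simp: line_C2_def)
  qed
  define h where "h = (\<lambda>y. \<phi>1 (v y) * frechet_derivative v (at y) b)"
  have h_diff: "h differentiable (at x)"
    unfolding h_def using differentiable_chain_at[OF dv(1)[OF D(2)] \<phi>_diff(2)]
    by (intro differentiable_mult dv(2) D(2)) (simp add: o_def)
  have "frechet_derivative (\<lambda>y. frechet_derivative (\<lambda>y. \<phi> (v y)) (at y) b) (at x) = frechet_derivative h (at x)"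
    by (rule frechet_derivative_at[symmetric],
        rule has_derivative_transform_within_open[OF _ D])
      (use h_diff first in \<open>auto simp: frechet_derivative_works h_def\<close>)
  moreover have "frechet_derivative h (at x) b = \<phi>1 (v x) * frechet_derivative (\<lambda>y. frechet_derivative v (at y) b) (at x) b +
      \<phi>2 (v x) * (frechet_derivative v (at x) b)\<^sup>2"
    using DERIV_unique[OF frechet_derivative_line[OF h_diff, of b]] C2 D(2) b
    by (auto simp: line_C2_def h_def)
  ultimately show "frechet_derivative (\<lambda>y. frechet_derivative (\<lambda>y. \<phi> (v y)) (at y) b) (at x) b =
      \<phi>1 (v x) * frechet_derivative (\<lambda>y. frechet_derivative v (at y) b) (at x) b +
      \<phi>2 (v x) * (frechet_derivative v (at x) b)\<^sup>2" by simp
qed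

lemma classical_imp_line_solution:
  fixes D :: "'a::euclidean_space set"
  assumes D: "open D" and sol: "classical_solution D \<nu> \<phi> f u0 \<epsilon> u"
    and \<phi>: "\<And>s. (\<phi> has_real_derivative \<phi>1 s) (at s)" "\<And>s. (\<phi>1 has_real_derivative \<phi>2 s) (at s)"
      "\<And>s. \<phi>1 s \<ge> C" "C > 0"
  shows "line_solution D \<nu> \<phi>1 \<phi>2 f \<epsilon> u"
proof -
  have C21: "C21_on u D" using sol by (simp add: classical_solution_def)
  have interior: "\<exists>u1 u2. line_C2 D (\<lambda>x. u x t) u1 u2 \<and>
        (\<forall>x\<in>D. ((\<lambda>s. u x s) has_real_derivative
           (\<Sum>b\<in>Basis. \<phi>1 (u x t) * u2 b x + \<phi>2 (u x t) * (u1 b x)\<^sup>2) + f (u x t) / \<epsilon>\<^sup>2) (at t))"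
    if t: "t > 0" for t
  proof (intro exI conjI ballI)
    have v: "Ck_on 2 (\<lambda>x. u x t) D" using C21 t by (simp add: C21_on_def)
    show "line_C2 D (\<lambda>x. u x t) (\<lambda>b x. frechet_derivative (\<lambda>x. u x t) (at x) b)
      (\<lambda>b x. frechet_derivative (\<lambda>y. frechet_derivative (\<lambda>x. u x t) (at y) b) (at x) b)"
      by (rule Ck_on_2_line_C2(1)[OF v])
    fix x assume x: "x \<in> D"
    have "(\<lambda>s. u x s) differentiable (at t)" using C21 x t by (simp add: C21_on_def)
    then have "((\<lambda>s. u x s) has_real_derivative deriv (\<lambda>s. u x s) t) (at t)"
      by (simp add: DERIV_deriv_iff_real_differentiable)
    moreover have "deriv (\<lambda>s. u x s) t = laplacian (\<lambda>y. \<phi> (u y t)) x + f (u x t) / \<epsilon>\<^sup>2"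
      using sol x t by (simp add: classical_solution_def)
    ultimately show "((\<lambda>s. u x s) has_real_derivative
      (\<Sum>b\<in>Basis. \<phi>1 (u x t) * frechet_derivative (\<lambda>y. frechet_derivative (\<lambda>x. u x t) (at y) b) (at x) b +
         \<phi>2 (u x t) * (frechet_derivative (\<lambda>x. u x t) (at x) b)\<^sup>2) + f (u x t) / \<epsilon>\<^sup>2) (at t)"
      by (simp add: laplacian_compose[OF D x v \<phi>(1,2)])
  qed
  have boundary: "((\<lambda>s. u (x + s *\<^sub>R \<nu> x) t) has_real_derivative 0) (at_left 0)"
    if x: "x \<in> frontier D" and t: "t > 0" for x t
  proof -
    define v where "v = (\<lambda>s. u (x + s *\<^sub>R \<nu> x) t)"
    have "((\<lambda>s. \<phi> (v s)) has_real_derivative 0) (at_left 0)"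
      using sol x t by (simp add: classical_solution_def v_def)
    then have lim: "((\<lambda>s. (\<phi> (v s) - \<phi> (v 0)) / (s - 0)) \<longlongrightarrow> 0) (at_left 0)"
      by (simp add: has_field_derivative_iff)
    have "((\<lambda>s. (v s - v 0) / (s - 0)) \<longlongrightarrow> 0) (at_left 0)"
    proof (rule Lim_null_comparison)
      show "\<forall>\<^sub>F s in at_left 0. norm ((v s - v 0) / (s - 0)) \<le> \<bar>(\<phi> (v s) - \<phi> (v 0)) / (s - 0)\<bar> / C"
      proof (intro always_eventually allI)
        fix s :: real
        have "\<bar>v s - v 0\<bar> / \<bar>s\<bar> \<le> (\<bar>\<phi> (v s) - \<phi> (v 0)\<bar> / C) / \<bar>s\<bar>"
          using expansion_of_derivative_ge[OF \<phi>(1,3,4), of "v s" "v 0"] \<phi>(4)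
          by (intro divide_right_mono) (auto simp: field_simps)
        then show "norm ((v s - v 0) / (s - 0)) \<le> \<bar>(\<phi> (v s) - \<phi> (v 0)) / (s - 0)\<bar> / C"
          by (simp add: abs_divide mult.commute)
      qed
      show "((\<lambda>s. \<bar>(\<phi> (v s) - \<phi> (v 0)) / (s - 0)\<bar> / C) \<longlongrightarrow> 0) (at_left 0)"
        using tendsto_divide[OF tendsto_rabs[OF lim] tendsto_const[of C]] \<phi>(4) by simp
    qed
    then show ?thesis by (simp add: has_field_derivative_iff v_def)
  qed
  show ?thesis
    unfolding line_solution_def using sol interior boundary by (auto simp: classical_solution_def)
qed

text \<open>The squared first derivative is even under u -> -u while the time and second derivatives
  are odd; hence the sign in front of \<phi>2, which is also the derivative of the reflected
  \<phi>1. Lower bounds for -u become upper bounds for u.\<close>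

lemma line_solution_reflect:
  assumes "line_solution D \<nu> \<phi>1 \<phi>2 f \<epsilon> u"
  shows "line_solution D \<nu> (\<lambda>s. \<phi>1 (- s)) (\<lambda>s. - \<phi>2 (- s)) (\<lambda>s. - f (- s)) \<epsilon> (\<lambda>x t. - u x t)"
  unfolding line_solution_def
proof (intro conjI allI impI ballI)
  have "continuous_on (closure D \<times> {0..}) (\<lambda>p. - (\<lambda>(x, t). u x t) p)"
    using assms by (intro continuous_on_minus) (simp add: line_solution_def)
  then show "continuous_on (closure D \<times> {0..}) (\<lambda>(x, t). - u x t)" by (simp add: case_prod_unfold)
next
  fix t :: real assume "t > 0"
  then obtain u1 u2 where C2: "line_C2 D (\<lambda>x. u x t) u1 u2"
    and ut: "\<And>x. x \<in> D \<Longrightarrow> ((\<lambda>s. u x s) has_real_derivative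
      (\<Sum>b\<in>Basis. \<phi>1 (u x t) * u2 b x + \<phi>2 (u x t) * (u1 b x)\<^sup>2) + f (u x t) / \<epsilon>\<^sup>2) (at t)"
    using assms unfolding line_solution_def by blast
  have "line_C2 D (\<lambda>x. - u x t) (\<lambda>b x. - u1 b x) (\<lambda>b x. - u2 b x)"
    using line_C2_cmult[OF C2, of "-1"] by simp
  moreover have "((\<lambda>s. - u x s) has_real_derivative
      (\<Sum>b\<in>Basis. \<phi>1 (- (- u x t)) * - u2 b x + - \<phi>2 (- (- u x t)) * (- u1 b x)\<^sup>2) + - f (- (- u x t)) / \<epsilon>\<^sup>2) (at t)"
    if "x \<in> D" for x
    using DERIV_minus[OF ut[OF that]] by (simp add: sum_negf[symmetric] add.commute)
  ultimately show "\<exists>u1 u2. line_C2 D (\<lambda>x. - u x t) u1 u2 \<and>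
    (\<forall>x\<in>D. ((\<lambda>s. - u x s) has_real_derivative
      (\<Sum>b\<in>Basis. \<phi>1 (- (- u x t)) * u2 b x + - \<phi>2 (- (- u x t)) * (u1 b x)\<^sup>2) + - f (- (- u x t)) / \<epsilon>\<^sup>2) (at t))"
    by blast
next
  fix x and t :: real assume "x \<in> frontier D" "t > 0"
  then have "((\<lambda>s. u (x + s *\<^sub>R \<nu> x) t) has_real_derivative 0) (at_left 0)"
    using assms by (simp add: line_solution_def)
  from DERIV_minus[OF this] show "((\<lambda>s. - u (x + s *\<^sub>R \<nu> x) t) has_real_derivative 0) (at_left 0)" by simp
qed

text \<open>\<open>Ck_closure\<close> speaks of coordinate directions, whereas the boundary normal
  is an arbitrary unit vector. Expanding v in the basis, with coefficients at most 1 in modulus,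
  sums of the coordinate bounds, mixed ones included, control both derivatives along v.\<close>

lemma Ck_closure_2_bounds:
  fixes D :: "'a::euclidean_space set"
  assumes D: "open D" "bounded D" and g: "Ck_closure 2 g D"
  obtains C where "C > 0" "continuous_on (closure D) g"
    "\<And>x. x \<in> D \<Longrightarrow> g differentiable (at x)"
    "\<And>x v. x \<in> D \<Longrightarrow> (\<lambda>y. frechet_derivative g (at y) v) differentiable (at x)"
    "\<And>x v. x \<in> D \<Longrightarrow> norm v = 1 \<Longrightarrow> \<bar>frechet_derivative g (at x) v\<bar> \<le> C"
    "\<And>x v. x \<in> D \<Longrightarrow> norm v = 1 \<Longrightarrow> \<bar>frechet_derivative (\<lambda>y. frechet_derivative g (at y) v) (at x) v\<bar> \<le> C"
proof -
  have g2: "Ck_closure (Suc (Suc 0)) g D" using g by (simp add: numeral_2_eq_2)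
  then have cont: "continuous_on (closure D) g" and diff: "\<And>x. x \<in> D \<Longrightarrow> g differentiable (at x)" by auto
  have "\<forall>b\<in>Basis. \<exists>h. Ck_closure (Suc 0) h D \<and> (\<forall>x\<in>D. h x = frechet_derivative g (at x) b)"
    using g2 by simp
  then obtain h where h: "\<And>b. b \<in> Basis \<Longrightarrow> Ck_closure (Suc 0) (h b) D"
    "\<And>b x. b \<in> Basis \<Longrightarrow> x \<in> D \<Longrightarrow> h b x = frechet_derivative g (at x) b" by metis
  have h_cont: "continuous_on (closure D) (h b)" and h_diff: "\<And>x. x \<in> D \<Longrightarrow> h b differentiable (at x)"
    if "b \<in> Basis" for b using h(1)[OF that] by auto
  have "\<forall>b\<in>Basis. \<forall>c\<in>Basis. \<exists>k. continuous_on (closure D) k \<and> (\<forall>x\<in>D. k x = frechet_derivative (h b) (at x) c)"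
    using h(1) by simp
  then obtain k where k: "\<And>b c. b \<in> Basis \<Longrightarrow> c \<in> Basis \<Longrightarrow> continuous_on (closure D) (k b c)"
    "\<And>b c x. b \<in> Basis \<Longrightarrow> c \<in> Basis \<Longrightarrow> x \<in> D \<Longrightarrow> k b c x = frechet_derivative (h b) (at x) c" by metis
  have bd: "\<exists>M>0. \<forall>x\<in>D. \<bar>w x\<bar> \<le> M" if "continuous_on (closure D) w" for w :: "'a \<Rightarrow> real"
    using continuous_bounded_on_closure[OF D(2) that] closure_subset[of D] by blast
  obtain M where M: "\<And>b. b \<in> Basis \<Longrightarrow> M b > 0" "\<And>b x. b \<in> Basis \<Longrightarrow> x \<in> D \<Longrightarrow> \<bar>h b x\<bar> \<le> M b"
    using bd[OF h_cont] by metis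
  obtain N where N: "\<And>b c. b \<in> Basis \<Longrightarrow> c \<in> Basis \<Longrightarrow> N b c > 0"
    "\<And>b c x. b \<in> Basis \<Longrightarrow> c \<in> Basis \<Longrightarrow> x \<in> D \<Longrightarrow> \<bar>k b c x\<bar> \<le> N b c"
    using bd[OF k(1)] by metis
  define C where "C = 1 + (\<Sum>b\<in>Basis. M b) + (\<Sum>b\<in>Basis. \<Sum>c\<in>Basis. N b c)"
  have sums: "(\<Sum>b\<in>Basis. M b) \<ge> 0" "(\<Sum>b\<in>Basis. \<Sum>c\<in>Basis. N b c) \<ge> 0"
    using M(1) N(1) by (simp_all add: sum_nonneg less_imp_le)
  have comp: "\<bar>v \<bullet> b\<bar> \<le> 1" if "norm v = 1" "b \<in> Basis" for v b :: 'a
    using Basis_le_norm[OF that(2), of v] that(1) by simp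
  have expand: "frechet_derivative g (at y) v = (\<Sum>b\<in>Basis. (v \<bullet> b) * h b y)" if "y \<in> D" for y v
  proof -
    have "frechet_derivative g (at y) v = gradient g y \<bullet> v" by (simp add: gradient_inner[OF diff[OF that]])
    then show ?thesis using h(2) that
      by (simp add: gradient_def inner_sum_left inner_commute[of v] mult.commute)
  qed
  have second: "((\<lambda>y. frechet_derivative g (at y) v) has_derivative
      (\<lambda>w. \<Sum>b\<in>Basis. (v \<bullet> b) * frechet_derivative (h b) (at x) w)) (at x)" if x: "x \<in> D" for x v
  proof (rule has_derivative_transform_within_open[OF _ D(1) x])
    show "((\<lambda>y. \<Sum>b\<in>Basis. (v \<bullet> b) * h b y) has_derivative
      (\<lambda>w. \<Sum>b\<in>Basis. (v \<bullet> b) * frechet_derivative (h b) (at x) w)) (at x)"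
      by (intro has_derivative_sum has_derivative_mult_right)
        (use h_diff x frechet_derivative_works in blast)
  qed (simp add: expand)
  show ?thesis
  proof (rule that[OF _ cont diff])
    show "C > 0" using sums by (simp add: C_def)
    fix x v :: 'a assume x: "x \<in> D"
    show "(\<lambda>y. frechet_derivative g (at y) v) differentiable (at x)"
      using second[OF x] differentiableI by blast
    assume v: "norm v = 1"
    have "\<bar>frechet_derivative g (at x) v\<bar> \<le> (\<Sum>b\<in>Basis. \<bar>(v \<bullet> b) * h b x\<bar>)"
      unfolding expand[OF x] by (rule sum_abs)
    also have "\<dots> \<le> (\<Sum>b\<in>Basis. 1 * M b)"
      unfolding abs_mult using comp[OF v] M(2) x by (intro sum_mono mult_mono) auto
    also have "\<dots> \<le> C" using sums by (simp add: C_def)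
    finally show "\<bar>frechet_derivative g (at x) v\<bar> \<le> C" .
    have inner: "\<bar>frechet_derivative (h b) (at x) v\<bar> \<le> (\<Sum>c\<in>Basis. N b c)" if b: "b \<in> Basis" for b
    proof -
      have "frechet_derivative (h b) (at x) v = (\<Sum>c\<in>Basis. (v \<bullet> c) * k b c x)"
        using gradient_inner[OF h_diff[OF b x], of v] k(2)[OF b _ x]
        by (simp add: gradient_def inner_sum_left inner_commute[of v] mult.commute)
      then have "\<bar>frechet_derivative (h b) (at x) v\<bar> \<le> (\<Sum>c\<in>Basis. \<bar>(v \<bullet> c) * k b c x\<bar>)" by (simp add: sum_abs)
      also have "\<dots> \<le> (\<Sum>c\<in>Basis. 1 * N b c)"
        unfolding abs_mult using comp[OF v] N(2) b x by (intro sum_mono mult_mono) auto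
      finally show ?thesis by simp
    qed
    have "frechet_derivative (\<lambda>y. frechet_derivative g (at y) v) (at x) v =
       (\<Sum>b\<in>Basis. (v \<bullet> b) * frechet_derivative (h b) (at x) v)"
      using fun_cong[OF frechet_derivative_at[OF second[OF x, of v]], of v] by simp
    then have "\<bar>frechet_derivative (\<lambda>y. frechet_derivative g (at y) v) (at x) v\<bar> \<le>
      (\<Sum>b\<in>Basis. \<bar>(v \<bullet> b) * frechet_derivative (h b) (at x) v\<bar>)" by (simp add: sum_abs)
    also have "\<dots> \<le> (\<Sum>b\<in>Basis. 1 * (\<Sum>c\<in>Basis. N b c))"
      unfolding abs_mult using comp[OF v] inner by (intro sum_mono mult_mono) auto
    also have "\<dots> \<le> C" using sums by (simp add: C_def)
    finally show "\<bar>frechet_derivative (\<lambda>y. frechet_derivative g (at y) v) (at x) v\<bar> \<le> C" .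
  qed
qed

section \<open>One-variable estimates along normal segments\<close>

lemma segment_slope_bound:
  fixes q :: "real \<Rightarrow> real"
  assumes cont: "continuous_on {0..s1} q" and q1: "\<And>s. 0 < s \<Longrightarrow> s \<le> s1 \<Longrightarrow> (q has_real_derivative q1 s) (at s)"
    and C: "\<And>s. 0 < s \<Longrightarrow> s \<le> s1 \<Longrightarrow> \<bar>q1 s\<bar> \<le> C" and s: "0 \<le> s" "s \<le> s1"
  shows "\<bar>q s - q 0\<bar> \<le> C * s"
proof (cases "s = 0")
  case False
  then have "0 < s" using s by simp
  moreover have "continuous_on {0..s} q" by (rule continuous_on_subset[OF cont]) (use s in auto)
  ultimately obtain l w where w: "0 < w" "w < s" "(q has_real_derivative l) (at w)" "q s - q 0 = (s - 0) * l"
    using MVT[of 0 s q] q1 s real_differentiable_def by (metis less_imp_le order_trans)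
  have "l = q1 w" by (rule DERIV_unique[OF w(3) q1]) (use w s in auto)
  then have "\<bar>q s - q 0\<bar> = s * \<bar>q1 w\<bar>" using w(4) s by (simp add: abs_mult)
  also have "\<dots> \<le> s * C" using C[of w] w s by (intro mult_left_mono) auto
  finally show ?thesis by (simp add: mult.commute)
qed simp

text \<open>A one-sided Glaeser-type inequality. A slope below -(q 0 / s1 + C s1) near 0 would stay
  below -q 0 / s1 up to s1, since the second derivative is bounded by C, and would make q s1
  negative. The length s1 is left free so that the two terms can be balanced later.\<close>

lemma nonneg_segment_lower_bound:
  fixes q :: "real \<Rightarrow> real"
  assumes cont: "continuous_on {0..s1} q"
    and q1: "\<And>s. 0 < s \<Longrightarrow> s \<le> s1 \<Longrightarrow> (q has_real_derivative q1 s) (at s)"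
    and q2: "\<And>s. 0 < s \<Longrightarrow> s \<le> s1 \<Longrightarrow> (q1 has_real_derivative q2 s) (at s)"
    and C: "\<And>s. 0 < s \<Longrightarrow> s \<le> s1 \<Longrightarrow> \<bar>q2 s\<bar> \<le> C"
    and nn: "q s1 \<ge> 0" and s: "0 < s" "s < s1"
  shows "q s \<ge> q 0 - s * (q 0 / s1 + C * s1)"
proof -
  have "continuous_on {0..s} q" by (rule continuous_on_subset[OF cont]) (use s in auto)
  then obtain l w where w: "0 < w" "w < s" "(q has_real_derivative l) (at w)" "q s - q 0 = (s - 0) * l"
    using MVT[of 0 s q] q1 s real_differentiable_def by (metis less_imp_le order_trans)
  have "l = q1 w" by (rule DERIV_unique[OF w(3) q1]) (use w s in auto)
  with w(4) have e1: "q s - q 0 = s * q1 w" by simp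
  have "(q has_real_derivative q1 x) (at x)" if "s \<le> x" "x \<le> s1" for x using q1 that s by auto
  from MVT2[OF s(2) this] obtain w' where w': "s < w'" "w' < s1" "q s1 - q s = (s1 - s) * q1 w'" by blast
  have "w < w'" using w w' by simp
  have "(q1 has_real_derivative q2 x) (at x)" if "w \<le> x" "x \<le> w'" for x using q2 that w w' by auto
  from MVT2[OF \<open>w < w'\<close> this] obtain v where v: "w < v" "v < w'" "q1 w' - q1 w = (w' - w) * q2 v" by blast
  have Cv: "\<bar>q2 v\<bar> \<le> C" using C[of v] v w w' by simp
  have "(w' - w) * q2 v \<le> (w' - w) * C" using Cv v by (intro mult_left_mono) auto
  also have "\<dots> \<le> s1 * C" using Cv w w' by (intro mult_right_mono) auto
  finally have slopes: "q1 w' \<le> q1 w + s1 * C" using v(3) by simp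
  have "0 \<le> q 0 + s * q1 w + (s1 - s) * q1 w'" using nn e1 w'(3) by simp
  also have "\<dots> \<le> q 0 + s * q1 w + (s1 - s) * (q1 w + s1 * C)"
    using slopes s by (intro add_left_mono mult_left_mono) auto
  also have "\<dots> \<le> q 0 + s * q1 w + (s1 - s) * q1 w + s1 * (s1 * C)"
    using s Cv by (simp add: distrib_left mult_right_mono)
  also have "\<dots> = q 0 + s1 * q1 w + s1 * (s1 * C)" by (simp add: algebra_simps)
  finally have "q1 w \<ge> - (q 0 / s1 + C * s1)" using s by (simp add: field_simps)
  from mult_left_mono[OF this less_imp_le[OF s(1)]] e1 show ?thesis by (simp add: algebra_simps)
qed

subsection \<open>Initial barriers\<close>

text \<open>Packages what \<open>interface_growth\<close> asks of \<zeta>. The last clause limits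
  the loss to 2 \<epsilon>; it stops at M = |ln \<epsilon>| because one construction caps large
  values of q. In the application M is fixed, so this only restricts \<epsilon>.\<close>

definition initial_barrier :: "'a::euclidean_space set \<Rightarrow> ('a \<Rightarrow> 'a) \<Rightarrow> ('a \<Rightarrow> real) \<Rightarrow> real \<Rightarrow> real \<Rightarrow> bool" where
  "initial_barrier D \<nu> q C \<epsilon> \<longleftrightarrow> (\<exists>\<zeta> \<zeta>1 \<zeta>2. continuous_on (closure D) \<zeta> \<and> line_C2 D \<zeta> \<zeta>1 \<zeta>2 \<and>
     (\<forall>x\<in>D. \<forall>b\<in>Basis. \<bar>\<zeta>1 b x\<bar> \<le> C \<and> \<bar>\<zeta>2 b x\<bar> \<le> C / (\<epsilon> * \<bar>ln \<epsilon>\<bar>)) \<and>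
     inward_increasing D \<nu> \<zeta> \<and> (\<forall>x\<in>closure D. \<zeta> x \<le> q x) \<and>
     (\<forall>M. 0 \<le> M \<and> M \<le> \<bar>ln \<epsilon>\<bar> \<longrightarrow> (\<forall>x\<in>D. M * \<epsilon> \<le> q x \<longrightarrow> (M - 2) * \<epsilon> \<le> \<zeta> x)))"

text \<open>For \<epsilon>, l > 0 this equals -l ln (exp (-s / l) + \<epsilon>), a smooth minimum of
  s and -l ln \<epsilon>. It is increasing and concave with logistic slope, and its curvature is at
  most 1 / l.\<close>

definition softcap :: "real \<Rightarrow> real \<Rightarrow> real \<Rightarrow> real" where
  "softcap \<epsilon> l s = s - l * ln (1 + \<epsilon> * exp (s / l))"

lemma softcap_DERIV:
  assumes "0 < \<epsilon>" "0 < l"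
  shows "(softcap \<epsilon> l has_real_derivative 1 / (1 + \<epsilon> * exp (s / l))) (at s)"
    "((\<lambda>s. 1 / (1 + \<epsilon> * exp (s / l))) has_real_derivative
      - (\<epsilon> * exp (s / l) / l) / (1 + \<epsilon> * exp (s / l))\<^sup>2) (at s)"
proof -
  define e where "e = \<epsilon> * exp (s / l)"
  have e: "e > 0" using assms by (simp add: e_def)
  have de: "((\<lambda>s. 1 + \<epsilon> * exp (s / l)) has_real_derivative e / l) (at s)"
    using assms by (auto intro!: derivative_eq_intros simp: e_def)
  have "((\<lambda>s. s - l * ln (1 + \<epsilon> * exp (s / l))) has_real_derivative 1 - l * (1 / (1 + \<epsilon> * exp (s / l)) * (e / l))) (at s)"
    using e by (intro DERIV_diff DERIV_ident DERIV_cmult DERIV_chain2[OF DERIV_ln_divide de]) (simp add: e_def)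
  moreover have "1 - l * (1 / (1 + e) * (e / l)) = 1 / (1 + e)"
  proof -
    have "l * (1 / (1 + e) * (e / l)) = e / (1 + e)" using assms by simp
    moreover have "1 - e / (1 + e) = 1 / (1 + e)" using e by (simp add: field_simps)
    ultimately show ?thesis by simp
  qed
  ultimately show "(softcap \<epsilon> l has_real_derivative 1 / (1 + \<epsilon> * exp (s / l))) (at s)"
    by (simp add: softcap_def[abs_def] e_def)
  show "((\<lambda>s. 1 / (1 + \<epsilon> * exp (s / l))) has_real_derivative
      - (\<epsilon> * exp (s / l) / l) / (1 + \<epsilon> * exp (s / l))\<^sup>2) (at s)"
    using DERIV_divide[OF DERIV_const[of 1] de] e by (simp add: e_def power2_eq_square)
qed

lemma softcap_mono: "0 < \<epsilon> \<Longrightarrow> 0 < l \<Longrightarrow> s \<le> t \<Longrightarrow> softcap \<epsilon> l s \<le> softcap \<epsilon> l t"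
  by (rule DERIV_nonneg_imp_nondecreasing[of s t], assumption)
    (use softcap_DERIV(1) in \<open>force intro!: exI add_nonneg_nonneg\<close>)

lemma softcap_bounds:
  assumes "0 < \<epsilon>" "0 < l"
  shows "softcap \<epsilon> l s \<le> s" "softcap \<epsilon> l s \<ge> s - l * (\<epsilon> * exp (s / l))"
    "0 \<le> 1 / (1 + \<epsilon> * exp (s / l))" "1 / (1 + \<epsilon> * exp (s / l)) \<le> 1"
    "\<bar>- (\<epsilon> * exp (s / l) / l) / (1 + \<epsilon> * exp (s / l))\<^sup>2\<bar> \<le> 1 / l"
proof -
  define e where "e = \<epsilon> * exp (s / l)"
  have e: "e > 0" using assms by (simp add: e_def)
  show "softcap \<epsilon> l s \<le> s" using assms e by (simp add: softcap_def e_def)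
  have "ln (1 + e) \<le> e" using e by (intro ln_add_one_self_le_self) simp
  then show "softcap \<epsilon> l s \<ge> s - l * (\<epsilon> * exp (s / l))"
    using assms by (simp add: softcap_def e_def)
  show "0 \<le> 1 / (1 + \<epsilon> * exp (s / l))" "1 / (1 + \<epsilon> * exp (s / l)) \<le> 1"
    using e by (auto simp: e_def[symmetric])
  have "e \<le> 1 * (1 + e)\<^sup>2" using e by (simp add: power2_eq_square algebra_simps)
  then have "e / (1 + e)\<^sup>2 \<le> 1" using e by (subst pos_divide_le_eq) auto
  then have "e / (1 + e)\<^sup>2 / l \<le> 1 / l" using assms by (intro divide_right_mono) auto
  then show "\<bar>- (\<epsilon> * exp (s / l) / l) / (1 + \<epsilon> * exp (s / l))\<^sup>2\<bar> \<le> 1 / l"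
    unfolding e_def[symmetric] using e assms by (simp add: abs_mult mult.commute)
qed

text \<open>By concavity the slope on [Q / 2, Q] is at most the slope at Q / 2, a value that depends
  on Q alone.\<close>

lemma softcap_decrease:
  assumes \<epsilon>: "0 < \<epsilon>" "0 < l" and Q: "Q / 2 \<le> s" "s \<le> Q"
  shows "softcap \<epsilon> l Q - softcap \<epsilon> l s \<le> 1 / (1 + \<epsilon> * exp (Q / 2 / l)) * (Q - s)"
proof (cases "s = Q")
  case False
  then have "s < Q" using Q by simp
  from MVT2[OF this softcap_DERIV(1)[OF \<epsilon>]] obtain w where w: "s < w" "w < Q"
    "softcap \<epsilon> l Q - softcap \<epsilon> l s = (Q - s) * (1 / (1 + \<epsilon> * exp (w / l)))" by blast
  have "exp (Q / 2 / l) \<le> exp (w / l)" 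
  proof -
    have "Q / 2 / l \<le> w / l" using Q w \<epsilon> by (intro divide_right_mono) auto
    then show ?thesis by (simp only: exp_le_cancel_iff)
  qed
  then have "1 / (1 + \<epsilon> * exp (w / l)) \<le> 1 / (1 + \<epsilon> * exp (Q / 2 / l))"
    using \<epsilon> by (intro divide_left_mono) (auto intro!: mult_pos_pos add_pos_pos)
  then have "(Q - s) * (1 / (1 + \<epsilon> * exp (w / l))) \<le> (Q - s) * (1 / (1 + \<epsilon> * exp (Q / 2 / l)))"
    using \<open>s < Q\<close> by (intro mult_left_mono) auto
  then show ?thesis using w(3) by (simp add: mult.commute)
qed simp

text \<open>Up to Q = 4 l |ln \<epsilon>| the slope bound 1 suffices. Beyond it, exp (Q / (2 l))
  overcomes the factor \<epsilon> with exp (Q / (4 l)) to spare, which dominates Q / (4 l). Thus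
  arbitrarily large boundary values contribute no more than order l |ln \<epsilon>| to the wrong
  slope.\<close>

lemma softcap_slope_times_value:
  fixes \<epsilon> l Q :: real
  assumes "0 < \<epsilon>" "\<epsilon> \<le> exp (- 1)" "0 < l" "0 \<le> Q"
  shows "1 / (1 + \<epsilon> * exp (Q / 2 / l)) * Q \<le> 4 * l * \<bar>ln \<epsilon>\<bar>"
proof -
  define L where "L = \<bar>ln \<epsilon>\<bar>"
  have "ln \<epsilon> \<le> - 1" using ln_mono[OF assms(2,1)] by simp
  then have "L = - ln \<epsilon>" "L \<ge> 1" by (auto simp: L_def)
  then have L: "L \<ge> 1" "\<epsilon> = exp (- L)" using assms(1) by auto
  have le: "1 / (1 + \<epsilon> * exp (Q / 2 / l)) * Q \<le> Q"
    using softcap_bounds(4)[OF assms(1,3), of "Q / 2"] assms(4)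
    by (metis mult_left_le_one_le softcap_bounds(3)[OF assms(1,3), of "Q / 2"])
  show ?thesis
  proof (cases "Q \<le> 4 * l * L")
    case True
    then show ?thesis using le by (simp add: L_def)
  next
    case False
    then have "L \<le> Q / (4 * l)" using assms by (simp add: field_simps)
    then have "Q / (4 * l) \<le> - L + Q / 2 / l" using assms by (simp add: field_simps)
    then have "exp (Q / (4 * l)) \<le> \<epsilon> * exp (Q / 2 / l)" unfolding L(2) by (simp flip: exp_add)
    moreover have "Q / (4 * l) \<le> exp (Q / (4 * l))"
      using exp_ge_add_one_self[of "Q / (4 * l)"] by linarith
    ultimately have "Q / (4 * l) \<le> 1 + \<epsilon> * exp (Q / 2 / l)" by simp
    then have "Q \<le> 4 * l * (1 + \<epsilon> * exp (Q / 2 / l))" using assms by (simp add: field_simps)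
    moreover have "1 + \<epsilon> * exp (Q / 2 / l) > 0" using assms by (simp add: add_pos_pos)
    ultimately have "1 / (1 + \<epsilon> * exp (Q / 2 / l)) * Q \<le> 4 * l" by (simp add: divide_le_eq)
    also have "\<dots> \<le> 4 * l * L" using assms L by simp
    finally show ?thesis by (simp add: L_def)
  qed
qed

section \<open>Exponential boundary layers and the modified initial data\<close>

lemma boundary_layer_C2:
  assumes d: "line_C2 D d d1 d2" and l: "0 < l"
  shows "line_C2 D (\<lambda>x. k * exp (- d x / l)) (\<lambda>b x. - (k / l) * exp (- d x / l) * d1 b x)
     (\<lambda>b x. - (k / l) * exp (- d x / l) * d2 b x + k / l\<^sup>2 * exp (- d x / l) * (d1 b x)\<^sup>2)"
proof -
  have 1: "((\<lambda>y. k * exp (- y / l)) has_real_derivative - (k / l) * exp (- y / l)) (at y)" for y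
    using l by (auto intro!: derivative_eq_intros)
  have 2: "((\<lambda>y. - (k / l) * exp (- y / l)) has_real_derivative k / l\<^sup>2 * exp (- y / l)) (at y)" for y
    using l by (auto intro!: derivative_eq_intros simp: power2_eq_square)
  show ?thesis by (rule line_C2_compose[OF d 1 2])
qed

lemma boundary_layer_bounds:
  fixes k l C d1 d2 y :: real
  assumes "0 < l" "0 \<le> k" "0 \<le> y" "\<bar>d1\<bar> \<le> C" "\<bar>d2\<bar> \<le> C"
  shows "\<bar>- (k / l) * exp (- y / l) * d1\<bar> \<le> k / l * C"
    "\<bar>- (k / l) * exp (- y / l) * d2 + k / l\<^sup>2 * exp (- y / l) * d1\<^sup>2\<bar> \<le> k / l * C + k / l\<^sup>2 * C\<^sup>2"
proof -
  have e: "0 \<le> exp (- y / l)" "exp (- y / l) \<le> 1" using assms by auto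
  have *: "\<bar>- (k / l) * exp (- y / l) * v\<bar> \<le> k / l * C" if "\<bar>v\<bar> \<le> C" for v
  proof -
    have "k / l * exp (- y / l) * \<bar>v\<bar> \<le> k / l * 1 * C"
      using assms e that by (intro mult_mono) auto
    then show ?thesis using assms by (simp add: abs_mult)
  qed
  show "\<bar>- (k / l) * exp (- y / l) * d1\<bar> \<le> k / l * C" by (rule *[OF assms(4)])
  have "d1\<^sup>2 \<le> C\<^sup>2" using assms by (simp add: abs_le_square_iff[symmetric])
  then have "k / l\<^sup>2 * exp (- y / l) * d1\<^sup>2 \<le> k / l\<^sup>2 * 1 * C\<^sup>2"
    using assms e by (intro mult_mono) auto
  moreover have "0 \<le> k / l\<^sup>2 * exp (- y / l) * d1\<^sup>2" using assms by simp
  ultimately show "\<bar>- (k / l) * exp (- y / l) * d2 + k / l\<^sup>2 * exp (- y / l) * d1\<^sup>2\<bar> \<le> k / l * C + k / l\<^sup>2 * C\<^sup>2"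
    using *[OF assms(5)] by linarith
qed

text \<open>On [0, 1] the product (1 - t / 2) (1 + t) is at least 1, whence exp (-t) <= 1 - t / 2.
  Within one width l the layer therefore loses height at a rate of at least k / (2 l) along the
  inward normal.\<close>

lemma boundary_layer_gain:
  fixes k l s y :: real
  assumes "0 < l" "0 \<le> k" "0 \<le> s" "s \<le> l" "s \<le> y"
  shows "k * exp (- y / l) \<le> k - k / (2 * l) * s"
proof -
  define t where "t = s / l"
  have t: "0 \<le> t" "t \<le> 1" "t \<le> y / l" using assms by (auto simp: t_def divide_right_mono)
  have "(1 - t / 2) * (1 + t) \<ge> 1" using t mult_left_mono[of t 1 t] by (simp add: algebra_simps)
  moreover have "1 + t \<le> exp t" by (rule exp_ge_add_one_self)
  then have "(1 - t / 2) * (1 + t) \<le> (1 - t / 2) * exp t" using t by (intro mult_left_mono) auto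
  ultimately have "1 \<le> (1 - t / 2) * exp t" by linarith
  then have "exp (- t) \<le> 1 - t / 2" by (simp add: exp_minus field_simps)
  moreover have "exp (- y / l) \<le> exp (- t)" using t by simp
  ultimately have "exp (- y / l) \<le> 1 - t / 2" by linarith
  from mult_left_mono[OF this assms(2)] show ?thesis by (simp add: t_def algebra_simps)
qed

text \<open>Near the boundary the initial datum may approach the unstable zero while its normal derivative
  has the wrong sign.  Capping it at height \<open>\<epsilon> \<bar>ln \<epsilon>\<bar>\<close> leaves a wrong slope of order
  \<open>sqrt \<epsilon> * \<bar>ln \<epsilon>\<bar>\<^sup>2\<close> only, which a layer of height \<open>\<epsilon>\<close> and width \<open>\<epsilon> \<bar>ln \<epsilon>\<bar>\<close> corrects.  The Laplacian
  of size \<open>1 / (\<epsilon> \<bar>ln \<epsilon>\<bar>)\<close> created this way costs a shift of order \<open>\<epsilon>\<close> only.\<close>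

lemma initial_barrier_nonneg_boundary:
  fixes D :: "'a::euclidean_space set"
  assumes d: "continuous_on UNIV d" "line_C2 D d d1 d2" "C > 0"
    "\<And>x b. x \<in> D \<Longrightarrow> b \<in> Basis \<Longrightarrow> \<bar>d1 b x\<bar> \<le> C \<and> \<bar>d2 b x\<bar> \<le> C"
    "\<And>x. x \<in> closure D \<Longrightarrow> 0 \<le> d x" "\<And>x. x \<in> frontier D \<Longrightarrow> d x = 0"
    "\<And>z. z \<in> frontier D \<Longrightarrow> \<exists>\<delta>>0. \<forall>s. 0 < s \<and> s < \<delta> \<longrightarrow> s \<le> d (z - s *\<^sub>R \<nu> z)"
    and q: "continuous_on (closure D) q" "line_C2 D q q1 q2"
    "\<And>x b. x \<in> D \<Longrightarrow> b \<in> Basis \<Longrightarrow> \<bar>q1 b x\<bar> \<le> C \<and> \<bar>q2 b x\<bar> \<le> C"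
    and s0: "s0 > 0" "\<And>z s. z \<in> frontier D \<Longrightarrow> 0 < s \<Longrightarrow> s \<le> s0 \<Longrightarrow> z - s *\<^sub>R \<nu> z \<in> D"
    "\<And>z. z \<in> frontier D \<Longrightarrow> q z \<ge> 0"
    "\<And>z s. z \<in> frontier D \<Longrightarrow> 0 < s \<Longrightarrow> s \<le> s0 \<Longrightarrow> q (z - s *\<^sub>R \<nu> z) \<ge> 0"
    "\<And>z s s1. z \<in> frontier D \<Longrightarrow> 0 < s \<Longrightarrow> s < s1 \<Longrightarrow> s1 \<le> s0 \<Longrightarrow>
       q (z - s *\<^sub>R \<nu> z) \<ge> q z - s * (q z / s1 + C * s1)"
  obtains C0 \<epsilon>0 where "C0 > 0" "\<epsilon>0 > 0" "\<And>\<epsilon>. 0 < \<epsilon> \<Longrightarrow> \<epsilon> < \<epsilon>0 \<Longrightarrow> initial_barrier D \<nu> q C0 \<epsilon>"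
proof -
  define C0 where "C0 = 2 * C + 2 * C\<^sup>2"
  have C0: "C0 > 0" using d(3) by (simp add: C0_def add_pos_pos)
  \<comment> \<open>The four limits make the cap harmless at heights up to \<epsilon> |ln
    \<epsilon>|, the wrong slope smaller than the layer slope 1 / (2 |ln \<epsilon>|), the segments
    of length sqrt \<epsilon> admissible, and |ln \<epsilon>| at least 1.\<close>
  have lim1: "((\<lambda>\<epsilon> :: real. \<epsilon> * \<bar>ln \<epsilon>\<bar>) \<longlongrightarrow> 0) (at_right 0)" by real_asymp
  have lim2: "((\<lambda>\<epsilon>. 2 * \<bar>ln \<epsilon>\<bar> * (sqrt \<epsilon> * (4 * \<bar>ln \<epsilon>\<bar>\<^sup>2 + C))) \<longlongrightarrow> 0) (at_right 0)" by real_asymp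
  have lim3: "((\<lambda>\<epsilon> :: real. sqrt \<epsilon>) \<longlongrightarrow> 0) (at_right 0)" by real_asymp
  have lim4: "((\<lambda>\<epsilon>. \<epsilon>) \<longlongrightarrow> 0) (at_right (0::real))" by real_asymp
  have "\<forall>\<^sub>F \<epsilon> in at_right 0. \<epsilon> * \<bar>ln \<epsilon>\<bar> < exp (- 1) \<and>
    2 * \<bar>ln \<epsilon>\<bar> * (sqrt \<epsilon> * (4 * \<bar>ln \<epsilon>\<bar>\<^sup>2 + C)) < 1 \<and> sqrt \<epsilon> < s0 \<and> \<epsilon> < exp (- 1)"
    by (intro eventually_conj order_tendstoD(2)[OF lim1] order_tendstoD(2)[OF lim2]
      order_tendstoD(2)[OF lim3] order_tendstoD(2)[OF lim4]) (use s0 in auto)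
  then obtain \<epsilon>0 where \<epsilon>0: "\<epsilon>0 > 0" "\<And>\<epsilon>. 0 < \<epsilon> \<Longrightarrow> \<epsilon> < \<epsilon>0 \<Longrightarrow> \<epsilon> * \<bar>ln \<epsilon>\<bar> < exp (- 1) \<and>
    2 * \<bar>ln \<epsilon>\<bar> * (sqrt \<epsilon> * (4 * \<bar>ln \<epsilon>\<bar>\<^sup>2 + C)) < 1 \<and> sqrt \<epsilon> < s0 \<and> \<epsilon> < exp (- 1)"
    by (auto simp: eventually_at_right_field)
  show ?thesis
  proof (rule that[OF C0 \<epsilon>0(1)])
    fix \<epsilon> :: real assume \<epsilon>: "0 < \<epsilon>" "\<epsilon> < \<epsilon>0"
    define L where "L = \<bar>ln \<epsilon>\<bar>"
    define l where "l = \<epsilon> * L"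
    \<comment> \<open>Balances the terms Q / s1 and C s1 of the slope bound: after the cap, Q times
      the slope is at most 4 \<epsilon> L^2, so both become sqrt \<epsilon> up to
      logarithms.\<close>
    define s1 where "s1 = sqrt \<epsilon>"
    have small: "l < exp (- 1)" "2 * L * (s1 * (4 * L\<^sup>2 + C)) < 1" "s1 < s0" "\<epsilon> < exp (- 1)"
      using \<epsilon>0(2)[OF \<epsilon>] by (auto simp: L_def l_def s1_def)
    have "ln \<epsilon> \<le> - 1" using ln_mono[OF less_imp_le[OF small(4)] \<epsilon>(1)] by simp
    then have L: "L \<ge> 1" by (simp add: L_def)
    have l: "l > 0" "l \<le> 1" using L \<epsilon> small(1) exp_le_one_iff[of "-1::real"] by (auto simp: l_def simp del: exp_le_one_iff)
    have s1: "s1 > 0" "s1 * s1 = \<epsilon>" using \<epsilon> by (auto simp: s1_def)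
    have \<epsilon>l: "\<epsilon> / l \<le> 1" "\<epsilon> / l = 1 / L" using L \<epsilon> by (auto simp: l_def)
    define \<zeta> where "\<zeta> = (\<lambda>x. softcap \<epsilon> l (q x) + - 1 * (\<epsilon> * exp (- d x / l)))"
    have layer_le: "exp (- d x / l) \<le> 1" if "x \<in> closure D" for x using d(5)[OF that] l by simp
    have cont: "continuous_on (closure D) \<zeta>"
    proof -
      have "continuous_on UNIV (softcap \<epsilon> l)"
        by (rule DERIV_continuous_on[of UNIV]) (use softcap_DERIV(1)[OF \<epsilon>(1) l(1)] in auto)
      then have "continuous_on (closure D) (\<lambda>x. softcap \<epsilon> l (q x))"
        by (rule continuous_on_compose2[OF _ q(1)]) auto
      then show ?thesis unfolding \<zeta>_def using l
        by (intro continuous_intros continuous_on_subset[OF d(1)]) auto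
    qed
    note C2 = line_C2_add[OF line_C2_compose[OF q(2) softcap_DERIV[OF \<epsilon>(1) l(1)]]
      line_C2_cmult[OF boundary_layer_C2[OF d(2) l(1), of \<epsilon>], of "- 1"]]
    have bounds: "\<bar>1 / (1 + \<epsilon> * exp (q x / l)) * q1 b x +
        - 1 * (- (\<epsilon> / l) * exp (- d x / l) * d1 b x)\<bar> \<le> C0 \<and>
      \<bar>1 / (1 + \<epsilon> * exp (q x / l)) * q2 b x +
          - (\<epsilon> * exp (q x / l) / l) / (1 + \<epsilon> * exp (q x / l))\<^sup>2 * (q1 b x)\<^sup>2 +
        - 1 * (- (\<epsilon> / l) * exp (- d x / l) * d2 b x + \<epsilon> / l\<^sup>2 * exp (- d x / l) * (d1 b x)\<^sup>2)\<bar> \<le> C0 / l"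
      if x: "x \<in> D" "b \<in> Basis" for x b
    proof -
      define h1 where "h1 = 1 / (1 + \<epsilon> * exp (q x / l))"
      define h2 where "h2 = - (\<epsilon> * exp (q x / l) / l) / (1 + \<epsilon> * exp (q x / l))\<^sup>2"
      have h: "0 \<le> h1" "h1 \<le> 1" "\<bar>h2\<bar> \<le> 1 / l"
        unfolding h1_def h2_def by (rule softcap_bounds[OF \<epsilon>(1) l(1)])+
      have hq: "\<bar>h1 * v\<bar> \<le> C" if "\<bar>v\<bar> \<le> C" for v
        using mult_mono[OF h(2) that] h(1) by (simp add: abs_mult)
      have "(q1 b x)\<^sup>2 \<le> C\<^sup>2" using q(3)[OF x] d(3) by (simp add: abs_le_square_iff[symmetric])
      then have h2q: "\<bar>h2 * (q1 b x)\<^sup>2\<bar> \<le> 1 / l * C\<^sup>2"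
        unfolding abs_mult using h(3) l by (intro mult_mono) auto
      have dx: "0 \<le> d x" "\<bar>d1 b x\<bar> \<le> C" "\<bar>d2 b x\<bar> \<le> C"
        using d(4)[OF x] d(5)[of x] x(1) closure_subset[of D] by auto
      note lay = boundary_layer_bounds[OF l(1) less_imp_le[OF \<epsilon>(1)] dx]
      have "\<epsilon> / l * C \<le> C" using mult_right_mono[OF \<epsilon>l(1), of C] d(3) by simp
      moreover have "\<epsilon> / l\<^sup>2 * C\<^sup>2 \<le> 1 / l * C\<^sup>2"
        using divide_right_mono[OF \<epsilon>l(1), of l] l by (intro mult_right_mono) (auto simp: power2_eq_square)
      moreover have "C \<le> C / l" "C * 2 + C\<^sup>2 * 2 / l \<le> C0 / l"
        using l d(3) mult_left_mono[of l 1 C] by (auto simp: C0_def field_simps)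
      moreover have "C0 \<ge> 2 * C" by (simp add: C0_def)
      ultimately have "\<bar>h1 * q1 b x + - 1 * (- (\<epsilon> / l) * exp (- d x / l) * d1 b x)\<bar> \<le> C0 \<and>
        \<bar>h1 * q2 b x + h2 * (q1 b x)\<^sup>2 +
        - 1 * (- (\<epsilon> / l) * exp (- d x / l) * d2 b x + \<epsilon> / l\<^sup>2 * exp (- d x / l) * (d1 b x)\<^sup>2)\<bar> \<le> C0 / l"
        using hq[of "q1 b x"] hq[of "q2 b x"] q(3)[OF x] h2q lay
        unfolding abs_le_iff by (simp add: algebra_simps)
      then show ?thesis unfolding h1_def h2_def .
    qed
    have inc: "inward_increasing D \<nu> \<zeta>"
      unfolding inward_increasing_def
    proof
      fix z assume z: "z \<in> frontier D"
      define Q where "Q = q z"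
      have Q: "Q \<ge> 0" using s0(3)[OF z] by (simp add: Q_def)
      define S where "S = Q / s1 + C * s1"
      have S: "S > 0" using Q s1 d(3) by (simp add: S_def add_nonneg_pos)
      define \<kappa> where "\<kappa> = s1 * (4 * L\<^sup>2 + C)"
      \<comment> \<open>The layer of height \<epsilon> and width l = \<epsilon> L gains slope 1 / (2
        L); \<kappa> bounds the inward descent of the capped datum.\<close>
      define c where "c = 1 / (2 * L) - \<kappa>"
      have "c > 0" using small(2) L by (simp add: c_def \<kappa>_def field_simps)
      have "\<kappa> \<ge> 0" using s1 d(3) by (simp add: \<kappa>_def)
      obtain \<delta>1 where \<delta>1: "\<delta>1 > 0" "\<And>s. 0 < s \<Longrightarrow> s < \<delta>1 \<Longrightarrow> s \<le> d (z - s *\<^sub>R \<nu> z)"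
        using d(7)[OF z] by blast
      \<comment> \<open>For Q > 0 this keeps the drop s S within Q / 2, where the slope of the cap
        at Q / 2 applies. For Q = 0 the nonnegative datum cannot drop below Q, and 1 is an arbitrary
        positive value.\<close>
      define \<delta>2 where "\<delta>2 = (if Q = 0 then 1 else Q / (2 * S))"
      have "\<delta>2 > 0" using Q S by (auto simp: \<delta>2_def)
      define \<delta> where "\<delta> = Min {\<delta>1, \<delta>2, s1, l}"
      have \<delta>: "\<delta> > 0" "\<delta> \<le> \<delta>1" "\<delta> \<le> \<delta>2" "\<delta> \<le> s1" "\<delta> \<le> l"
        using \<delta>1 \<open>\<delta>2 > 0\<close> s1 l by (auto simp: \<delta>_def)
      have "z - s *\<^sub>R \<nu> z \<in> D \<and> \<zeta> z + c * s \<le> \<zeta> (z - s *\<^sub>R \<nu> z)" if s: "0 < s" "s < \<delta>" for s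
      proof
        define w where "w = z - s *\<^sub>R \<nu> z"
        show "z - s *\<^sub>R \<nu> z \<in> D" using s0(2)[OF z, of s] s \<delta> small(3) by simp
        have qw0: "q w \<ge> 0" using s0(4)[OF z, of s] s \<delta> small(3) by (simp add: w_def)
        have qw: "q w \<ge> Q - s * S"
          using s0(5)[OF z, of s s1] s \<delta> small(3) by (simp add: w_def Q_def S_def)
        have cap: "softcap \<epsilon> l Q - \<kappa> * s \<le> softcap \<epsilon> l (q w)"
        proof (cases "Q \<le> q w")
          case True
          have "\<kappa> * s \<ge> 0" using \<open>\<kappa> \<ge> 0\<close> s by simp
          then show ?thesis using softcap_mono[OF \<epsilon>(1) l(1) True] by simp
        next
          case False
          then have "Q > 0" using qw0 by simp
          have "s * S \<le> \<delta>2 * S" using s \<delta>(3) S by (intro mult_right_mono) auto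
          then have "s * S \<le> Q / 2" using \<open>Q > 0\<close> S by (simp add: \<delta>2_def)
          then have half: "Q / 2 \<le> q w" using qw by simp
          define h where "h = 1 / (1 + \<epsilon> * exp (Q / 2 / l))"
          have h: "0 \<le> h" "h \<le> 1" unfolding h_def using softcap_bounds(3,4)[OF \<epsilon>(1) l(1), of "Q / 2"] by auto
          have hQ: "h * Q \<le> 4 * l * L"
            unfolding h_def L_def using small(4) l Q \<epsilon> by (intro softcap_slope_times_value) auto
          have "softcap \<epsilon> l Q - softcap \<epsilon> l (q w) \<le> h * (Q - q w)"
            unfolding h_def using half False by (intro softcap_decrease \<epsilon> l) auto
          also have "\<dots> \<le> h * (s * S)" using qw h by (intro mult_left_mono) auto
          also have "\<dots> = s * (h * Q / s1 + h * (C * s1))" by (simp add: S_def algebra_simps)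
          also have "\<dots> \<le> s * (4 * l * L / s1 + 1 * (C * s1))"
            using s hQ s1 h d(3) by (intro mult_left_mono add_mono divide_right_mono mult_right_mono) auto
          also have "4 * l * L / s1 + 1 * (C * s1) = \<kappa>"
            unfolding l_def \<kappa>_def s1(2)[symmetric] using s1(1) by (simp add: field_simps power2_eq_square)
          finally show ?thesis by (simp add: mult.commute)
        qed
        have "s \<le> d w" using \<delta>1(2)[of s] s \<delta> by (simp add: w_def)
        then have "\<epsilon> * exp (- d w / l) \<le> \<epsilon> - \<epsilon> / (2 * l) * s"
          using s \<delta> l \<epsilon> by (intro boundary_layer_gain) auto
        moreover have "\<epsilon> / (2 * l) * s = 1 / (2 * L) * s" using \<epsilon>l(2) by (metis divide_divide_eq_left mult.commute)
        ultimately have lay: "\<epsilon> * exp (- d w / l) \<le> \<epsilon> - 1 / (2 * L) * s" by simp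
        have "\<zeta> z = softcap \<epsilon> l Q - \<epsilon>" using d(6)[OF z] by (simp add: \<zeta>_def Q_def)
        then have "\<zeta> z + c * s \<le> \<zeta> w" using cap lay unfolding \<zeta>_def c_def left_diff_distrib by linarith
        then show "\<zeta> z + c * s \<le> \<zeta> (z - s *\<^sub>R \<nu> z)" by (simp add: w_def)
      qed
      then show "\<exists>c>0. \<exists>\<delta>>0. \<forall>s. 0 < s \<and> s < \<delta> \<longrightarrow> z - s *\<^sub>R \<nu> z \<in> D \<and> \<zeta> z + c * s \<le> \<zeta> (z - s *\<^sub>R \<nu> z)"
        using \<open>c > 0\<close> \<delta>(1) by blast
    qed
    have upper: "\<zeta> x \<le> q x" for x
      using softcap_bounds(1)[OF \<epsilon>(1) l(1), of "q x"] \<epsilon> by (simp add: \<zeta>_def add_increasing2 order_trans[OF _ softcap_bounds(1)[OF \<epsilon>(1) l(1), of "q x"]])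
    have lower: "(M - 2) * \<epsilon> \<le> \<zeta> x" if M: "0 \<le> M" "M \<le> L" and x: "x \<in> D" "M * \<epsilon> \<le> q x" for M x
    proof -
      \<comment> \<open>This is where M <= |ln \<epsilon>| enters: the exponential in the cap is
        then at most e, and l < exp (-1) bounds the loss by \<epsilon>. The layer loses another
        \<epsilon>, which explains the 2 in \<open>initial_barrier\<close>.\<close>
      have "M * \<epsilon> / l \<le> 1" using M L \<epsilon> by (simp add: l_def)
      then have "exp (M * \<epsilon> / l) \<le> exp 1" by simp
      then have "l * exp (M * \<epsilon> / l) \<le> exp (- 1) * exp 1" using small(1) l by (intro mult_mono) auto
      then have "l * exp (M * \<epsilon> / l) \<le> 1" by (simp flip: exp_add)
      from mult_left_mono[OF this less_imp_le[OF \<epsilon>(1)]]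
      have "l * (\<epsilon> * exp (M * \<epsilon> / l)) \<le> \<epsilon>" by (simp add: mult_ac)
      then have "M * \<epsilon> - \<epsilon> \<le> softcap \<epsilon> l (M * \<epsilon>)"
        using softcap_bounds(2)[OF \<epsilon>(1) l(1), of "M * \<epsilon>"] by linarith
      also have "\<dots> \<le> softcap \<epsilon> l (q x)" by (rule softcap_mono[OF \<epsilon>(1) l(1) x(2)])
      finally have "M * \<epsilon> - \<epsilon> \<le> softcap \<epsilon> l (q x)" .
      moreover have "\<epsilon> * exp (- d x / l) \<le> \<epsilon>"
        using layer_le[of x] x(1) closure_subset[of D] \<epsilon> by auto
      ultimately show ?thesis by (simp add: \<zeta>_def algebra_simps)
    qed
    show "initial_barrier D \<nu> q C0 \<epsilon>"
      unfolding initial_barrier_def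
      by (intro exI[of _ \<zeta>] exI conjI)
        (rule cont, rule C2[folded \<zeta>_def], use bounds inc upper lower in \<open>auto simp: L_def l_def\<close>)
  qed
qed

text \<open>Where q >= 0 the function d is at least c0. A steep layer of amplitude K l can therefore
  be subtracted: it reverses any slope of q at the boundary, yet at depth c0 it has decayed to K l
  exp (-c0 / l), which is below \<epsilon> for small \<epsilon>.\<close>

lemma initial_barrier_interior:
  fixes D :: "'a::euclidean_space set"
  assumes d: "continuous_on UNIV d" "line_C2 D d d1 d2" "C > 0"
    "\<And>x b. x \<in> D \<Longrightarrow> b \<in> Basis \<Longrightarrow> \<bar>d1 b x\<bar> \<le> C \<and> \<bar>d2 b x\<bar> \<le> C"
    "\<And>x. x \<in> closure D \<Longrightarrow> 0 \<le> d x" "\<And>x. x \<in> frontier D \<Longrightarrow> d x = 0"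
    "\<And>z. z \<in> frontier D \<Longrightarrow> \<exists>\<delta>>0. \<forall>s. 0 < s \<and> s < \<delta> \<longrightarrow> s \<le> d (z - s *\<^sub>R \<nu> z)"
    and q: "continuous_on (closure D) q" "line_C2 D q q1 q2"
    "\<And>x b. x \<in> D \<Longrightarrow> b \<in> Basis \<Longrightarrow> \<bar>q1 b x\<bar> \<le> C \<and> \<bar>q2 b x\<bar> \<le> C"
    and s0: "s0 > 0" "\<And>z s. z \<in> frontier D \<Longrightarrow> 0 < s \<Longrightarrow> s \<le> s0 \<Longrightarrow> z - s *\<^sub>R \<nu> z \<in> D"
    "\<And>z s. z \<in> frontier D \<Longrightarrow> 0 < s \<Longrightarrow> s \<le> s0 \<Longrightarrow> q (z - s *\<^sub>R \<nu> z) \<ge> q z - C * s"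
    and c0: "c0 > 0" "\<And>x. x \<in> D \<Longrightarrow> q x \<ge> 0 \<Longrightarrow> c0 \<le> d x"
  obtains C0 \<epsilon>0 where "C0 > 0" "\<epsilon>0 > 0" "\<And>\<epsilon>. 0 < \<epsilon> \<Longrightarrow> \<epsilon> < \<epsilon>0 \<Longrightarrow> initial_barrier D \<nu> q C0 \<epsilon>"
proof -
  \<comment> \<open>The layer gains slope K / 2 = C + 1, of which C compensates the datum and 1
    remains.\<close>
  define K where "K = 2 * (C + 1)"
  have K: "K > 0" using d(3) by (simp add: K_def)
  define C0 where "C0 = C + K * C + K * C\<^sup>2"
  have C0: "C0 > 0" using d(3) K by (simp add: C0_def add_pos_pos)
  have lim1: "((\<lambda>\<epsilon> :: real. \<epsilon> * \<bar>ln \<epsilon>\<bar>) \<longlongrightarrow> 0) (at_right 0)" by real_asymp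
  have lim2: "((\<lambda>\<epsilon> :: real. K * \<bar>ln \<epsilon>\<bar> * exp (- c0 / (\<epsilon> * \<bar>ln \<epsilon>\<bar>))) \<longlongrightarrow> 0) (at_right 0)"
    using c0(1) K by real_asymp
  have "\<forall>\<^sub>F \<epsilon> in at_right (0::real). \<epsilon> * \<bar>ln \<epsilon>\<bar> < 1 \<and> K * \<bar>ln \<epsilon>\<bar> * exp (- c0 / (\<epsilon> * \<bar>ln \<epsilon>\<bar>)) < 1"
    by (intro eventually_conj order_tendstoD(2)[OF lim1] order_tendstoD(2)[OF lim2]) auto
  then obtain e0 where e0: "e0 > 0" "\<And>\<epsilon>. 0 < \<epsilon> \<Longrightarrow> \<epsilon> < e0 \<Longrightarrow> \<epsilon> * \<bar>ln \<epsilon>\<bar> < 1 \<and>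
    K * \<bar>ln \<epsilon>\<bar> * exp (- c0 / (\<epsilon> * \<bar>ln \<epsilon>\<bar>)) < 1"
    by (auto simp: eventually_at_right_field)
  define \<epsilon>0 where "\<epsilon>0 = min e0 1"
  have "\<epsilon>0 > 0" using e0 by (simp add: \<epsilon>0_def)
  show ?thesis
  proof (rule that[OF C0 \<open>\<epsilon>0 > 0\<close>])
    fix \<epsilon> :: real assume \<epsilon>: "0 < \<epsilon>" "\<epsilon> < \<epsilon>0"
    define L where "L = \<bar>ln \<epsilon>\<bar>"
    define l where "l = \<epsilon> * L"
    have small: "l < 1" "K * L * exp (- c0 / l) < 1" "\<epsilon> < 1"
      using e0(2)[of \<epsilon>] \<epsilon> by (auto simp: L_def l_def \<epsilon>0_def)
    have L: "L > 0" using \<epsilon> small(3) by (simp add: L_def)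
    have l: "l > 0" using L \<epsilon> by (simp add: l_def)
    have Kl: "K * l \<ge> 0" using K l by simp
    define \<zeta> where "\<zeta> = (\<lambda>x. q x + - 1 * (K * l * exp (- d x / l)))"
    have cont: "continuous_on (closure D) \<zeta>"
      unfolding \<zeta>_def using l by (intro continuous_intros q(1) continuous_on_subset[OF d(1)]) auto
    note C2 = line_C2_add[OF q(2) line_C2_cmult[OF boundary_layer_C2[OF d(2) l, of "K * l"], of "- 1"]]
    have bounds: "\<bar>q1 b x + - 1 * (- (K * l / l) * exp (- d x / l) * d1 b x)\<bar> \<le> C0 \<and>
      \<bar>q2 b x + - 1 * (- (K * l / l) * exp (- d x / l) * d2 b x + K * l / l\<^sup>2 * exp (- d x / l) * (d1 b x)\<^sup>2)\<bar> \<le> C0 / l"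
      if x: "x \<in> D" "b \<in> Basis" for x b
    proof -
      have dx: "0 \<le> d x" "\<bar>d1 b x\<bar> \<le> C" "\<bar>d2 b x\<bar> \<le> C"
        using d(4)[OF x] d(5)[of x] x(1) closure_subset[of D] by auto
      note lay = boundary_layer_bounds[OF l Kl dx]
      have e: "K * l / l * C = K * C" "K * l / l\<^sup>2 * C\<^sup>2 = K * C\<^sup>2 / l"
        using l by (auto simp: power2_eq_square)
      have "C + K * C \<le> (C + K * C) / l"
        using l small(1) d(3) K mult_left_mono[of l 1 "C + K * C"] by (simp add: field_simps)
      then have "C + (K * C + K * C\<^sup>2 / l) \<le> C0 / l" by (simp add: C0_def add_divide_distrib)
      moreover have "C + K * C \<le> C0" using K by (simp add: C0_def)
      moreover have "\<bar>a + - 1 * b\<bar> \<le> A + B" if "\<bar>a\<bar> \<le> A" "\<bar>b\<bar> \<le> B" for a b A B :: real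
        using that by linarith
      ultimately show ?thesis
        using lay[unfolded e] q(3)[OF x] by (meson order_trans)
    qed
    have inc: "inward_increasing D \<nu> \<zeta>"
      unfolding inward_increasing_def
    proof
      fix z assume z: "z \<in> frontier D"
      obtain \<delta>1 where \<delta>1: "\<delta>1 > 0" "\<And>s. 0 < s \<Longrightarrow> s < \<delta>1 \<Longrightarrow> s \<le> d (z - s *\<^sub>R \<nu> z)"
        using d(7)[OF z] by blast
      define \<delta> where "\<delta> = Min {\<delta>1, s0, l}"
      have \<delta>: "\<delta> > 0" "\<delta> \<le> \<delta>1" "\<delta> \<le> s0" "\<delta> \<le> l" using \<delta>1 s0 l by (auto simp: \<delta>_def)
      have "z - s *\<^sub>R \<nu> z \<in> D \<and> \<zeta> z + 1 * s \<le> \<zeta> (z - s *\<^sub>R \<nu> z)" if s: "0 < s" "s < \<delta>" for s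
      proof
        define w where "w = z - s *\<^sub>R \<nu> z"
        show "z - s *\<^sub>R \<nu> z \<in> D" using s0(2)[OF z, of s] s \<delta> by simp
        have "s \<le> d w" using \<delta>1(2)[of s] s \<delta> by (simp add: w_def)
        then have "K * l * exp (- d w / l) \<le> K * l - K * l / (2 * l) * s"
          using s \<delta> l Kl by (intro boundary_layer_gain) auto
        also have "K * l / (2 * l) * s = (C + 1) * s" using l by (simp add: K_def)
        finally have lay: "K * l * exp (- d w / l) \<le> K * l - (C + 1) * s" .
        have qw: "q w \<ge> q z - C * s" using s0(3)[OF z, of s] s \<delta> by (simp add: w_def)
        have "\<zeta> z = q z - K * l" using d(6)[OF z] by (simp add: \<zeta>_def)
        moreover have "\<zeta> w = q w - K * l * exp (- d w / l)" by (simp add: \<zeta>_def)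
        ultimately have "\<zeta> z + 1 * s \<le> \<zeta> w" using qw lay unfolding distrib_right by linarith
        then show "\<zeta> z + 1 * s \<le> \<zeta> (z - s *\<^sub>R \<nu> z)" by (simp add: w_def)
      qed
      then show "\<exists>c>0. \<exists>\<delta>>0. \<forall>s. 0 < s \<and> s < \<delta> \<longrightarrow> z - s *\<^sub>R \<nu> z \<in> D \<and> \<zeta> z + c * s \<le> \<zeta> (z - s *\<^sub>R \<nu> z)"
        using \<delta>(1) zero_less_one by blast
    qed
    have upper: "\<zeta> x \<le> q x" for x using Kl by (simp add: \<zeta>_def)
    have lower: "(M - 2) * \<epsilon> \<le> \<zeta> x" if M: "0 \<le> M" and x: "x \<in> D" "M * \<epsilon> \<le> q x" for M x
    proof -
      have "0 \<le> M * \<epsilon>" using M \<epsilon> by simp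
      then have "c0 \<le> d x" using c0(2)[OF x(1)] x(2) by linarith
      then have "- d x / l \<le> - c0 / l" using l by (intro divide_right_mono) auto
      then have "K * L * exp (- d x / l) \<le> K * L * exp (- c0 / l)" using K L by (intro mult_left_mono) auto
      then have "K * L * exp (- d x / l) \<le> 1" using small(2) by linarith
      from mult_left_mono[OF this less_imp_le[OF \<epsilon>(1)]]
      have "K * l * exp (- d x / l) \<le> \<epsilon>" by (simp add: l_def mult_ac)
      moreover have "(M - 2) * \<epsilon> = M * \<epsilon> - \<epsilon> - \<epsilon>" by (simp add: algebra_simps)
      ultimately show ?thesis using x(2) \<epsilon>(1) unfolding \<zeta>_def by linarith
    qed
    show "initial_barrier D \<nu> q C0 \<epsilon>"
      unfolding initial_barrier_def
      by (intro exI[of _ \<zeta>] exI conjI)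
        (rule cont, rule C2[folded \<zeta>_def], use bounds inc upper lower in \<open>auto simp: L_def l_def\<close>)
  qed
qed

text \<open>The bound from \<open>decaying_lower_bound\<close> has two roles: its final value is the
  estimate am - \<eta>, and its value on the whole time interval confines u to the range where the
  coordinate \<Theta> is a subsolution. Datum and barriers are left abstract so that both u and -u
  can be inserted.\<close>

lemma one_sided_generation:
  fixes D :: "'a::euclidean_space set" and f \<phi>1 \<phi>2 :: "real \<Rightarrow> real"
  assumes D: "open D" "bounded D" "D \<noteq> {}"
    and d: "continuous_on (closure D) d" "\<And>x. x \<in> closure D \<Longrightarrow> 0 \<le> d x \<and> d x \<le> C" "line_C2 D d d1 d2"
      "\<And>x b. x \<in> D \<Longrightarrow> b \<in> Basis \<Longrightarrow> \<bar>d1 b x\<bar> \<le> C \<and> \<bar>d2 b x\<bar> \<le> C" "inward_increasing D \<nu> d" "C > 0"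
    and f: "\<And>s. (f has_real_derivative f1 s) (at s)" "\<And>s. (f1 has_real_derivative f2 s) (at s)"
      "continuous_on UNIV f2" "{s. f s = 0} = {am, \<alpha>, ap}" "am < \<alpha>" "\<alpha> < ap" "f1 am < 0" "f1 \<alpha> > 0"
    and \<phi>: "continuous_on UNIV \<phi>1" "continuous_on UNIV \<phi>2" "\<And>y. \<phi>1 y \<ge> 0"
    and g: "continuous_on (closure D) g" and \<eta>: "0 < \<eta>" "\<eta> < ap - \<alpha>"
    and bar: "C1 > 0" "\<epsilon>1 > 0" "\<And>\<epsilon>. 0 < \<epsilon> \<Longrightarrow> \<epsilon> < \<epsilon>1 \<Longrightarrow> initial_barrier D \<nu> (\<lambda>x. g x - \<alpha>) C1 \<epsilon>"
  obtains \<epsilon>0 M0 where "\<epsilon>0 > 0" "M0 > 0"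
    "\<And>\<epsilon> u x. \<lbrakk>0 < \<epsilon>; \<epsilon> < \<epsilon>0; line_solution D \<nu> \<phi>1 \<phi>2 f \<epsilon> u; \<And>x. x \<in> closure D \<Longrightarrow> u x 0 = g x; x \<in> D\<rbrakk> \<Longrightarrow>
      am - \<eta> \<le> u x (\<epsilon>\<^sup>2 * \<bar>ln \<epsilon>\<bar> / f1 \<alpha>) \<and>
      (\<alpha> + M0 * \<epsilon> \<le> g x \<longrightarrow> ap - \<eta> \<le> u x (\<epsilon>\<^sup>2 * \<bar>ln \<epsilon>\<bar> / f1 \<alpha>))"
proof -
  define \<mu> where "\<mu> = f1 \<alpha>"
  have \<mu>: "\<mu> > 0" using f(8) by (simp add: \<mu>_def)
  have f_cont: "continuous_on UNIV f" by (rule DERIV_continuous_on[of UNIV]) (use f(1) in auto)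
  have f_zero: "f s = 0 \<longleftrightarrow> s = am \<or> s = \<alpha> \<or> s = ap" for s using f(4) by (auto simp: set_eq_iff)
  have f_left: "f s > 0" if "s < am" for s
    by (rule pos_left_of_zero[OF f_cont f(1,7) _ _ that]) (use f_zero f(5,6) in auto)
  have f_right: "f s > 0" if "\<alpha> < s" "s < ap" for s
    by (rule pos_right_of_zero[OF f_cont f(1,8) _ _ that]) (use f_zero f(5,6) in auto)
  have "compact (closure D)" "closure D \<noteq> {}" using D by (auto simp: compact_closure)
  then obtain m where m: "\<And>x. x \<in> closure D \<Longrightarrow> m \<le> g x"
    using continuous_attains_inf[OF _ _ g] by blast
  \<comment> \<open>The margin 2 \<eta> gives both A0 < am - \<eta> and A0 + \<eta> <= g; the same
    A0 is the lower end \<alpha> - B of the range for \<Theta>.\<close>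
  define A0 where "A0 = min m am - 2 * \<eta>"
  have A0: "A0 < am - \<eta>" "\<And>x. x \<in> closure D \<Longrightarrow> A0 + \<eta> \<le> g x"
    using \<eta> m by (auto simp: A0_def min_def) (smt (verit))+
  define B where "B = \<alpha> - A0"
  have B: "B > 0" "\<alpha> - B = A0" using A0 f(5) \<eta> by (auto simp: B_def)
  \<comment> \<open>J saturates at the level \<beta>, while only the lower level \<beta>' has to be
    reached; the gap \<eta> / 2 makes this happen at a finite z.\<close>
  define \<beta> where "\<beta> = ap - \<alpha> - \<eta> / 2"
  define \<beta>' where "\<beta>' = ap - \<alpha> - \<eta>"
  have \<beta>: "0 < \<beta>" "\<beta> < ap - \<alpha>" "\<beta>' < \<beta>" using \<eta> by (auto simp: \<beta>_def \<beta>'_def)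
  have "f \<alpha> = 0" using f_zero by simp
  obtain K0 where K0: "K0 \<ge> 0" "\<And>y. - B \<le> y \<Longrightarrow> y \<le> \<beta> \<Longrightarrow> f (\<alpha> + y) \<ge> \<mu> * y - K0 * y\<^sup>2"
    unfolding \<mu>_def using quadratic_lower_bound[OF f(1,2,3) \<open>f \<alpha> = 0\<close> B(1) \<beta>(1)] by blast
  have h_pos: "f (\<alpha> + y) > 0" if "0 < y" "y \<le> \<beta>" for y using f_right[of "\<alpha> + y"] that \<beta> by simp
  have h_cont: "continuous_on UNIV (\<lambda>y. f (\<alpha> + y))"
    by (rule continuous_on_compose2[OF f_cont]) (auto intro!: continuous_intros)
  obtain K where K: "K > 0" "\<And>y. - B \<le> y \<Longrightarrow> y \<le> \<beta> \<Longrightarrow> \<mu> * interface_coord K y \<le> interface_coord_deriv K y * f (\<alpha> + y)"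
    using interface_coord_subsolution[OF \<mu> K0(1) \<beta>(1) K0(2) h_pos h_cont] by blast
  obtain A2 where A2: "\<And>y. (interface_coord_deriv K has_real_derivative A2 y) (at y)" "continuous_on UNIV A2"
    using interface_coord_deriv_DERIV by blast
  have mono: "interface_coord K y < interface_coord K y'" if "y < y'" for y y'
    by (rule DERIV_pos_imp_increasing[OF that]) (use interface_coord_DERIV interface_coord_deriv_pos in blast)
  have mono_iff: "y < y'" if "interface_coord K y < interface_coord K y'" for y y'
    using that mono[of y' y] by (cases y y' rule: linorder_cases) auto
  define N where "N = interface_coord K \<beta>"
  have N: "N > 0" using interface_coord_ge[of K \<beta>] K \<beta> by (simp add: N_def)
  obtain e2 where e2: "e2 > 0" "e2 < 1" and low: "\<And>\<epsilon> u. \<lbrakk>0 < \<epsilon>; \<epsilon> < e2; line_solution D \<nu> \<phi>1 \<phi>2 f \<epsilon> u;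
      \<And>x. x \<in> closure D \<Longrightarrow> A0 + \<eta> \<le> u x 0\<rbrakk> \<Longrightarrow>
      (\<forall>x\<in>closure D. \<forall>t. 0 \<le> t \<and> t \<le> \<epsilon>\<^sup>2 * \<bar>ln \<epsilon>\<bar> / \<mu> \<longrightarrow> A0 < u x t) \<and>
      (\<forall>x\<in>closure D. am - \<eta> < u x (\<epsilon>\<^sup>2 * \<bar>ln \<epsilon>\<bar> / \<mu>))"
    using decaying_lower_bound[OF D(1,2) d(1-5) \<phi> f_cont f_left \<eta>(1) \<mu> d(6) A0(1)] by blast
  obtain C' where C': "C' > 0" and grow: "\<And>\<epsilon> u \<zeta> \<zeta>1 \<zeta>2 x. \<lbrakk>0 < \<epsilon>; \<epsilon> < 1; line_solution D \<nu> \<phi>1 \<phi>2 f \<epsilon> u;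
      \<And>x t. x \<in> closure D \<Longrightarrow> 0 \<le> t \<Longrightarrow> t \<le> \<epsilon>\<^sup>2 * \<bar>ln \<epsilon>\<bar> / \<mu> \<Longrightarrow> \<alpha> - B < u x t;
      continuous_on (closure D) \<zeta>; line_C2 D \<zeta> \<zeta>1 \<zeta>2;
      \<And>x b. x \<in> D \<Longrightarrow> b \<in> Basis \<Longrightarrow> \<bar>\<zeta>1 b x\<bar> \<le> C1;
      \<And>x b. x \<in> D \<Longrightarrow> b \<in> Basis \<Longrightarrow> \<bar>\<zeta>2 b x\<bar> \<le> C1 / (\<epsilon> * \<bar>ln \<epsilon>\<bar>);
      inward_increasing D \<nu> \<zeta>; \<And>x. x \<in> closure D \<Longrightarrow> \<zeta> x \<le> u x 0 - \<alpha>; x \<in> D\<rbrakk> \<Longrightarrow>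
      N * (1 - exp (- (\<zeta> x / \<epsilon> - C') / N)) < interface_coord K (u x (\<epsilon>\<^sup>2 * \<bar>ln \<epsilon>\<bar> / \<mu>) - \<alpha>)"
    unfolding N_def
  proof (rule interface_growth[where f = f and \<alpha> = \<alpha> and B = B and \<nu> = \<nu>, OF D(1,2) interface_coord_DERIV A2 interface_coord_deriv_pos
        interface_coord_ge[OF less_imp_le[OF K(1)]] \<mu> \<beta>(1) _ \<phi> less_imp_le[OF bar(1)]], goal_cases)
    case (1 y)
    from 1(2,3) show ?case by (rule K(2))
  next
    case (2 C')
    show ?case
    proof (rule 2(1))
      show "0 < C'" by (rule 2(2))
    qed (rule 2(3); blast)
  qed
  \<comment> \<open>J(z) reaches \<Theta>(\<beta>') exactly when exp (-z / N) <= r, which Z <= z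
    guarantees.\<close>
  define r where "r = 1 - interface_coord K \<beta>' / N"
  have r: "r > 0" using mono[OF \<beta>(3)] N by (simp add: r_def N_def)
  define Z where "Z = \<bar>N * ln r\<bar>"
  have Z: "interface_coord K \<beta>' \<le> N * (1 - exp (- z / N))" if "Z \<le> z" for z
  proof -
    have "- z / N \<le> ln r" using that N by (simp add: Z_def field_simps abs_le_iff)
    then have "exp (- z / N) \<le> r" using r by (metis exp_le_cancel_iff exp_ln)
    then have "N * exp (- z / N) \<le> N * r" using N by (intro mult_left_mono) auto
    then show ?thesis using N by (simp add: r_def algebra_simps)
  qed
  \<comment> \<open>The initial barrier loses 2 and the growth C', leaving Z. The bound exp (-M0) on
    \<epsilon> then provides M0 <= |ln \<epsilon>|.\<close>
  define M0 where "M0 = Z + C' + 2"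
  have M0: "M0 > 0" using C' by (simp add: M0_def Z_def add_nonneg_pos)
  define \<epsilon>0 where "\<epsilon>0 = Min {\<epsilon>1, e2, exp (- M0)}"
  have \<epsilon>0: "\<epsilon>0 > 0" "\<epsilon>0 \<le> \<epsilon>1" "\<epsilon>0 \<le> e2" "\<epsilon>0 \<le> exp (- M0)" using bar(2) e2 by (auto simp: \<epsilon>0_def)
  show ?thesis
  proof (rule that[OF \<epsilon>0(1) M0])
    fix \<epsilon> u x assume \<epsilon>: "0 < \<epsilon>" "\<epsilon> < \<epsilon>0" and sol: "line_solution D \<nu> \<phi>1 \<phi>2 f \<epsilon> u"
      and init: "\<And>x. x \<in> closure D \<Longrightarrow> u x 0 = g x" and x: "x \<in> D"
    have bounds: "(\<forall>x\<in>closure D. \<forall>t. 0 \<le> t \<and> t \<le> \<epsilon>\<^sup>2 * \<bar>ln \<epsilon>\<bar> / \<mu> \<longrightarrow> A0 < u x t) \<and>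
      (\<forall>x\<in>closure D. am - \<eta> < u x (\<epsilon>\<^sup>2 * \<bar>ln \<epsilon>\<bar> / \<mu>))"
      by (rule low[OF \<epsilon>(1) _ sol]) (use \<epsilon> \<epsilon>0 init A0(2) in auto)
    have "initial_barrier D \<nu> (\<lambda>x. g x - \<alpha>) C1 \<epsilon>" using bar(3) \<epsilon> \<epsilon>0 by simp
    then obtain \<zeta> \<zeta>1 \<zeta>2 where \<zeta>: "continuous_on (closure D) \<zeta>" "line_C2 D \<zeta> \<zeta>1 \<zeta>2"
      "\<And>x b. x \<in> D \<Longrightarrow> b \<in> Basis \<Longrightarrow> \<bar>\<zeta>1 b x\<bar> \<le> C1 \<and> \<bar>\<zeta>2 b x\<bar> \<le> C1 / (\<epsilon> * \<bar>ln \<epsilon>\<bar>)"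
      "inward_increasing D \<nu> \<zeta>" "\<And>x. x \<in> closure D \<Longrightarrow> \<zeta> x \<le> g x - \<alpha>"
      "\<And>M x. 0 \<le> M \<Longrightarrow> M \<le> \<bar>ln \<epsilon>\<bar> \<Longrightarrow> x \<in> D \<Longrightarrow> M * \<epsilon> \<le> g x - \<alpha> \<Longrightarrow> (M - 2) * \<epsilon> \<le> \<zeta> x"
      unfolding initial_barrier_def by blast
    have "\<epsilon> < 1" using \<epsilon> \<epsilon>0 e2 by simp
    have low_coord: "N * (1 - exp (- (\<zeta> x / \<epsilon> - C') / N)) < interface_coord K (u x (\<epsilon>\<^sup>2 * \<bar>ln \<epsilon>\<bar> / \<mu>) - \<alpha>)"
      by (rule grow[OF \<epsilon>(1) \<open>\<epsilon> < 1\<close> sol _ \<zeta>(1,2) _ _ \<zeta>(4) _ x]) (use bounds \<zeta>(3,5) init B(2) in auto)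
    have "am - \<eta> \<le> u x (\<epsilon>\<^sup>2 * \<bar>ln \<epsilon>\<bar> / \<mu>)" using bounds x closure_subset[of D] by (auto intro: less_imp_le)
    moreover have "ap - \<eta> \<le> u x (\<epsilon>\<^sup>2 * \<bar>ln \<epsilon>\<bar> / \<mu>)" if gx: "\<alpha> + M0 * \<epsilon> \<le> g x"
    proof -
      have "ln \<epsilon> \<le> - M0" using ln_mono[of \<epsilon> "exp (- M0)"] \<epsilon> \<epsilon>0(4) by simp
      then have "(M0 - 2) * \<epsilon> \<le> \<zeta> x" using M0 gx by (intro \<zeta>(6) x) auto
      then have "Z \<le> \<zeta> x / \<epsilon> - C'" using \<epsilon>(1) by (simp add: M0_def field_simps)
      from order_le_less_trans[OF Z[OF this] low_coord]
      have "\<beta>' < u x (\<epsilon>\<^sup>2 * \<bar>ln \<epsilon>\<bar> / \<mu>) - \<alpha>" by (rule mono_iff)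
      then show ?thesis by (simp add: \<beta>'_def)
    qed
    ultimately show "am - \<eta> \<le> u x (\<epsilon>\<^sup>2 * \<bar>ln \<epsilon>\<bar> / f1 \<alpha>) \<and>
      (\<alpha> + M0 * \<epsilon> \<le> g x \<longrightarrow> ap - \<eta> \<le> u x (\<epsilon>\<^sup>2 * \<bar>ln \<epsilon>\<bar> / f1 \<alpha>))"
      by (simp add: \<mu>_def)
  qed
qed

subsection \<open>Generation of interface\<close>

lemma continuous_eq_on_closure:
  fixes g h :: "'a::metric_space \<Rightarrow> real"
  assumes "continuous_on (closure S) g" "continuous_on (closure S) h" "\<And>x. x \<in> S \<Longrightarrow> g x = h x" "x \<in> closure S"
  shows "g x = h x"
proof -
  have "continuous_on (closure S) (\<lambda>x. g x - h x)" using assms(1,2) by (intro continuous_intros)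
  from continuous_constant_on_closure[OF this _ assms(4), of 0] assms(3) show ?thesis by simp
qed

text \<open>Reduces to the one-variable function s -> g(z - s n). The starting point z may lie on
  the boundary, so only continuity is available at s = 0.\<close>

lemma C2_normal_segment:
  fixes D :: "'a::euclidean_space set"
  assumes g: "continuous_on (closure D) g" "\<And>x. x \<in> D \<Longrightarrow> g differentiable (at x)"
      "\<And>x v. x \<in> D \<Longrightarrow> (\<lambda>y. frechet_derivative g (at y) v) differentiable (at x)"
      "\<And>x v. x \<in> D \<Longrightarrow> norm v = 1 \<Longrightarrow> \<bar>frechet_derivative g (at x) v\<bar> \<le> C"
      "\<And>x v. x \<in> D \<Longrightarrow> norm v = 1 \<Longrightarrow> \<bar>frechet_derivative (\<lambda>y. frechet_derivative g (at y) v) (at x) v\<bar> \<le> C"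
    and z: "z \<in> closure D" and n: "norm n = 1" and seg: "\<And>s. 0 < s \<Longrightarrow> s \<le> s0 \<Longrightarrow> z - s *\<^sub>R n \<in> D"
  shows "\<And>s. 0 < s \<Longrightarrow> s \<le> s0 \<Longrightarrow> \<bar>g (z - s *\<^sub>R n) - g z\<bar> \<le> C * s"
    and "\<And>s s1. 0 < s \<Longrightarrow> s < s1 \<Longrightarrow> s1 \<le> s0 \<Longrightarrow> a \<le> g (z - s1 *\<^sub>R n) \<Longrightarrow>
      g (z - s *\<^sub>R n) - a \<ge> (g z - a) - s * ((g z - a) / s1 + C * s1)"
proof -
  define q1 where "q1 = (\<lambda>s. frechet_derivative g (at (z - s *\<^sub>R n)) (- n))"
  define q2 where "q2 = (\<lambda>s. frechet_derivative (\<lambda>y. frechet_derivative g (at y) (- n)) (at (z - s *\<^sub>R n)) (- n))"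
  have shift: "((\<lambda>s. h (z - s *\<^sub>R n)) has_real_derivative frechet_derivative h (at (z - s *\<^sub>R n)) (- n)) (at s)"
    if "h differentiable (at (z - s *\<^sub>R n))" for h :: "'a \<Rightarrow> real" and s
  proof -
    have "((\<lambda>r. h (z - (r + s) *\<^sub>R n)) has_real_derivative frechet_derivative h (at (z - s *\<^sub>R n)) (- n)) (at 0)"
      using frechet_derivative_line[OF that, of "- n"] by (simp add: algebra_simps)
    then show ?thesis using DERIV_shift[of "\<lambda>r. h (z - r *\<^sub>R n)" _ 0 s] by simp
  qed
  have d1: "((\<lambda>s. g (z - s *\<^sub>R n)) has_real_derivative q1 s) (at s)"
    and d2: "(q1 has_real_derivative q2 s) (at s)" and b: "\<bar>q1 s\<bar> \<le> C" "\<bar>q2 s\<bar> \<le> C"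
    if "0 < s" "s \<le> s0" for s
    unfolding q1_def q2_def using seg[OF that] n by (auto intro!: shift g(2-5))
  have cont: "continuous_on {0..s1} (\<lambda>s. g (z - s *\<^sub>R n))" if "s1 \<le> s0" for s1
  proof (rule continuous_on_compose2[OF g(1)])
    show "(\<lambda>s. z - s *\<^sub>R n) ` {0..s1} \<subseteq> closure D"
    proof (rule image_subsetI)
      fix s assume s: "s \<in> {0..s1}"
      show "z - s *\<^sub>R n \<in> closure D"
        using z seg[of s] s that closure_subset[of D] by (cases "s = 0") auto
    qed
  qed (intro continuous_intros)
  show "\<bar>g (z - s *\<^sub>R n) - g z\<bar> \<le> C * s" if "0 < s" "s \<le> s0" for s
    using segment_slope_bound[OF cont[OF that(2)], of q1 C s] d1 b that by simp
  fix s s1 assume s: "0 < s" "s < s1" "s1 \<le> s0" "a \<le> g (z - s1 *\<^sub>R n)"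
  have "continuous_on {0..s1} (\<lambda>s. g (z - s *\<^sub>R n) - a)"
    by (intro continuous_intros cont s(3))
  moreover have "((\<lambda>s. g (z - s *\<^sub>R n) - a) has_real_derivative q1 r) (at r)" if "0 < r" "r \<le> s1" for r
    using DERIV_diff[OF d1 DERIV_const[of a]] that s by simp
  ultimately show "g (z - s *\<^sub>R n) - a \<ge> (g z - a) - s * ((g z - a) / s1 + C * s1)"
    using nonneg_segment_lower_bound[of s1 "\<lambda>s. g (z - s *\<^sub>R n) - a" q1 q2 C s] d2 b s by simp
qed

theorem theorem1p1:
  fixes D \<Gamma>\<^sub>0 Dm Dp :: "'a::euclidean_space set"
    and \<nu> n :: "'a \<Rightarrow> 'a"
    and f \<phi> :: "real \<Rightarrow> real"
    and u0 :: "'a \<Rightarrow> real"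
    and \<alpha>m \<alpha> \<alpha>p C\<phi> \<theta> \<eta> :: real
  assumes dim: "DIM('a) \<ge> 2"
    and domain: "smooth_bounded_domain D"
    and normal_D: "\<And>x. x \<in> frontier D \<Longrightarrow> outward_unit_normal D x (\<nu> x)"
    and f_C2: "Ck_on 2 f UNIV"
    and zeros_order: "\<alpha>m < \<alpha>" "\<alpha> < \<alpha>p"
    and f_zeros: "{s. f s = 0} = {\<alpha>m, \<alpha>, \<alpha>p}"
    and f_deriv: "deriv f \<alpha>m < 0" "deriv f \<alpha>p < 0" "deriv f \<alpha> > 0"
    and \<phi>_C4: "Ck_on 4 \<phi> UNIV"
    and \<phi>_deriv: "C\<phi> > 0" "\<And>s. deriv \<phi> s \<ge> C\<phi>"
    and balance: "integral {\<alpha>m..\<alpha>p} (\<lambda>s. deriv \<phi> s * f s) = 0"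
    and u0_C2: "Ck_closure 2 u0 D"
    and \<Gamma>\<^sub>0_eq: "\<Gamma>\<^sub>0 = {x \<in> D. u0 x = \<alpha>}"
    and \<theta>: "0 < \<theta>" "\<theta> < 1"
    and \<Gamma>\<^sub>0_hypersurface: "Ck_holder_hypersurface 4 \<theta> \<Gamma>\<^sub>0"
    and \<Gamma>\<^sub>0_inside: "compact (closure \<Gamma>\<^sub>0)" "closure \<Gamma>\<^sub>0 \<subseteq> D"
    and regions: "separates_into \<Gamma>\<^sub>0 D Dm Dp"
    and normal_Dm: "\<And>x. x \<in> \<Gamma>\<^sub>0 \<Longrightarrow> outward_unit_normal Dm x (n x)"
    and transversal: "\<And>x. x \<in> \<Gamma>\<^sub>0 \<Longrightarrow> gradient u0 x \<bullet> n x \<noteq> 0"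
    and u0_Dp: "\<And>x. x \<in> Dp \<Longrightarrow> u0 x > \<alpha>"
    and u0_Dm: "\<And>x. x \<in> Dm \<Longrightarrow> u0 x < \<alpha>"
    and \<eta>: "0 < \<eta>" "\<eta> < min (\<alpha> - \<alpha>m) (\<alpha>p - \<alpha>)"
  shows "\<exists>\<epsilon>\<^sub>0 M\<^sub>0. \<epsilon>\<^sub>0 > 0 \<and> M\<^sub>0 > 0 \<and>
    (\<forall>\<epsilon> u. 0 < \<epsilon> \<and> \<epsilon> < \<epsilon>\<^sub>0 \<and> classical_solution D \<nu> \<phi> f u0 \<epsilon> u \<longrightarrow>
      (let t = \<epsilon>\<^sup>2 * \<bar>ln \<epsilon>\<bar> / deriv f \<alpha> in
        (\<forall>x\<in>D. \<alpha>m - \<eta> \<le> u x t \<and> u x t \<le> \<alpha>p + \<eta>) \<and>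
        (\<forall>x\<in>D. u0 x \<ge> \<alpha> + M\<^sub>0 * \<epsilon> \<longrightarrow> u x t \<ge> \<alpha>p - \<eta>) \<and>
        (\<forall>x\<in>D. u0 x \<le> \<alpha> - M\<^sub>0 * \<epsilon> \<longrightarrow> u x t \<le> \<alpha>m + \<eta>)))"
proof -
  have D: "open D" "bounded D" "D \<noteq> {}" using domain by (auto simp: smooth_bounded_domain_def)
  define f1 where "f1 = deriv f"
  define f2 where "f2 = deriv f1"
  have f': "Ck_on (Suc (Suc 0)) f UNIV" using f_C2 by (simp add: numeral_2_eq_2)
  have f: "(f has_real_derivative f1 s) (at s)" "(f1 has_real_derivative f2 s) (at s)" "continuous_on UNIV f2" for s
    using Ck_on_real_Suc[OF f'] Ck_on_real_Suc[of 0 f1] by (auto simp: f1_def f2_def)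
  define \<phi>1 where "\<phi>1 = deriv \<phi>"
  define \<phi>2 where "\<phi>2 = deriv \<phi>1"
  have \<phi>': "Ck_on (Suc (Suc (Suc (Suc 0)))) \<phi> UNIV" using \<phi>_C4 by (simp add: eval_nat_numeral)
  have \<phi>1: "(\<phi> has_real_derivative \<phi>1 s) (at s)" "Ck_on (Suc (Suc (Suc 0))) \<phi>1 UNIV" for s
    using Ck_on_real_Suc[OF \<phi>'] by (auto simp: \<phi>1_def)
  have \<phi>2: "(\<phi>1 has_real_derivative \<phi>2 s) (at s)" "Ck_on (Suc (Suc 0)) \<phi>2 UNIV" for s
    using Ck_on_real_Suc[OF \<phi>1(2)] by (auto simp: \<phi>2_def)
  have \<phi>_cont: "continuous_on UNIV \<phi>1" "continuous_on UNIV \<phi>2"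
    using Ck_on_imp_continuous_on \<phi>1(2) \<phi>2(2) by blast+
  have \<phi>1_ge: "\<phi>1 s \<ge> C\<phi>" for s using \<phi>_deriv(2) by (simp add: \<phi>1_def)
  then have \<phi>1_nn: "\<phi>1 s \<ge> 0" for s using \<phi>_deriv(1) by (meson less_imp_le order_trans)

  obtain s0 where s0: "s0 > 0" "\<And>z s. z \<in> frontier D \<Longrightarrow> 0 < s \<Longrightarrow> s \<le> s0 \<Longrightarrow> z - s *\<^sub>R \<nu> z \<in> D"
    using inner_segments[OF domain normal_D] by blast
  obtain d d1 d2 Cd where d: "continuous_on UNIV d" "line_C2 D d d1 d2" "Cd > 0"
    "\<And>x b. x \<in> D \<Longrightarrow> b \<in> Basis \<Longrightarrow> \<bar>d1 b x\<bar> \<le> Cd \<and> \<bar>d2 b x\<bar> \<le> Cd"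
    "\<And>x. x \<in> closure D \<Longrightarrow> 0 \<le> d x \<and> d x \<le> Cd"
    "\<And>x. x \<in> D \<Longrightarrow> d x > 0" "\<And>x. x \<in> frontier D \<Longrightarrow> d x = 0"
    "\<And>z. z \<in> frontier D \<Longrightarrow> \<exists>\<delta>>0. \<forall>s. 0 < s \<and> s < \<delta> \<longrightarrow> s \<le> d (z - s *\<^sub>R \<nu> z)"
    using domain_barrier[OF domain normal_D] by blast
  have d_cont: "continuous_on (closure D) d" by (rule continuous_on_subset[OF d(1)]) simp
  have d_inc: "inward_increasing D \<nu> d"
    unfolding inward_increasing_def
  proof
    fix z assume z: "z \<in> frontier D"
    then obtain \<delta> where "\<delta> > 0" "\<And>s. 0 < s \<Longrightarrow> s < \<delta> \<Longrightarrow> s \<le> d (z - s *\<^sub>R \<nu> z)" using d(8) by blast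
    then show "\<exists>c>0. \<exists>\<delta>>0. \<forall>s. 0 < s \<and> s < \<delta> \<longrightarrow> z - s *\<^sub>R \<nu> z \<in> D \<and> d z + c * s \<le> d (z - s *\<^sub>R \<nu> z)"
      using s0 z d(7)[OF z] by (intro exI[of _ 1] conjI exI[of _ "min \<delta> s0"]) auto
  qed
  obtain Cg where g: "Cg > 0" "continuous_on (closure D) u0" "\<And>x. x \<in> D \<Longrightarrow> u0 differentiable (at x)"
    "\<And>x v. x \<in> D \<Longrightarrow> (\<lambda>y. frechet_derivative u0 (at y) v) differentiable (at x)"
    "\<And>x v. x \<in> D \<Longrightarrow> norm v = 1 \<Longrightarrow> \<bar>frechet_derivative u0 (at x) v\<bar> \<le> Cg"
    "\<And>x v. x \<in> D \<Longrightarrow> norm v = 1 \<Longrightarrow> \<bar>frechet_derivative (\<lambda>y. frechet_derivative u0 (at y) v) (at x) v\<bar> \<le> Cg"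
    using Ck_closure_2_bounds[OF D(1,2) u0_C2] by blast
  define C where "C = max Cd Cg"
  have C: "C > 0" "Cd \<le> C" "Cg \<le> C" using g(1) by (auto simp: C_def)
  have dC: "\<bar>d1 b x\<bar> \<le> C \<and> \<bar>d2 b x\<bar> \<le> C" if "x \<in> D" "b \<in> Basis" for x b using d(4)[OF that] C by auto
  have g56: "\<bar>frechet_derivative u0 (at x) v\<bar> \<le> C"
    "\<bar>frechet_derivative (\<lambda>y. frechet_derivative u0 (at y) v) (at x) v\<bar> \<le> C" if "x \<in> D" "norm v = 1" for x v
    using g(5,6)[OF that] C by auto
  have norm_\<nu>: "norm (\<nu> z) = 1" if "z \<in> frontier D" for z by (rule outward_unit_normal_norm[OF normal_D[OF that]])
  have frontier_closure: "z \<in> closure D" if "z \<in> frontier D" for z using that by (simp add: frontier_def)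
  have seg1: "\<bar>u0 (z - s *\<^sub>R \<nu> z) - u0 z\<bar> \<le> C * s" if "z \<in> frontier D" "0 < s" "s \<le> s0" for z s
    by (rule C2_normal_segment(1)[of D u0 C z "\<nu> z" s0 s])
      (use g(2-4) g56 frontier_closure norm_\<nu> s0 that in auto)
  have seg2: "u0 (z - s *\<^sub>R \<nu> z) - \<alpha> \<ge> (u0 z - \<alpha>) - s * ((u0 z - \<alpha>) / r + C * r)"
    if "z \<in> frontier D" "0 < s" "s < r" "r \<le> s0" "\<alpha> \<le> u0 (z - r *\<^sub>R \<nu> z)" for z s r
    by (rule C2_normal_segment(2)[of D u0 C z "\<nu> z" s0 s r \<alpha>])
      (use g(2-4) g56 frontier_closure norm_\<nu> s0 that in auto)
  define q1 where "q1 = (\<lambda>b x. frechet_derivative u0 (at x) b)"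
  define q2 where "q2 = (\<lambda>b x. frechet_derivative (\<lambda>y. frechet_derivative u0 (at y) b) (at x) b)"
  have u0_line: "line_C2 D u0 q1 q2"
    unfolding line_C2_def q1_def q2_def using g(3,4) by (auto intro!: frechet_derivative_line)
  have q12: "\<bar>q1 b x\<bar> \<le> C \<and> \<bar>q2 b x\<bar> \<le> C" if "x \<in> D" "b \<in> Basis" for x b
    using g56[of x b] that by (simp add: q1_def q2_def)

  \<comment> \<open>Since the frontier of Dm is \<open>\<Gamma>\<^sub>0\<close>, which lies in D,
    the closure of Dm is a compact subset of D; it contains every point of D with u0 <= \<alpha>.
    Compactness then yields both the bound c0 and a boundary collar where u0 > \<alpha>.\<close>
  have reg: "open Dm" "Dm \<union> Dp = D - \<Gamma>\<^sub>0" "frontier Dm = \<Gamma>\<^sub>0"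
    using regions by (auto simp: separates_into_def)
  have clDm: "closure Dm = Dm \<union> \<Gamma>\<^sub>0" "closure Dm \<subseteq> D"
    using reg closure_Un_frontier[of Dm] \<Gamma>\<^sub>0_inside(2) closure_subset[of \<Gamma>\<^sub>0] by auto
  have outside: "u0 x > \<alpha>" if "x \<in> D" "x \<notin> closure Dm" for x using that reg(2) clDm(1) u0_Dp by auto
  have below: "x \<in> closure Dm" if "x \<in> D" "u0 x \<le> \<alpha>" for x using outside[OF that(1)] that(2) by force
  have cDm: "compact (closure Dm)"
    using clDm(2) D(2) bounded_subset compact_eq_bounded_closed closed_closure by blast
  obtain c0 where c0: "c0 > 0" "\<And>x. x \<in> closure Dm \<Longrightarrow> c0 \<le> d x"
  proof (cases "closure Dm = {}")
    case False
    then obtain y where "y \<in> closure Dm" "\<And>x. x \<in> closure Dm \<Longrightarrow> d y \<le> d x"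
      using continuous_attains_inf[OF cDm _ continuous_on_subset[OF d(1)]] by blast
    then show ?thesis using that[of "d y"] d(6) clDm(2) by blast
  qed (use that[of 1] in auto)
  have "frontier D \<inter> closure Dm = {}" using clDm(2) D(1) by (auto simp: frontier_def interior_open)
  then obtain r where r: "r > 0" "\<And>x y. x \<in> frontier D \<Longrightarrow> y \<in> closure Dm \<Longrightarrow> r \<le> dist x y"
    using separate_compact_closed[OF compact_frontier_bounded[OF D(2)] closed_closure] by metis
  define s1 where "s1 = min s0 (r / 2)"
  have s1: "s1 > 0" "s1 \<le> s0" "s1 < r" using s0 r(1) by (auto simp: s1_def)
  have collar: "u0 (z - s *\<^sub>R \<nu> z) > \<alpha>" if z: "z \<in> frontier D" and s: "0 < s" "s \<le> s1" for z s
  proof (rule outside)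
    show "z - s *\<^sub>R \<nu> z \<in> D" using s0(2)[OF z] s s1 by simp
    have "dist z (z - s *\<^sub>R \<nu> z) < r" using norm_\<nu>[OF z] s s1 by (simp add: dist_norm)
    then show "z - s *\<^sub>R \<nu> z \<notin> closure Dm" using r(2)[OF z] by force
  qed
  have slope: "\<bar>u0 (z - s *\<^sub>R \<nu> z) - u0 z\<bar> \<le> C * s" if "z \<in> frontier D" "0 < s" "s \<le> s1" for z s
    using that s1 seg1 by simp
  \<comment> \<open>On the boundary itself only the weak inequality survives: a value below \<alpha>
    would persist a little inwards by the Lipschitz bound, against the collar.\<close>
  have u0_frontier: "u0 z \<ge> \<alpha>" if z: "z \<in> frontier D" for z
  proof (rule ccontr)
    assume neg: "\<not> u0 z \<ge> \<alpha>"
    define s where "s = min s1 ((\<alpha> - u0 z) / C)"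
    have s: "0 < s" "s \<le> s1" "C * s \<le> \<alpha> - u0 z" using neg s1 C(1) by (auto simp: s_def min_def field_simps)
    show False using slope[OF z s(1,2)] collar[OF z s(1,2)] s(3) by linarith
  qed

  have "\<alpha>p - \<alpha> > \<eta>" "\<alpha> - \<alpha>m > \<eta>" using \<eta> by auto
  \<comment> \<open>u0 - \<alpha> may vanish on the boundary, so the capped construction applies;
    the collar supplies nonnegativity along the normal segments.\<close>
  obtain C1 e1 where lower: "C1 > 0" "e1 > 0" "\<And>\<epsilon>. 0 < \<epsilon> \<Longrightarrow> \<epsilon> < e1 \<Longrightarrow> initial_barrier D \<nu> (\<lambda>x. u0 x - \<alpha>) C1 \<epsilon>"
  proof (rule initial_barrier_nonneg_boundary[OF d(1,2) C(1) dC _ d(7,8), of "\<lambda>x. u0 x - \<alpha>" q1 q2 s1])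
    show "continuous_on (closure D) (\<lambda>x. u0 x - \<alpha>)" by (intro continuous_intros g(2))
    show "line_C2 D (\<lambda>x. u0 x - \<alpha>) q1 q2" using line_C2_add[OF u0_line line_C2_const[of D "- \<alpha>"]] by simp
    show "u0 z - \<alpha> - s * ((u0 z - \<alpha>) / r + C * r) \<le> u0 (z - s *\<^sub>R \<nu> z) - \<alpha>"
      if "z \<in> frontier D" "0 < s" "s < r" "r \<le> s1" for z s r
      using that s1 collar[of z r] seg2[of z s r] by simp
  qed (use d(5) q12 s1 s0(2) u0_frontier collar in \<open>auto intro: less_imp_le that\<close>)
  \<comment> \<open>The set where \<alpha> - u0 >= 0 lies in the closure of Dm, hence at d >= c0,
    and the steep layer can be used.\<close>
  obtain C2 e2 where upper: "C2 > 0" "e2 > 0" "\<And>\<epsilon>. 0 < \<epsilon> \<Longrightarrow> \<epsilon> < e2 \<Longrightarrow> initial_barrier D \<nu> (\<lambda>x. - u0 x - - \<alpha>) C2 \<epsilon>"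
  proof (rule initial_barrier_interior[OF d(1,2) C(1) dC _ d(7,8), of "\<lambda>x. - u0 x - - \<alpha>" "\<lambda>b x. - q1 b x" "\<lambda>b x. - q2 b x" s1 c0])
    show "continuous_on (closure D) (\<lambda>x. - u0 x - - \<alpha>)" by (intro continuous_intros g(2))
    show "line_C2 D (\<lambda>x. - u0 x - - \<alpha>) (\<lambda>b x. - q1 b x) (\<lambda>b x. - q2 b x)"
      using line_C2_add[OF line_C2_cmult[OF u0_line, of "- 1"] line_C2_const[of D \<alpha>]] by simp
    show "- u0 z - - \<alpha> - C * s \<le> - u0 (z - s *\<^sub>R \<nu> z) - - \<alpha>" if "z \<in> frontier D" "0 < s" "s \<le> s1" for z s
      using slope[OF that] by linarith
    show "c0 \<le> d x" if "x \<in> D" "0 \<le> - u0 x - - \<alpha>" for x using c0(2) below[OF that(1)] that(2) by simp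
  qed (use d(5) q12 s1 s0(2) c0 in \<open>auto intro: that\<close>)

  obtain \<epsilon>a Ma where a: "\<epsilon>a > 0" "Ma > 0"
    "\<And>\<epsilon> u x. \<lbrakk>0 < \<epsilon>; \<epsilon> < \<epsilon>a; line_solution D \<nu> \<phi>1 \<phi>2 f \<epsilon> u; \<And>x. x \<in> closure D \<Longrightarrow> u x 0 = u0 x; x \<in> D\<rbrakk> \<Longrightarrow>
      \<alpha>m - \<eta> \<le> u x (\<epsilon>\<^sup>2 * \<bar>ln \<epsilon>\<bar> / f1 \<alpha>) \<and>
      (\<alpha> + Ma * \<epsilon> \<le> u0 x \<longrightarrow> \<alpha>p - \<eta> \<le> u x (\<epsilon>\<^sup>2 * \<bar>ln \<epsilon>\<bar> / f1 \<alpha>))"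
    using one_sided_generation[OF D d_cont d(5,2,4) d_inc d(3) f f_zeros zeros_order
        f_deriv(1,3)[folded f1_def] \<phi>_cont \<phi>1_nn g(2) \<eta>(1) \<open>\<alpha>p - \<alpha> > \<eta>\<close> lower] by blast
  \<comment> \<open>The reflected reaction -f(-s) exchanges the roles of the two stable zeros and
    has at -\<alpha> the same derivative \<mu>, so the time of observation is unchanged.\<close>
  have refl_f: "((\<lambda>s. - f (- s)) has_real_derivative f1 (- s)) (at s)"
    "((\<lambda>s. f1 (- s)) has_real_derivative - f2 (- s)) (at s)" for s
    using DERIV_minus[OF DERIV_mirror[THEN iffD1, OF f(1)]] DERIV_mirror[THEN iffD1, OF f(2)] by auto
  have refl_cont: "continuous_on UNIV (\<lambda>s. - f2 (- s))" "continuous_on UNIV (\<lambda>s. \<phi>1 (- s))" "continuous_on UNIV (\<lambda>s. - \<phi>2 (- s))"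
    by (intro continuous_intros continuous_on_compose2[OF f(3)] continuous_on_compose2[OF \<phi>_cont(1)]
        continuous_on_compose2[OF \<phi>_cont(2)]; simp)+
  have f_zero: "f s = 0 \<longleftrightarrow> s = \<alpha>m \<or> s = \<alpha> \<or> s = \<alpha>p" for s using f_zeros by (auto simp: set_eq_iff)
  have refl_zeros: "{s. - f (- s) = 0} = {- \<alpha>p, - \<alpha>, - \<alpha>m}" by (auto simp: f_zero)
  have refl_order: "- \<alpha>p < - \<alpha>" "- \<alpha> < - \<alpha>m" "\<eta> < - \<alpha>m - - \<alpha>" "f1 (- (- \<alpha>p)) < 0" "f1 (- (- \<alpha>)) > 0"
    using zeros_order \<open>\<alpha> - \<alpha>m > \<eta>\<close> f_deriv by (auto simp: f1_def)
  have refl_g: "continuous_on (closure D) (\<lambda>x. - u0 x)" by (intro continuous_intros g(2))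
  obtain \<epsilon>b Mb where b: "\<epsilon>b > 0" "Mb > 0"
    "\<And>\<epsilon> u x. \<lbrakk>0 < \<epsilon>; \<epsilon> < \<epsilon>b; line_solution D \<nu> (\<lambda>s. \<phi>1 (- s)) (\<lambda>s. - \<phi>2 (- s)) (\<lambda>s. - f (- s)) \<epsilon> u;
       \<And>x. x \<in> closure D \<Longrightarrow> u x 0 = - u0 x; x \<in> D\<rbrakk> \<Longrightarrow>
      - \<alpha>p - \<eta> \<le> u x (\<epsilon>\<^sup>2 * \<bar>ln \<epsilon>\<bar> / f1 (- (- \<alpha>))) \<and>
      (- \<alpha> + Mb * \<epsilon> \<le> - u0 x \<longrightarrow> - \<alpha>m - \<eta> \<le> u x (\<epsilon>\<^sup>2 * \<bar>ln \<epsilon>\<bar> / f1 (- (- \<alpha>))))"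
    using one_sided_generation[OF D d_cont d(5,2,4) d_inc d(3) refl_f refl_cont(1) refl_zeros refl_order(1,2,4,5)
        refl_cont(2,3) \<phi>1_nn refl_g \<eta>(1) refl_order(3) upper] by blast

  define \<epsilon>\<^sub>0 where "\<epsilon>\<^sub>0 = min \<epsilon>a \<epsilon>b"
  define M\<^sub>0 where "M\<^sub>0 = max Ma Mb"
  have "\<epsilon>\<^sub>0 > 0" "M\<^sub>0 > 0" using a b by (auto simp: \<epsilon>\<^sub>0_def M\<^sub>0_def)
  moreover have "\<alpha>m - \<eta> \<le> u x t \<and> u x t \<le> \<alpha>p + \<eta> \<and> (u0 x \<ge> \<alpha> + M\<^sub>0 * \<epsilon> \<longrightarrow> u x t \<ge> \<alpha>p - \<eta>) \<and>
      (u0 x \<le> \<alpha> - M\<^sub>0 * \<epsilon> \<longrightarrow> u x t \<le> \<alpha>m + \<eta>)"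
    if \<epsilon>: "0 < \<epsilon>" "\<epsilon> < \<epsilon>\<^sub>0" and cs: "classical_solution D \<nu> \<phi> f u0 \<epsilon> u" and x: "x \<in> D"
      and t: "t = \<epsilon>\<^sup>2 * \<bar>ln \<epsilon>\<bar> / deriv f \<alpha>" for \<epsilon> u x t
  proof -
    have sol: "line_solution D \<nu> \<phi>1 \<phi>2 f \<epsilon> u"
      by (rule classical_imp_line_solution[OF D(1) cs \<phi>1(1) \<phi>2(1) \<phi>1_ge \<phi>_deriv(1)])
    \<comment> \<open>The initial condition is imposed on D only, whereas the comparison starts from
      the closure; continuity bridges the difference.\<close>
    have "continuous_on (closure D \<times> {0..}) (\<lambda>(x, t). u x t)" using cs by (simp add: classical_solution_def)
    then have "continuous_on (closure D) (\<lambda>x. (\<lambda>(x, t). u x t) (x, 0))"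
      by (rule continuous_on_compose2) (auto intro!: continuous_intros)
    then have "continuous_on (closure D) (\<lambda>x. u x 0)" by simp
    then have init: "u y 0 = u0 y" if "y \<in> closure D" for y
      using continuous_eq_on_closure[OF _ g(2) _ that, of "\<lambda>x. u x 0"] cs by (simp add: classical_solution_def)
    have A: "\<alpha>m - \<eta> \<le> u x t \<and> (\<alpha> + Ma * \<epsilon> \<le> u0 x \<longrightarrow> \<alpha>p - \<eta> \<le> u x t)"
      using a(3)[OF \<epsilon>(1) _ sol init x] \<epsilon>(2) by (simp add: t f1_def \<epsilon>\<^sub>0_def)
    have B: "- \<alpha>p - \<eta> \<le> - u x t \<and> (- \<alpha> + Mb * \<epsilon> \<le> - u0 x \<longrightarrow> - \<alpha>m - \<eta> \<le> - u x t)"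
      using b(3)[OF \<epsilon>(1) _ line_solution_reflect[OF sol] _ x] init \<epsilon>(2) by (simp add: t f1_def \<epsilon>\<^sub>0_def)
    have "Ma * \<epsilon> \<le> M\<^sub>0 * \<epsilon>" "Mb * \<epsilon> \<le> M\<^sub>0 * \<epsilon>" using \<epsilon>(1) by (auto simp: M\<^sub>0_def)
    with A B show ?thesis by auto
  qed
  ultimately show ?thesis unfolding Let_def by blast
qed

end
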